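(* Let $G_1$ and $G_2$ be locally compact second countable groups and let $E_1\subseteq G_1$ and $E_2\subseteq G_2$ be closed sets. Then: (i) If $E_1$ and $E_2$ are sets of restricted multiplicity, then $E_1\times E_2$ is a set of restricted multiplicity (in $G_1\times G_2$). (ii) If $E_1$ and $E_2$ are sets of extended uniqueness, then $E_1\times E_2$ is a set of extended uniqueness (in $G_1\times G_2$).
   Context: Topological groups are assumed Hausdorff. For a locally compact group $G$, $M(G)$ is the Banach algebra (under convolution) of complex Borel measures on $G$; for a closed set $E\subseteq G$, $M(E)\subseteq M(G)$ is the set of measures with support contained in $E$. $L^p(G)$ is taken with respect to Haar measure. For $\mu\in M(G)$ the operator $\lambda(\mu)$ on $L^2(G)$ is $\lambda(\mu)\xi(g)=\int_G\xi(s^{-1}g)\,d\mu(s)$; $L^1(G)$ is identified with a closed ideal of $M(G)$. The reduced group $C^*$-algebra is $C_r^*(G)=\overline{\{\lambda(f): f\in L^1(G)\}}^{\|\cdot\|}\subseteq\mathcal{L}(L^2(G))$. A closed set $E\subseteq G$ is a set of extended uniqueness if $\lambda(M(E))\cap C_r^*(G)=\{0\}$; otherwise it is called a set of restricted multiplicity, or an $M_0$-set. *)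

theory Defs
  imports "HOL-Analysis.Analysis"
begin

(* Groups are types of class topological_group_add. The class group_add is not commutative, so
   this covers arbitrary topological groups: s + t stands for the product st, - s for the inverse
   and 0 for the identity. The order of the summands matters throughout. *)

instance prod :: (topological_group_add, topological_group_add) topological_group_add
proof
  fix a b :: "'a \<times> 'b"
  have f: "(fst \<longlongrightarrow> fst c) (nhds c)" and s: "(snd \<longlongrightarrow> snd c) (nhds c)" for c :: "'a \<times> 'b"
    by (auto intro!: tendsto_fst tendsto_snd filterlim_ident)
  have "((\<lambda>x. (fst (fst x) + fst (snd x), snd (fst x) + snd (snd x))) \<longlongrightarrow> (fst a + fst b, snd a + snd b))
          (nhds a \<times>\<^sub>F nhds b)"
    by (intro tendsto_intros filterlim_compose[OF f] filterlim_compose[OF s] filterlim_fst filterlim_snd)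
  then show "((\<lambda>x. fst x + snd x) \<longlongrightarrow> a + b) (nhds a \<times>\<^sub>F nhds b)"
    by (simp add: plus_prod_def)
  have "((\<lambda>x. (- fst x, - snd x)) \<longlongrightarrow> (- fst a, - snd a)) (nhds a)"
    by (intro tendsto_intros f s)
  then show "(uminus \<longlongrightarrow> - a) (nhds a)"
    by (simp add: uminus_prod_def[abs_def])
qed

(* Intended for locally compact second countable Hausdorff groups, where a Borel measure that is
   finite on compact sets is automatically regular. *)
definition left_haar_measure :: "'a::topological_group_add measure \<Rightarrow> bool" where
  "left_haar_measure m \<longleftrightarrow>
     sets m = sets borel \<and>
     (\<forall>K. compact K \<longrightarrow> emeasure m K < \<infinity>) \<and>
     emeasure m UNIV \<noteq> 0 \<and>
     (\<forall>a. \<forall>A\<in>sets borel. emeasure m ((\<lambda>x. a + x) ` A) = emeasure m A)"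


subsection \<open>Complex Borel measures\<close>

(* A countably additive set function on the Borel sets; its values elsewhere are never used. *)
definition complex_borel_measure :: "('a::topological_space set \<Rightarrow> complex) \<Rightarrow> bool" where
  "complex_borel_measure \<mu> \<longleftrightarrow>
     (\<forall>A :: nat \<Rightarrow> 'a set. range A \<subseteq> sets borel \<longrightarrow> disjoint_family A \<longrightarrow>
        (\<lambda>n. \<mu> (A n)) sums \<mu> (\<Union>n. A n))"

(* Positive part of the Jordan decomposition of a real-valued measure, by the formula
   nu+(A) = sup {nu(B) | B Borel, B \<subseteq> A}. The truncation of negative values by ennreal
   is harmless, as the supremum includes B = {}. The negative part is the positive part of -nu. *)
definition positive_variation :: "('a::topological_space set \<Rightarrow> real) \<Rightarrow> 'a measure" where
  "positive_variation \<nu> =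
     measure_of UNIV (sets borel) (\<lambda>A. SUP B\<in>{B \<in> sets borel. B \<subseteq> A}. ennreal (\<nu> B))"

definition signed_integral :: "('a::topological_space set \<Rightarrow> real) \<Rightarrow> ('a \<Rightarrow> complex) \<Rightarrow> complex" where
  "signed_integral \<nu> f =
     integral\<^sup>L (positive_variation \<nu>) f - integral\<^sup>L (positive_variation (\<lambda>A. - \<nu> A)) f"

definition complex_measure_integral :: "('a::topological_space set \<Rightarrow> complex) \<Rightarrow> ('a \<Rightarrow> complex) \<Rightarrow> complex" where
  "complex_measure_integral \<mu> f =
     signed_integral (\<lambda>A. Re (\<mu> A)) f + \<i> * signed_integral (\<lambda>A. Im (\<mu> A)) f"

(* x lies in the support iff no open neighbourhood of x is null for the total variation, that is,
   each one contains a Borel set of nonzero measure. *)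
definition measure_support :: "('a::topological_space set \<Rightarrow> complex) \<Rightarrow> 'a set" where
  "measure_support \<mu> =
     {x. \<forall>U. open U \<longrightarrow> x \<in> U \<longrightarrow> (\<exists>A\<in>sets borel. A \<subseteq> U \<and> \<mu> A \<noteq> 0)}"

definition measures_on :: "'a::topological_space set \<Rightarrow> ('a set \<Rightarrow> complex) set" where
  "measures_on E = {\<mu>. complex_borel_measure \<mu> \<and> measure_support \<mu> \<subseteq> E}"


subsection \<open>Operators on the Hilbert space of square-integrable functions\<close>

(* Elements of L2 and L1 are represented by functions and operators on L2 by maps between such
   functions; no quotient by almost-everywhere equality is formed. Identities between values of
   operators are therefore stated almost everywhere. *)

definition L1 :: "'a measure \<Rightarrow> ('a \<Rightarrow> complex) set" where
  "L1 m = {f. integrable m f}"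

definition L2 :: "'a measure \<Rightarrow> ('a \<Rightarrow> complex) set" where
  "L2 m = {\<xi> \<in> borel_measurable m. integrable m (\<lambda>x. (norm (\<xi> x))\<^sup>2)}"

definition L2_norm :: "'a measure \<Rightarrow> ('a \<Rightarrow> complex) \<Rightarrow> real" where
  "L2_norm m \<xi> = sqrt (\<integral>x. (norm (\<xi> x))\<^sup>2 \<partial>m)"

type_synonym 'a fun_op = "('a \<Rightarrow> complex) \<Rightarrow> ('a \<Rightarrow> complex)"

(* Boundedness and linearity force T to respect almost-everywhere equality. *)
definition L2_bounded_ops :: "'a measure \<Rightarrow> 'a fun_op set" where
  "L2_bounded_ops m = {T.
     (\<forall>\<xi>\<in>L2 m. T \<xi> \<in> L2 m) \<and>
     (\<forall>\<xi>\<in>L2 m. \<forall>\<eta>\<in>L2 m. AE x in m. T (\<lambda>y. \<xi> y + \<eta> y) x = T \<xi> x + T \<eta> x) \<and>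
     (\<forall>c. \<forall>\<xi>\<in>L2 m. AE x in m. T (\<lambda>y. c * \<xi> y) x = c * T \<xi> x) \<and>
     (\<exists>C. \<forall>\<xi>\<in>L2 m. L2_norm m (T \<xi>) \<le> C * L2_norm m \<xi>)}"

definition L2_zero_ops :: "'a measure \<Rightarrow> 'a fun_op set" where
  "L2_zero_ops m = {T. \<forall>\<xi>\<in>L2 m. AE x in m. T \<xi> x = 0}"

definition L2_opnorm :: "'a measure \<Rightarrow> 'a fun_op \<Rightarrow> real" where
  "L2_opnorm m T = Sup {L2_norm m (T \<xi>) | \<xi>. \<xi> \<in> L2 m \<and> L2_norm m \<xi> \<le> 1}"


subsection \<open>The reduced group C*-algebra and sets of multiplicity\<close>

(* The integral exists for almost every g. *)
definition conv_op :: "('a::topological_group_add set \<Rightarrow> complex) \<Rightarrow> 'a fun_op" where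
  "conv_op \<mu> \<xi> g = complex_measure_integral \<mu> (\<lambda>s. \<xi> (- s + g))"

(* The embedding of L1 into the measure algebra, f \<mapsto> f dm. *)
definition L1_measure :: "'a measure \<Rightarrow> ('a \<Rightarrow> complex) \<Rightarrow> 'a set \<Rightarrow> complex" where
  "L1_measure m f A = (\<integral>x\<in>A. f x \<partial>m)"

(* The operator-norm closure of the image of L1; the parameter m is the Haar measure. *)
definition reduced_Cstar :: "'a::topological_group_add measure \<Rightarrow> 'a fun_op set" where
  "reduced_Cstar m = {T \<in> L2_bounded_ops m.
     \<forall>\<epsilon>>0. \<exists>f\<in>L1 m. L2_opnorm m (\<lambda>\<xi> g. T \<xi> g - conv_op (L1_measure m f) \<xi> g) < \<epsilon>}"

(* Inclusion in L2_zero_ops says that the intersection is {0} modulo almost-everywhere equality;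
   the operator 0 = conv_op 0 always belongs to it. *)
definition extended_uniqueness :: "'a::topological_group_add measure \<Rightarrow> 'a set \<Rightarrow> bool" where
  "extended_uniqueness m E \<longleftrightarrow> conv_op ` measures_on E \<inter> reduced_Cstar m \<subseteq> L2_zero_ops m"

definition restricted_multiplicity :: "'a::topological_group_add measure \<Rightarrow> 'a set \<Rightarrow> bool" where
  "restricted_multiplicity m E \<longleftrightarrow> \<not> extended_uniqueness m E"

end

theory Submission
  imports Defs
begin

(* Up to a scalar, the Haar measure of G1 x G2 is m1 (x) m2, so everything may be computed there.

   (i) For mu in M(E1) and nu in M(E2) the operator lambda(mu x nu) is lambda(mu) (x) lambda(nu). It is
   approximated by lambda(f (x) g), where f is chosen close to mu first and then g close to nu relative
   to the L1 norm of f, since mu x nu - f x g = (mu - f) x nu + f x (nu - g).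

   (ii) Integrating mu in M(E1 x E2) against a coefficient u(t) = <lambda(t) xi, eta> in the second
   variable gives a measure in M(E1) whose convolution operator is the slice of lambda(mu) by the
   functional of xi and eta; slicing maps lambda(L1(G1 x G2)) to lambda(L1(G1)) and is bounded. If
   lambda(mu) is in the reduced C*-algebra, all these slices vanish, hence lambda(mu) = 0. *)

subsection \<open>Sums of measures\<close>

text \<open>No operator tensor products are formed. Membership of lambda(mu) in the reduced
  C*-algebra is restated as smallness of the convolution operator of the measure mu - f dm, since
  measures can be sliced and multiplied directly. In (i) the operator norm of mu - f is small, but
  in general not its total mass. Hence the estimate behind it is ||lambda(kappa x nu)|| <=
  ||lambda(kappa)|| ||nu||, operator norm on one factor and total mass on the other, and it forces
  the order in which f and g are chosen. In (ii) the final inference tests with indicators: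
  vanishing slices say that lambda(mu) applied to the indicator of a rectangle integrates to zero
  over every rectangle of finite measure. Two obstacles shape the rest. Integrals against a complex
  measure are defined by Jordan parts, which are not preserved by images, products or differences;
  \<open>represents\<close> replaces them by densities. And operator identities hold only almost
  everywhere, with a null set depending on the function, so that passages to the limit must use
  countably many functions or sets.\<close>

definition sum_measure :: "'a measure \<Rightarrow> 'a measure \<Rightarrow> 'a measure" where
  "sum_measure P Q = measure_of (space P) (sets P) (\<lambda>A. emeasure P A + emeasure Q A)"

lemma space_sum_measure [simp]: "space (sum_measure P Q) = space P"
  and sets_sum_measure [simp, measurable_cong]: "sets (sum_measure P Q) = sets P"
  by (simp_all add: sum_measure_def)

lemma emeasure_sum_measure:
  assumes "sets Q = sets P" "A \<in> sets P"
  shows "emeasure (sum_measure P Q) A = emeasure P A + emeasure Q A"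
  unfolding sum_measure_def
proof (rule emeasure_measure_of_sigma)
  show "countably_additive (sets P) (\<lambda>A. emeasure P A + emeasure Q A)"
  proof (rule countably_additiveI)
    fix A :: "nat \<Rightarrow> 'a set" assume A: "range A \<subseteq> sets P" "disjoint_family A"
    then have "(\<Sum>i. emeasure P (A i)) = emeasure P (\<Union>i. A i)" "(\<Sum>i. emeasure Q (A i)) = emeasure Q (\<Union>i. A i)"
      using assms(1) by (auto intro!: suminf_emeasure)
    then show "(\<Sum>i. emeasure P (A i) + emeasure Q (A i)) = emeasure P (\<Union>i. A i) + emeasure Q (\<Union>i. A i)"
      by (simp add: suminf_add[symmetric])
  qed
qed (use assms in \<open>auto simp: positive_def sets.sigma_algebra_axioms\<close>)

lemma finite_measure_sum_measure:
  assumes "finite_measure P" "finite_measure Q" "sets Q = sets P"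
  shows "finite_measure (sum_measure P Q)"
proof -
  have "space Q = space P" using assms(3) by (rule sets_eq_imp_space_eq)
  then show ?thesis using assms
    by (intro finite_measureI) (auto simp: emeasure_sum_measure finite_measure.emeasure_eq_measure)
qed

text \<open>The purpose of sums: P + Q dominates both P and Q, so that both have densities over one
  common measure.\<close>

lemma absolutely_continuous_sum_measure:
  assumes "sets Q = sets P" "absolutely_continuous P R \<or> absolutely_continuous Q R"
  shows "absolutely_continuous (sum_measure P Q) R"
  using assms unfolding absolutely_continuous_def
  by (auto simp: null_sets_def emeasure_sum_measure)


subsection \<open>Complex measures as densities\<close>

definition signed_borel_measure :: "('a::topological_space set \<Rightarrow> real) \<Rightarrow> bool" where
  "signed_borel_measure \<nu> \<longleftrightarrow>
     (\<forall>A :: nat \<Rightarrow> 'a set. range A \<subseteq> sets borel \<longrightarrow> disjoint_family A \<longrightarrow>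
        (\<lambda>n. \<nu> (A n)) sums \<nu> (\<Union>n. A n))"

lemma signed_borel_measure_uminus: "signed_borel_measure \<nu> \<Longrightarrow> signed_borel_measure (\<lambda>A. - \<nu> A)"
  unfolding signed_borel_measure_def by (auto intro: sums_minus)

lemma signed_borel_measure_empty:
  assumes "signed_borel_measure \<nu>" shows "\<nu> {} = 0"
proof -
  have "(\<lambda>n::nat. \<nu> {}) sums \<nu> (\<Union>n::nat. {})"
    using assms unfolding signed_borel_measure_def by (auto simp: disjoint_family_on_def)
  then have "(\<lambda>n::nat. \<nu> {}) \<longlonglongrightarrow> 0" by (metis sums_summable summable_LIMSEQ_zero)
  then show ?thesis by (simp add: LIMSEQ_const_iff)
qed

lemma signed_borel_measure_Un:
  assumes "signed_borel_measure \<nu>" "A \<in> sets borel" "B \<in> sets borel" "A \<inter> B = {}"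
  shows "\<nu> (A \<union> B) = \<nu> A + \<nu> B"
proof -
  have "(\<lambda>n. \<nu> (binaryset A B n)) sums \<nu> (\<Union>n. binaryset A B n)"
    using assms unfolding signed_borel_measure_def
    by (intro assms(1)[unfolded signed_borel_measure_def, rule_format])
       (auto simp: range_binaryset_eq disjoint_family_on_def binaryset_def)
  moreover have "(\<lambda>n. \<nu> (binaryset A B n)) sums (\<nu> A + \<nu> B)"
    by (rule binaryset_sums[where f = \<nu>, OF signed_borel_measure_empty[OF assms(1)]])
  ultimately show ?thesis by (simp add: UN_binaryset_eq sums_unique2)
qed

lemma signed_borel_measure_Diff:
  assumes "signed_borel_measure \<nu>" "A \<in> sets borel" "B \<in> sets borel" "B \<subseteq> A"
  shows "\<nu> (A - B) = \<nu> A - \<nu> B"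
  using signed_borel_measure_Un[of \<nu> B "A - B"] assms by (simp add: Un_absorb1)

lemma sets_positive_variation [simp, measurable_cong]: "sets (positive_variation \<nu>) = sets borel"
  and space_positive_variation [simp]: "space (positive_variation \<nu>) = UNIV"
  by (simp_all add: positive_variation_def sigma_algebra.sigma_sets_eq sets.sigma_algebra_axioms flip: space_borel)

text \<open>The content is that the supremum formula is countably additive; otherwise
  \<open>measure_of\<close> would not return it. One inequality joins subsets of finitely many
  disjoint sets into a subset of their union, the other cuts a subset of the union along the
  pieces.\<close>

lemma emeasure_positive_variation:
  assumes \<nu>: "signed_borel_measure \<nu>" and X: "X \<in> sets borel"
  shows "emeasure (positive_variation \<nu>) X = (SUP B\<in>{B \<in> sets borel. B \<subseteq> X}. ennreal (\<nu> B))"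
proof (rule emeasure_measure_of[OF positive_variation_def])
  let ?V = "\<lambda>A. SUP B\<in>{B \<in> sets borel. B \<subseteq> A}. ennreal (\<nu> B)"
  have "{B \<in> sets borel. B \<subseteq> {}} = {{} :: 'a set}" by auto
  then show "positive (sets (positive_variation \<nu>)) ?V"
    by (simp add: positive_def signed_borel_measure_empty[OF \<nu>])
  show "countably_additive (sets (positive_variation \<nu>)) ?V"
  proof (rule countably_additiveI)
    fix A :: "nat \<Rightarrow> 'a set"
    assume A: "range A \<subseteq> sets (positive_variation \<nu>)" and disj: "disjoint_family A"
    then have Ab [measurable]: "A n \<in> sets borel" for n by auto
    show "(\<Sum>n. ?V (A n)) = ?V (\<Union>n. A n)"
    proof (rule antisym)
      have fin: "(\<Sum>n<N. ?V (A n)) \<le> (SUP B\<in>{B \<in> sets borel. B \<subseteq> (\<Union>n<N. A n)}. ennreal (\<nu> B))" for N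
      proof (induction N)
        case (Suc N)
        have *: "ennreal (\<nu> B) + ennreal (\<nu> C) \<le> ?V (\<Union>n<Suc N. A n)"
          if B: "B \<in> sets borel" "B \<subseteq> (\<Union>n<N. A n)" and C: "C \<in> sets borel" "C \<subseteq> A N" for B C
        proof -
          have "(\<Union>n<N. A n) \<inter> A N = {}"
            using disjoint_family_onD[OF disj, of _ N] by fastforce
          then have "B \<inter> C = {}" using B C by blast
          then have BC: "\<nu> (B \<union> C) = \<nu> B + \<nu> C" using signed_borel_measure_Un[OF \<nu>] B C by blast
          have upper: "D \<in> sets borel \<Longrightarrow> D \<subseteq> (\<Union>n<Suc N. A n) \<Longrightarrow> ennreal (\<nu> D) \<le> ?V (\<Union>n<Suc N. A n)" for D
            by (rule SUP_upper) auto
          have 1: "ennreal (\<nu> B) \<le> ?V (\<Union>n<Suc N. A n)" using B by (intro upper) (auto simp: lessThan_Suc)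
          have 2: "ennreal (\<nu> C) \<le> ?V (\<Union>n<Suc N. A n)" using C by (intro upper) (auto simp: lessThan_Suc)
          have 3: "ennreal (\<nu> B + \<nu> C) \<le> ?V (\<Union>n<Suc N. A n)" unfolding BC[symmetric]
            using B C by (intro upper) (auto simp: lessThan_Suc)
          \<comment> \<open>The union of B and C serves when both values are positive. A value that
            is not positive is truncated to 0, and then the other set alone suffices.\<close>
          show ?thesis
          proof (cases "\<nu> B \<le> 0 \<or> \<nu> C \<le> 0")
            case True then show ?thesis using 1 2 by (auto simp: ennreal_neg)
          next
            case False then show ?thesis using 3 by (simp add: ennreal_plus[symmetric] del: ennreal_plus)
          qed
        qed
        have ne: "{B \<in> sets borel. B \<subseteq> D} \<noteq> {}" for D :: "'a set" by auto
        have "(\<Sum>n<Suc N. ?V (A n)) \<le> (SUP B\<in>{B \<in> sets borel. B \<subseteq> (\<Union>n<N. A n)}. ennreal (\<nu> B)) + ?V (A N)"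
          using Suc.IH by (simp add: add_right_mono)
        \<comment> \<open>A sum of two suprema over nonempty families is a double supremum, which
          \<open>*\<close> bounds term by term.\<close>
        also have "\<dots> = (SUP B\<in>{B \<in> sets borel. B \<subseteq> (\<Union>n<N. A n)}. (SUP C\<in>{B \<in> sets borel. B \<subseteq> A N}. ennreal (\<nu> B) + ennreal (\<nu> C)))"
          unfolding ennreal_SUP_add_left[OF ne, symmetric] ennreal_SUP_add_right[OF ne] by (rule SUP_commute)
        also have "\<dots> \<le> ?V (\<Union>n<Suc N. A n)"
          by (intro SUP_least) (use * in auto)
        finally show ?case .
      qed simp
      show "(\<Sum>n. ?V (A n)) \<le> ?V (\<Union>n. A n)"
      proof (rule suminf_le_const[OF summableI])
        show "(\<Sum>n<N. ?V (A n)) \<le> ?V (\<Union>n. A n)" for N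
          by (rule order_trans[OF fin], rule SUP_subset_mono) auto
      qed
      show "?V (\<Union>n. A n) \<le> (\<Sum>n. ?V (A n))"
      proof (rule SUP_least, clarify)
        fix B assume B [measurable]: "B \<in> sets borel" and sub: "B \<subseteq> (\<Union>n. A n)"
        have "(\<lambda>n. \<nu> (B \<inter> A n)) sums \<nu> (\<Union>n. B \<inter> A n)"
          by (rule \<nu>[unfolded signed_borel_measure_def, rule_format])
             (use disj in \<open>auto simp: disjoint_family_on_def\<close>)
        also have "(\<Union>n. B \<inter> A n) = B" using sub by auto
        finally have s: "(\<lambda>n. \<nu> (B \<inter> A n)) sums \<nu> B" .
        have le: "ennreal (\<Sum>n<N. \<nu> (B \<inter> A n)) \<le> (\<Sum>n. ?V (A n))" for N
        proof -
          \<comment> \<open>Truncation by \<open>ennreal\<close> is not additive across signs.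
            Replacing each term by its positive part first can only raise the real sum and leaves
            each truncated term unchanged.\<close>
          have max0: "ennreal (max 0 x) = ennreal x" for x :: real by (simp add: max_def ennreal_neg)
          have "ennreal (\<Sum>n<N. \<nu> (B \<inter> A n)) \<le> ennreal (\<Sum>n<N. max 0 (\<nu> (B \<inter> A n)))"
            by (intro ennreal_leI sum_mono) auto
          also have "\<dots> = (\<Sum>n<N. ennreal (\<nu> (B \<inter> A n)))"
            using sum_ennreal[of "{..<N}" "\<lambda>n. max 0 (\<nu> (B \<inter> A n))"] by (simp add: max0)
          also have "\<dots> \<le> (\<Sum>n<N. ?V (A n))"
            by (intro sum_mono SUP_upper) auto
          also have "\<dots> \<le> (\<Sum>n. ?V (A n))" by (intro sum_le_suminf summableI) auto
          finally show ?thesis .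
        qed
        have "(\<lambda>N. ennreal (\<Sum>n<N. \<nu> (B \<inter> A n))) \<longlonglongrightarrow> ennreal (\<nu> B)"
          using s unfolding sums_def by (intro tendsto_ennrealI)
        then show "ennreal (\<nu> B) \<le> (\<Sum>n. ?V (A n))"
          by (rule LIMSEQ_le_const2) (use le in auto)
      qed
    qed
  qed
qed (use X in auto)

text \<open>Classical exhaustion. If \<open>\<nu>\<close> is unbounded on the subsets of A, it is so
  on one of any two complementary parts of A. This yields a decreasing sequence whose successive
  differences are disjoint and have \<open>\<nu>\<close>-values of modulus at least 1, so their
  series cannot converge.\<close>

lemma signed_borel_measure_bounded:
  assumes \<nu>: "signed_borel_measure \<nu>"
  obtains K where "\<And>B. B \<in> sets borel \<Longrightarrow> \<bar>\<nu> B\<bar> \<le> K"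
proof -
  define unb where "unb A \<longleftrightarrow> (A \<in> sets borel \<and> (\<forall>K. \<exists>B\<in>sets borel. B \<subseteq> A \<and> \<bar>\<nu> B\<bar> > K))" for A
  have split: "unb B \<or> unb (A - B)" if A: "unb A" and B: "B \<in> sets borel" "B \<subseteq> A" for A B
  proof (rule ccontr)
    assume "\<not> ?thesis"
    moreover have "A - B \<in> sets borel" using A B by (auto simp: unb_def)
    ultimately obtain K1 K2
      where K: "\<And>C. C \<in> sets borel \<Longrightarrow> C \<subseteq> B \<Longrightarrow> \<bar>\<nu> C\<bar> \<le> K1"
        "\<And>C. C \<in> sets borel \<Longrightarrow> C \<subseteq> A - B \<Longrightarrow> \<bar>\<nu> C\<bar> \<le> K2"
      using A B unfolding unb_def by (force simp: not_less)
    obtain C where C: "C \<in> sets borel" "C \<subseteq> A" "\<bar>\<nu> C\<bar> > K1 + K2"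
      using A[unfolded unb_def, THEN conjunct2, rule_format, of "K1 + K2"] by blast
    have "\<nu> C = \<nu> (C \<inter> B) + \<nu> (C - B)"
      using signed_borel_measure_Diff[OF \<nu>, of C "C \<inter> B"] C B by (simp add: Diff_Int)
    moreover have "\<bar>\<nu> (C \<inter> B)\<bar> \<le> K1" "\<bar>\<nu> (C - B)\<bar> \<le> K2" using C B by (auto intro!: K)
    ultimately show False using C(3) by linarith
  qed
  have step: "\<exists>B. unb B \<and> B \<subseteq> A \<and> \<bar>\<nu> (A - B)\<bar> \<ge> 1" if unbA: "unb A" for A
  proof -
    have A: "A \<in> sets borel" using that by (simp add: unb_def)
    \<comment> \<open>The threshold makes both B and A - B large: the modulus of
      \<open>\<nu> (A - B)\<close> is at least that of \<open>\<nu> B\<close> minus that of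
      \<open>\<nu> A\<close>, hence exceeds 1. So either part may be kept and the other
      discarded.\<close>
    obtain B where B: "B \<in> sets borel" "B \<subseteq> A" "\<bar>\<nu> B\<bar> > \<bar>\<nu> A\<bar> + 1"
      using unbA[unfolded unb_def, THEN conjunct2, rule_format, of "\<bar>\<nu> A\<bar> + 1"] by blast
    have D: "\<nu> (A - B) = \<nu> A - \<nu> B" by (rule signed_borel_measure_Diff[OF \<nu> A B(1,2)])
    consider "unb B" | "unb (A - B)" using split[OF unbA B(1,2)] by blast
    then show ?thesis
    proof cases
      case 1 then show ?thesis using B D by (intro exI[of _ B]) auto
    next
      case 2
      have "A - (A - B) = B" using B by blast
      then show ?thesis using 2 B by (intro exI[of _ "A - B"]) auto
    qed
  qed
  have "\<not> unb UNIV"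
  proof
    assume "unb UNIV"
    have "\<exists>E. \<forall>n::nat. unb (E n) \<and> E (Suc n) \<subseteq> E n \<and> \<bar>\<nu> (E n - E (Suc n))\<bar> \<ge> 1"
      by (rule dependent_nat_choice[of "\<lambda>_. unb" "\<lambda>_ A B. B \<subseteq> A \<and> \<bar>\<nu> (A - B)\<bar> \<ge> 1"])
         (use \<open>unb UNIV\<close> step in blast)+
    then obtain E where E: "\<And>n::nat. unb (E n)" "\<And>n. E (Suc n) \<subseteq> E n \<and> \<bar>\<nu> (E n - E (Suc n))\<bar> \<ge> 1"
      by blast
    have dec: "E n \<subseteq> E m" if "m \<le> n" for m n
      using that E(2) by (induction n rule: dec_induct) auto
    have "disjoint_family (\<lambda>n. E n - E (Suc n))"
      unfolding disjoint_family_on_def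
    proof safe
      fix m n :: nat and x
      assume "m \<noteq> n" and x: "x \<in> E m" "x \<notin> E (Suc m)" "x \<in> E n" "x \<notin> E (Suc n)"
      then consider "Suc m \<le> n" | "Suc n \<le> m" by linarith
      then show "x \<in> {}" using dec[of "Suc m" n] dec[of "Suc n" m] x by cases blast+
    qed
    then have "(\<lambda>n. \<nu> (E n - E (Suc n))) sums \<nu> (\<Union>n. E n - E (Suc n))"
      using E(1) by (intro \<nu>[unfolded signed_borel_measure_def, rule_format]) (auto simp: unb_def)
    then have "(\<lambda>n. \<nu> (E n - E (Suc n))) \<longlonglongrightarrow> 0" by (metis sums_summable summable_LIMSEQ_zero)
    then have "eventually (\<lambda>n. \<bar>\<nu> (E n - E (Suc n))\<bar> < 1) sequentially"
      by (auto dest!: tendstoD[where e = 1] simp: dist_real_def)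
    then show False using E(2) by (auto simp: eventually_sequentially not_less[symmetric])
  qed
  then show ?thesis using that unfolding unb_def by (auto simp: not_less)
qed

lemma finite_measure_positive_variation:
  assumes \<nu>: "signed_borel_measure \<nu>"
  shows "finite_measure (positive_variation \<nu>)"
proof (rule finite_measureI)
  obtain K where K: "\<And>B. B \<in> sets borel \<Longrightarrow> \<bar>\<nu> B\<bar> \<le> K" using signed_borel_measure_bounded[OF \<nu>] by blast
  have "emeasure (positive_variation \<nu>) UNIV \<le> ennreal K"
    unfolding emeasure_positive_variation[OF \<nu> sets.top[of borel, unfolded space_borel]]
    by (intro SUP_least ennreal_leI) (use K abs_le_D1 in blast)
  then show "emeasure (positive_variation \<nu>) (space (positive_variation \<nu>)) \<noteq> \<infinity>"
    by (auto simp: top_unique)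
qed

text \<open>For B inside X, \<open>\<nu> B\<close> equals \<open>\<nu> X\<close> minus
  \<open>\<nu> (X - B)\<close>, which is at most \<open>\<nu> X\<close> plus the negative part of X.
  The supremum over B gives one inequality; the same inequality for the negated measure gives the
  other.\<close>

lemma measure_positive_variation_diff:
  assumes \<nu>: "signed_borel_measure \<nu>" and X: "X \<in> sets borel"
  shows "\<nu> X = measure (positive_variation \<nu>) X - measure (positive_variation (\<lambda>A. - \<nu> A)) X"
proof -
  have le: "measure (positive_variation \<nu>) X \<le> \<nu> X + measure (positive_variation (\<lambda>A. - \<nu> A)) X"
    if \<nu>: "signed_borel_measure \<nu>" for \<nu> :: "'a set \<Rightarrow> real"
  proof -
    let ?N = "positive_variation (\<lambda>A. - \<nu> A)"
    interpret P: finite_measure "positive_variation \<nu>" by (rule finite_measure_positive_variation[OF \<nu>])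
    interpret N: finite_measure ?N
      by (rule finite_measure_positive_variation[OF signed_borel_measure_uminus[OF \<nu>]])
    have B: "\<nu> B \<le> \<nu> X + measure ?N X" if "B \<in> sets borel" "B \<subseteq> X" for B
    proof -
      have "ennreal (- \<nu> (X - B)) \<le> emeasure ?N X"
        unfolding emeasure_positive_variation[OF signed_borel_measure_uminus[OF \<nu>] X]
        using that X by (intro SUP_upper) auto
      then have "- \<nu> (X - B) \<le> measure ?N X"
        using measure_nonneg[of ?N X] by (auto simp: N.emeasure_eq_measure ennreal_le_iff2)
      then show ?thesis using signed_borel_measure_Diff[OF \<nu> X that] by simp
    qed
    have nn: "0 \<le> \<nu> X + measure ?N X" using B[of "{}"] signed_borel_measure_empty[OF \<nu>] by simp
    have "emeasure (positive_variation \<nu>) X \<le> ennreal (\<nu> X + measure ?N X)"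
      unfolding emeasure_positive_variation[OF \<nu> X] by (intro SUP_least ennreal_leI) (use B in auto)
    then show ?thesis using nn by (simp add: P.emeasure_eq_measure)
  qed
  show ?thesis using le[OF \<nu>] le[OF signed_borel_measure_uminus[OF \<nu>]] by simp
qed

text \<open>Minimality of the Jordan parts: each value of \<open>\<nu>\<close> on a subset of X is
  bounded by A of that subset, hence by A of X.\<close>

lemma positive_variation_le:
  assumes \<nu>: "signed_borel_measure \<nu>" and A: "finite_measure A" "sets A = sets borel"
    and le: "\<And>X. X \<in> sets borel \<Longrightarrow> \<nu> X \<le> measure A X" and X: "X \<in> sets borel"
  shows "emeasure (positive_variation \<nu>) X \<le> emeasure A X"
  unfolding emeasure_positive_variation[OF \<nu> X]
proof (rule SUP_least, clarify)
  fix B assume B: "B \<in> sets borel" "B \<subseteq> X"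
  have "ennreal (\<nu> B) \<le> ennreal (measure A B)" by (intro ennreal_leI le B)
  also have "\<dots> = emeasure A B" by (simp add: A(1) finite_measure.emeasure_eq_measure)
  also have "\<dots> \<le> emeasure A X" by (intro emeasure_mono) (use A X B in auto)
  finally show "ennreal (\<nu> B) \<le> emeasure A X" .
qed

section \<open>Densities, and integration independent of the chosen decomposition\<close>

lemma finite_measure_real_density:
  assumes S: "finite_measure S" and P: "finite_measure P" "sets P = sets S" "absolutely_continuous S P"
  obtains p :: "'a \<Rightarrow> real" where "integrable S p" "\<And>x. 0 \<le> p x" "P = density S p"
proof -
  interpret S: finite_measure S by fact
  interpret P: finite_measure P by fact
  obtain D where D: "D \<in> borel_measurable S" "AE x in S. RN_deriv S P x = ennreal (D x)" "\<And>x. 0 \<le> D x"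
    using S.real_RN_deriv[OF P(1,3,2)] by blast
  have "density S (RN_deriv S P) = P" by (rule S.density_RN_deriv) (use P in auto)
  moreover have "density S (RN_deriv S P) = density S D" by (rule density_cong) (use D in auto)
  ultimately have eq: "P = density S D" by simp
  have "integrable S D"
  proof (rule integrableI_nonneg)
    have "emeasure P (space S) = (\<integral>\<^sup>+x. D x \<partial>S)"
      unfolding eq using D by (subst emeasure_density) (auto intro!: nn_integral_cong)
    then show "(\<integral>\<^sup>+x. ennreal (D x) \<partial>S) < \<infinity>" by (metis P.emeasure_finite infinity_ennreal_def less_top)
  qed (use D in auto)
  then show ?thesis using that eq D by blast
qed

lemma measure_density_real:
  assumes p: "integrable S p" "\<And>x. 0 \<le> p x" and X: "X \<in> sets S"
  shows "measure (density S p) X = (\<integral>x. indicator X x * p x \<partial>S)"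
proof -
  have "emeasure (density S p) X = (\<integral>\<^sup>+x. ennreal (indicator X x * p x) \<partial>S)"
    using p X by (subst emeasure_density) (auto intro!: nn_integral_cong simp: indicator_def)
  also have "\<dots> = ennreal (\<integral>x. indicator X x * p x \<partial>S)"
    using integrable_mult_indicator[OF X p(1)] p by (intro nn_integral_eq_integral) auto
  finally show ?thesis using p by (simp add: measure_def)
qed

text \<open>Frees \<open>signed_integral\<close> from the Jordan decomposition: any two finite
  measures with difference \<open>\<nu>\<close> compute it. All four measures get densities over A +
  B, and the two differences of densities agree almost everywhere because they have the same
  integral over every set.\<close>

lemma signed_integral_diff:
  assumes \<nu>: "signed_borel_measure \<nu>"
    and A: "finite_measure A" "sets A = sets borel" and B: "finite_measure B" "sets B = sets borel"
    and eq: "\<And>X. X \<in> sets borel \<Longrightarrow> \<nu> X = measure A X - measure B X"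
    and f: "integrable A f" "integrable B f"
  shows "signed_integral \<nu> f = integral\<^sup>L A f - integral\<^sup>L B f"
proof -
  define P where "P = positive_variation \<nu>"
  define N where "N = positive_variation (\<lambda>X. - \<nu> X)"
  define S where "S = sum_measure A B"
  have sets [simp]: "sets P = sets borel" "sets N = sets borel" "sets S = sets borel"
    by (simp_all add: P_def N_def S_def A)
  have sp [simp]: "space S = UNIV" using sets_eq_imp_space_eq[OF sets(3)] by simp
  have S: "finite_measure S" unfolding S_def using A B by (intro finite_measure_sum_measure) auto
  have fin: "finite_measure P" "finite_measure N"
    unfolding P_def N_def by (intro finite_measure_positive_variation signed_borel_measure_uminus \<nu>)+
  have nu_le: "\<nu> X \<le> measure A X" "- \<nu> X \<le> measure B X" if "X \<in> sets borel" for X using eq[OF that] by auto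
  \<comment> \<open>By minimality the Jordan parts lie below A and B. They inherit absolute
    continuity with respect to S from this, and f stays integrable against them.\<close>
  have PA: "emeasure P X \<le> emeasure A X" and NB: "emeasure N X \<le> emeasure B X" if "X \<in> sets borel" for X
    unfolding P_def N_def
    by (intro positive_variation_le signed_borel_measure_uminus \<nu> A B nu_le that; assumption)+
  have acA: "absolutely_continuous S A" and acB: "absolutely_continuous S B"
    unfolding S_def by (rule absolutely_continuous_sum_measure; simp add: A B absolutely_continuous_def)+
  have acP: "absolutely_continuous S P"
    using acA unfolding absolutely_continuous_def
  proof (safe, goal_cases)
    case (1 X)
    then have "X \<in> sets borel" "emeasure A X = 0" by (auto simp: A null_sets_def)
    then show ?case using PA[of X] by (simp add: null_sets_def)
  qed
  have acN: "absolutely_continuous S N"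
    using acB unfolding absolutely_continuous_def
  proof (safe, goal_cases)
    case (1 X)
    then have "X \<in> sets borel" "emeasure B X = 0" by (auto simp: B null_sets_def)
    then show ?case using NB[of X] by (simp add: null_sets_def)
  qed
  obtain a where a: "integrable S a" "\<And>x. 0 \<le> a x" "A = density S a"
    using finite_measure_real_density[OF S A(1) _ acA] A(2) by auto
  obtain b where b: "integrable S b" "\<And>x. 0 \<le> b x" "B = density S b"
    using finite_measure_real_density[OF S B(1) _ acB] B(2) by auto
  obtain p where p: "integrable S p" "\<And>x. 0 \<le> p x" "P = density S p"
    using finite_measure_real_density[OF S fin(1) _ acP] by auto
  obtain n where n: "integrable S n" "\<And>x. 0 \<le> n x" "N = density S n"
    using finite_measure_real_density[OF S fin(2) _ acN] by auto
  have bm: "f \<in> borel_measurable S"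
    using f(1) A(2) by (metis borel_measurable_integrable measurable_cong_sets sets(3))
  \<comment> \<open>Both sides are densities of \<open>\<nu>\<close> over S.\<close>
  have "AE x in S. p x - n x = a x - b x"
  proof (rule density_unique_real)
    fix X assume "X \<in> sets S"
    then have X: "X \<in> sets borel" "X \<in> sets S" by auto
    have int: "set_integrable S X u" if "integrable S u" for u :: "'a \<Rightarrow> real"
      unfolding set_integrable_def using integrable_mult_indicator[OF X(2) that] .
    have meas: "(\<integral>x\<in>X. u x \<partial>S) = measure (density S u) X" if "integrable S u" "\<And>x. 0 \<le> u x" for u
      using measure_density_real[OF that X(2)] by (simp add: set_lebesgue_integral_def)
    have "(\<integral>x\<in>X. p x - n x \<partial>S) = measure P X - measure N X"
      using p n meas[of p] meas[of n] by (simp add: set_integral_diff int)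
    also have "\<dots> = \<nu> X" unfolding P_def N_def by (rule measure_positive_variation_diff[OF \<nu> X(1), symmetric])
    also have "\<dots> = measure A X - measure B X" by (rule eq[OF X(1)])
    also have "\<dots> = (\<integral>x\<in>X. a x - b x \<partial>S)"
      using a b meas[of a] meas[of b] by (simp add: set_integral_diff int)
    finally show "(\<integral>x\<in>X. p x - n x \<partial>S) = (\<integral>x\<in>X. a x - b x \<partial>S)" .
  qed (use a b p n in auto)
  then have pnab: "AE x in S. p x *\<^sub>R f x - n x *\<^sub>R f x = a x *\<^sub>R f x - b x *\<^sub>R f x"
    by eventually_elim (simp flip: scaleR_diff_left)
  have "integrable P f"
  proof (rule integrableI_bounded)
    have "(\<integral>\<^sup>+x. norm (f x) \<partial>P) \<le> (\<integral>\<^sup>+x. norm (f x) \<partial>A)"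
      by (rule nn_integral_mono_measure) (simp_all add: le_measure A PA)
    then show "(\<integral>\<^sup>+x. norm (f x) \<partial>P) < \<infinity>" using f(1) by (auto simp: integrable_iff_bounded)
  qed (use bm p in simp)
  then have iP: "integrable S (\<lambda>x. p x *\<^sub>R f x)"
    using p bm by (simp add: integrable_density)
  have "integrable N f"
  proof (rule integrableI_bounded)
    have "(\<integral>\<^sup>+x. norm (f x) \<partial>N) \<le> (\<integral>\<^sup>+x. norm (f x) \<partial>B)"
      by (rule nn_integral_mono_measure) (simp_all add: le_measure B NB)
    then show "(\<integral>\<^sup>+x. norm (f x) \<partial>N) < \<infinity>" using f(2) by (auto simp: integrable_iff_bounded)
  qed (use bm n in simp)
  then have iN: "integrable S (\<lambda>x. n x *\<^sub>R f x)"
    using n bm by (simp add: integrable_density)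
  have iA: "integrable S (\<lambda>x. a x *\<^sub>R f x)" using f(1) a bm by (simp add: integrable_density)
  have iB: "integrable S (\<lambda>x. b x *\<^sub>R f x)" using f(2) b bm by (simp add: integrable_density)
  have "signed_integral \<nu> f = integral\<^sup>L P f - integral\<^sup>L N f" by (simp add: signed_integral_def P_def N_def)
  also have "\<dots> = (\<integral>x. p x *\<^sub>R f x - n x *\<^sub>R f x \<partial>S)"
    using p n iP iN bm by (simp add: integral_density)
  also have "\<dots> = (\<integral>x. a x *\<^sub>R f x - b x *\<^sub>R f x \<partial>S)"
    using pnab iP iN iA iB by (intro integral_cong_AE) auto
  also have "\<dots> = integral\<^sup>L A f - integral\<^sup>L B f"
    using a b iA iB bm by (simp add: integral_density)
  finally show ?thesis .
qed

lemma complex_borel_measure_Re: "complex_borel_measure \<mu> \<Longrightarrow> signed_borel_measure (\<lambda>A. Re (\<mu> A))"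
  and complex_borel_measure_Im: "complex_borel_measure \<mu> \<Longrightarrow> signed_borel_measure (\<lambda>A. Im (\<mu> A))"
  unfolding complex_borel_measure_def signed_borel_measure_def by (auto intro!: sums_Re sums_Im)

(* mu is the image under pi of the complex measure h dM. Allowing an arbitrary space for M and an
   arbitrary map pi keeps slices and products of complex measures in this form. *)
definition represents ::
    "('a::topological_space set \<Rightarrow> complex) \<Rightarrow> 'w measure \<Rightarrow> ('w \<Rightarrow> 'a) \<Rightarrow> ('w \<Rightarrow> complex) \<Rightarrow> bool" where
  "represents \<mu> M \<pi> h \<longleftrightarrow> sigma_finite_measure M \<and> \<pi> \<in> borel_measurable M \<and> integrable M h \<and>
     (\<forall>A\<in>sets borel. \<mu> A = (\<integral>w. indicator A (\<pi> w) * h w \<partial>M))"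

lemma representsD:
  assumes "represents \<mu> M \<pi> h"
  shows "sigma_finite_measure M" "\<pi> \<in> borel_measurable M" "integrable M h" "h \<in> borel_measurable M"
    "A \<in> sets borel \<Longrightarrow> \<mu> A = (\<integral>w. indicator A (\<pi> w) * h w \<partial>M)"
  using assms unfolding represents_def by auto

lemma represents_complex_borel_measure:
  assumes r: "represents \<mu> M \<pi> h"
  shows "complex_borel_measure \<mu>"
  unfolding complex_borel_measure_def
proof (intro allI impI)
  fix A :: "nat \<Rightarrow> 'a set" assume A: "range A \<subseteq> sets borel" and disj: "disjoint_family A"
  note [measurable] = representsD(2,4)[OF r]
  have Ab [measurable]: "A n \<in> sets borel" for n using A by auto
  have int: "integrable M (\<lambda>w. indicator B (\<pi> w) * h w)" if [measurable]: "B \<in> sets borel" for B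
    by (rule Bochner_Integration.integrable_bound[OF representsD(3)[OF r]]) (auto simp: indicator_def)
  have "(\<lambda>N. \<integral>w. indicator (\<Union>n<N. A n) (\<pi> w) * h w \<partial>M) \<longlonglongrightarrow> (\<integral>w. indicator (\<Union>n. A n) (\<pi> w) * h w \<partial>M)"
  proof (rule integral_dominated_convergence[where w = "\<lambda>w. norm (h w)"])
    show "AE w in M. (\<lambda>N. indicator (\<Union>n<N. A n) (\<pi> w) * h w) \<longlonglongrightarrow> indicator (\<Union>n. A n) (\<pi> w) * h w"
      by (intro AE_I2 tendsto_mult LIMSEQ_indicator_UN tendsto_const)
    show "integrable M (\<lambda>w. norm (h w))" using representsD(3)[OF r] by simp
  qed (auto simp: indicator_def)
  moreover have "(\<integral>w. indicator (\<Union>n<N. A n) (\<pi> w) * h w \<partial>M) = (\<Sum>n<N. \<mu> (A n))" for N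
  proof -
    have "indicator (\<Union>n<N. A n) (\<pi> w) * h w = (\<Sum>n<N. indicator (A n) (\<pi> w) * h w)" for w
      using disj by (subst indicator_UN_disjoint) (auto simp: sum_distrib_right disjoint_family_on_def)
    then have "(\<integral>w. indicator (\<Union>n<N. A n) (\<pi> w) * h w \<partial>M) = (\<integral>w. (\<Sum>n<N. indicator (A n) (\<pi> w) * h w) \<partial>M)"
      by presburger
    also have "\<dots> = (\<Sum>n<N. \<integral>w. indicator (A n) (\<pi> w) * h w \<partial>M)"
      by (intro Bochner_Integration.integral_sum int Ab)
    finally show ?thesis by (simp add: representsD(5)[OF r])
  qed
  ultimately show "(\<lambda>n. \<mu> (A n)) sums \<mu> (\<Union>n. A n)"
    unfolding sums_def by (simp add: representsD(5)[OF r])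
qed

text \<open>Splits r into its positive and negative parts and maps both to the target by
  \<open>\<pi>\<close>. The images need not be the Jordan parts, as \<open>\<pi>\<close> may
  identify points where r has opposite signs; this is why \<open>signed_integral_diff\<close> admits
  arbitrary decompositions.\<close>

lemma signed_integral_represented:
  fixes r :: "'w \<Rightarrow> real" and f :: "'a::topological_space \<Rightarrow> complex"
  assumes \<nu>: "signed_borel_measure \<nu>" and \<pi> [measurable]: "\<pi> \<in> borel_measurable M" and r: "integrable M r"
    and eq: "\<And>X. X \<in> sets borel \<Longrightarrow> \<nu> X = (\<integral>w. indicator X (\<pi> w) * r w \<partial>M)"
    and f [measurable]: "f \<in> borel_measurable borel" and int: "integrable M (\<lambda>w. r w *\<^sub>R f (\<pi> w))"
  shows "signed_integral \<nu> f = (\<integral>w. r w *\<^sub>R f (\<pi> w) \<partial>M)"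
proof -
  \<comment> \<open>Stated for every s between 0 and the modulus of r, so that one argument serves
    the positive and the negative part.\<close>
  have part: "finite_measure (distr (density M s) borel \<pi>)" (is ?fin)
    "\<And>X. X \<in> sets borel \<Longrightarrow> measure (distr (density M s) borel \<pi>) X = (\<integral>w. indicator X (\<pi> w) * s w \<partial>M)"
    "integrable (distr (density M s) borel \<pi>) f"
    "integral\<^sup>L (distr (density M s) borel \<pi>) f = (\<integral>w. s w *\<^sub>R f (\<pi> w) \<partial>M)"
    "integrable M (\<lambda>w. s w *\<^sub>R f (\<pi> w))"
    if s: "integrable M s" "\<And>w. 0 \<le> s w" "\<And>w. s w \<le> \<bar>r w\<bar>" for s :: "'w \<Rightarrow> real"
  proof -
    have [measurable]: "s \<in> borel_measurable M" using s by auto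
    show intM: "integrable M (\<lambda>w. s w *\<^sub>R f (\<pi> w))"
      by (rule Bochner_Integration.integrable_bound[OF int]) (use s in \<open>auto intro!: mult_right_mono\<close>)
    have "emeasure (density M s) (space M) = (\<integral>\<^sup>+w. s w \<partial>M)"
      by (subst emeasure_density) (auto intro!: nn_integral_cong)
    also have "\<dots> < \<infinity>" using s by (simp add: nn_integral_eq_integral)
    finally have "finite_measure (density M s)" by (intro finite_measureI) auto
    then show ?fin by (rule finite_measure.finite_measure_distr) simp
    show "measure (distr (density M s) borel \<pi>) X = (\<integral>w. indicator X (\<pi> w) * s w \<partial>M)" if [measurable]: "X \<in> sets borel" for X
    proof -
      have "measure (distr (density M s) borel \<pi>) X = (\<integral>w. indicator (\<pi> -` X \<inter> space M) w * s w \<partial>M)"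
        by (subst measure_distr) (auto intro!: measure_density_real s)
      also have "\<dots> = (\<integral>w. indicator X (\<pi> w) * s w \<partial>M)"
        by (intro Bochner_Integration.integral_cong) (auto simp: indicator_def)
      finally show ?thesis .
    qed
    show "integrable (distr (density M s) borel \<pi>) f"
      using s intM by (simp add: integrable_distr_eq integrable_density)
    show "integral\<^sup>L (distr (density M s) borel \<pi>) f = (\<integral>w. s w *\<^sub>R f (\<pi> w) \<partial>M)"
      using s by (simp add: integral_distr integral_density)
  qed
  define p n where "p w = max 0 (r w)" and "n w = max 0 (- r w)" for w
  have pn: "r w = p w - n w" for w by (auto simp: p_def n_def)
  have p: "integrable M p" "\<And>w. 0 \<le> p w" "\<And>w. p w \<le> \<bar>r w\<bar>" and n: "integrable M n" "\<And>w. 0 \<le> n w" "\<And>w. n w \<le> \<bar>r w\<bar>"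
    using integrable_max[OF integrable_zero r] integrable_max[OF integrable_zero, of M "\<lambda>w. - r w"] r
    by (auto simp: p_def[abs_def] n_def[abs_def])
  have "signed_integral \<nu> f = integral\<^sup>L (distr (density M p) borel \<pi>) f - integral\<^sup>L (distr (density M n) borel \<pi>) f"
  proof (rule signed_integral_diff[OF \<nu>])
    fix X :: "'a set" assume X [measurable]: "X \<in> sets borel"
    have "integrable M (\<lambda>w. indicator X (\<pi> w) * u w)" if "integrable M u" for u :: "'w \<Rightarrow> real"
      by (rule Bochner_Integration.integrable_bound[OF that]) (use that in \<open>auto simp: indicator_def\<close>)
    then show "\<nu> X = measure (distr (density M p) borel \<pi>) X - measure (distr (density M n) borel \<pi>) X"
      using p n by (simp add: part(2)[OF p] part(2)[OF n] eq[OF X] pn right_diff_distrib)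
  qed (use part[OF p] part[OF n] in simp_all)
  also have "\<dots> = (\<integral>w. r w *\<^sub>R f (\<pi> w) \<partial>M)"
    using part[OF p] part[OF n] by (simp add: pn scaleR_diff_left)
  finally show ?thesis .
qed

text \<open>All later evaluations of \<open>complex_measure_integral\<close> go through this
  formula, which turns them into Bochner integrals accessible to Fubini and dominated
  convergence.\<close>

lemma represents_integral:
  assumes r: "represents \<mu> M \<pi> h" and f [measurable]: "f \<in> borel_measurable borel"
    and int: "integrable M (\<lambda>w. f (\<pi> w) * h w)"
  shows "complex_measure_integral \<mu> f = (\<integral>w. f (\<pi> w) * h w \<partial>M)"
proof -
  note [measurable] = representsD(2,4)[OF r]
  note \<mu> = represents_complex_borel_measure[OF r]
  have intX: "integrable M (\<lambda>w. indicator X (\<pi> w) * h w)" if [measurable]: "X \<in> sets borel" for X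
    by (rule Bochner_Integration.integrable_bound[OF representsD(3)[OF r]]) (auto simp: indicator_def)
  have bound: "integrable M (\<lambda>w. u w *\<^sub>R f (\<pi> w))"
    if [measurable]: "u \<in> borel_measurable M" and "\<And>w. \<bar>u w\<bar> \<le> norm (h w)" for u
    by (rule Bochner_Integration.integrable_bound[OF int])
       (use that in \<open>auto simp: norm_mult mult.commute intro!: mult_right_mono\<close>)
  have iRe: "integrable M (\<lambda>w. Re (h w) *\<^sub>R f (\<pi> w))" and iIm: "integrable M (\<lambda>w. Im (h w) *\<^sub>R f (\<pi> w))"
    by (rule bound; simp add: abs_Re_le_cmod abs_Im_le_cmod)+
  have Re: "signed_integral (\<lambda>A. Re (\<mu> A)) f = (\<integral>w. Re (h w) *\<^sub>R f (\<pi> w) \<partial>M)"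
  proof (rule signed_integral_represented[OF complex_borel_measure_Re[OF \<mu>]])
    fix X :: "'a set" assume X: "X \<in> sets borel"
    have "(\<lambda>w. Re (indicator X (\<pi> w) * h w)) = (\<lambda>w. indicator X (\<pi> w) * Re (h w))" by (auto simp: indicator_def)
    then show "Re (\<mu> X) = (\<integral>w. indicator X (\<pi> w) * Re (h w) \<partial>M)"
      using integral_Re[OF intX[OF X]] representsD(5)[OF r X] by simp
  qed (use representsD(3)[OF r] iRe in auto)
  have Im: "signed_integral (\<lambda>A. Im (\<mu> A)) f = (\<integral>w. Im (h w) *\<^sub>R f (\<pi> w) \<partial>M)"
  proof (rule signed_integral_represented[OF complex_borel_measure_Im[OF \<mu>]])
    fix X :: "'a set" assume X: "X \<in> sets borel"
    have "(\<lambda>w. Im (indicator X (\<pi> w) * h w)) = (\<lambda>w. indicator X (\<pi> w) * Im (h w))" by (auto simp: indicator_def)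
    then show "Im (\<mu> X) = (\<integral>w. indicator X (\<pi> w) * Im (h w) \<partial>M)"
      using integral_Im[OF intX[OF X]] representsD(5)[OF r X] by simp
  qed (use representsD(3)[OF r] iIm in auto)
  have "complex_measure_integral \<mu> f = (\<integral>w. Re (h w) *\<^sub>R f (\<pi> w) + \<i> * (Im (h w) *\<^sub>R f (\<pi> w)) \<partial>M)"
    unfolding complex_measure_integral_def Re Im using iRe iIm
    by (subst Bochner_Integration.integral_add) (simp_all only: integral_mult_right_zero integrable_mult_right simp_thms)
  also have "\<dots> = (\<integral>w. f (\<pi> w) * h w \<partial>M)"
  proof (rule Bochner_Integration.integral_cong[OF refl])
    fix w
    have "f (\<pi> w) * h w = f (\<pi> w) * (Re (h w) + \<i> * Im (h w))" by (simp flip: complex_eq)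
    then show "Re (h w) *\<^sub>R f (\<pi> w) + \<i> * (Im (h w) *\<^sub>R f (\<pi> w)) = f (\<pi> w) * h w"
      by (simp add: scaleR_conv_of_real algebra_simps)
  qed
  finally show ?thesis .
qed

text \<open>Radon-Nikodym in a form that leaves the reference measure open: any finite T dominating
  S works. This allows several measures to be given densities over the same T.\<close>

lemma signed_borel_measure_density:
  assumes \<nu>: "signed_borel_measure \<nu>"
  obtains S :: "'a::topological_space measure" where "finite_measure S" "sets S = sets borel"
    "\<And>T. finite_measure T \<Longrightarrow> sets T = sets borel \<Longrightarrow> absolutely_continuous T S \<Longrightarrow>
      \<exists>r. integrable T r \<and> (\<forall>X\<in>sets borel. \<nu> X = (\<integral>w. indicator X w * r w \<partial>T))"
proof -
  define P where "P = positive_variation \<nu>"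
  define N where "N = positive_variation (\<lambda>X. - \<nu> X)"
  have sets [simp]: "sets P = sets borel" "sets N = sets borel" by (simp_all add: P_def N_def)
  have fin: "finite_measure P" "finite_measure N"
    unfolding P_def N_def by (intro finite_measure_positive_variation signed_borel_measure_uminus \<nu>)+
  show ?thesis
  proof (rule that[of "sum_measure P N"])
    show "finite_measure (sum_measure P N)" using fin by (intro finite_measure_sum_measure) auto
    fix T :: "'a measure" assume T: "finite_measure T" "sets T = sets borel" "absolutely_continuous T (sum_measure P N)"
    have acP: "absolutely_continuous T P" and acN: "absolutely_continuous T N"
      using T absolutely_continuous_sum_measure[of N P P] absolutely_continuous_sum_measure[of N P N]
      unfolding absolutely_continuous_def by auto
    obtain p where p: "integrable T p" "\<And>x. 0 \<le> p x" "P = density T p"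
      using finite_measure_real_density[OF T(1) fin(1) _ acP] T(2) by auto
    obtain n where n: "integrable T n" "\<And>x. 0 \<le> n x" "N = density T n"
      using finite_measure_real_density[OF T(1) fin(2) _ acN] T(2) by auto
    have "\<nu> X = (\<integral>w. indicator X w * (p w - n w) \<partial>T)" if X: "X \<in> sets borel" for X
    proof -
      have XT: "X \<in> sets T" using X T by simp
      have "\<nu> X = measure P X - measure N X" unfolding P_def N_def by (rule measure_positive_variation_diff[OF \<nu> X])
      also have "\<dots> = (\<integral>w. indicator X w * p w \<partial>T) - (\<integral>w. indicator X w * n w \<partial>T)"
        using measure_density_real[OF p(1,2) XT] measure_density_real[OF n(1,2) XT] p(3) n(3) by simp
      also have "\<dots> = (\<integral>w. indicator X w * (p w - n w) \<partial>T)"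
        using integrable_mult_indicator[OF XT p(1)] integrable_mult_indicator[OF XT n(1)]
        by (simp add: right_diff_distrib)
      finally show ?thesis .
    qed
    then show "\<exists>r. integrable T r \<and> (\<forall>X\<in>sets borel. \<nu> X = (\<integral>w. indicator X w * r w \<partial>T))"
      using p n by (intro exI[of _ "\<lambda>w. p w - n w"]) auto
  qed simp
qed

lemma complex_borel_measure_density:
  assumes \<mu>: "complex_borel_measure \<mu>"
  obtains S :: "'a::topological_space measure" where "finite_measure S" "sets S = sets borel"
    "\<And>T. finite_measure T \<Longrightarrow> sets T = sets borel \<Longrightarrow> absolutely_continuous T S \<Longrightarrow> \<exists>h. represents \<mu> T (\<lambda>x. x) h"
proof -
  obtain S1 where S1: "finite_measure S1" "sets S1 = sets borel"
    "\<And>T. finite_measure T \<Longrightarrow> sets T = sets borel \<Longrightarrow> absolutely_continuous T S1 \<Longrightarrow>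
      \<exists>r. integrable T r \<and> (\<forall>X\<in>sets borel. Re (\<mu> X) = (\<integral>w. indicator X w * r w \<partial>T))"
    using signed_borel_measure_density[OF complex_borel_measure_Re[OF \<mu>]] by blast
  obtain S2 where S2: "finite_measure S2" "sets S2 = sets borel"
    "\<And>T. finite_measure T \<Longrightarrow> sets T = sets borel \<Longrightarrow> absolutely_continuous T S2 \<Longrightarrow>
      \<exists>r. integrable T r \<and> (\<forall>X\<in>sets borel. Im (\<mu> X) = (\<integral>w. indicator X w * r w \<partial>T))"
    using signed_borel_measure_density[OF complex_borel_measure_Im[OF \<mu>]] by blast
  show ?thesis
  proof (rule that[of "sum_measure S1 S2"])
    show "finite_measure (sum_measure S1 S2)" "sets (sum_measure S1 S2) = sets borel"
      using S1 S2 by (auto intro!: finite_measure_sum_measure)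
    fix T :: "'a measure" assume T: "finite_measure T" "sets T = sets borel" "absolutely_continuous T (sum_measure S1 S2)"
    have "absolutely_continuous T S1" "absolutely_continuous T S2"
      using T S1 S2 absolutely_continuous_sum_measure[of S2 S1 S1] absolutely_continuous_sum_measure[of S2 S1 S2]
      unfolding absolutely_continuous_def by auto
    then obtain a b where a: "integrable T a" "\<And>X. X \<in> sets borel \<Longrightarrow> Re (\<mu> X) = (\<integral>w. indicator X w * a w \<partial>T)"
      and b: "integrable T b" "\<And>X. X \<in> sets borel \<Longrightarrow> Im (\<mu> X) = (\<integral>w. indicator X w * b w \<partial>T)"
      using S1(3) S2(3) T by meson
    have "\<mu> X = (\<integral>w. indicator X w * Complex (a w) (b w) \<partial>T)" if X: "X \<in> sets borel" for X
    proof -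
      have XT: "X \<in> sets T" using X T by simp
      have ia: "integrable T (\<lambda>w. indicator X w * a w)" and ib: "integrable T (\<lambda>w. indicator X w * b w)"
        using integrable_mult_indicator[OF XT a(1)] integrable_mult_indicator[OF XT b(1)] by simp_all
      have "\<mu> X = of_real (Re (\<mu> X)) + \<i> * of_real (Im (\<mu> X))" by (rule complex_eq)
      also have "\<dots> = (\<integral>w. of_real (indicator X w * a w) + \<i> * of_real (indicator X w * b w) \<partial>T)"
        using ia ib by (simp add: a(2)[OF X] b(2)[OF X] del: of_real_mult)
      also have "\<dots> = (\<integral>w. indicator X w * Complex (a w) (b w) \<partial>T)"
        by (intro Bochner_Integration.integral_cong) (auto simp: indicator_def complex_eq_iff)
      finally show ?thesis .
    qed
    moreover have "integrable T (\<lambda>w. Complex (a w) (b w))"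
    proof -
      have "integrable T (\<lambda>w. of_real (a w) + \<i> * of_real (b w))" using a(1) b(1) by auto
      then show ?thesis by (simp add: Complex_eq)
    qed
    ultimately show "\<exists>h. represents \<mu> T (\<lambda>x. x) h"
      unfolding represents_def using T
      by (intro exI[of _ "\<lambda>w. Complex (a w) (b w)"]) (auto simp: finite_measure.axioms(1) measurable_ident_sets)
  qed
qed

text \<open>Over a common T, sums and differences of measures become those of densities. Applied
  with \<open>\<mu>\<close> and \<open>\<nu>\<close> equal, it is the standard way below to obtain a
  density of a single measure.\<close>

lemma represents_common:
  assumes "complex_borel_measure \<mu>" "complex_borel_measure \<nu>"
  obtains T :: "'a::topological_space measure" and h k where "finite_measure T" "sets T = sets borel"
    "represents \<mu> T (\<lambda>x. x) h" "represents \<nu> T (\<lambda>x. x) k"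
proof -
  obtain S1 where S1: "finite_measure S1" "sets S1 = sets borel"
    "\<And>T. finite_measure T \<Longrightarrow> sets T = sets borel \<Longrightarrow> absolutely_continuous T S1 \<Longrightarrow> \<exists>h. represents \<mu> T (\<lambda>x. x) h"
    using complex_borel_measure_density[OF assms(1)] by blast
  obtain S2 where S2: "finite_measure S2" "sets S2 = sets borel"
    "\<And>T. finite_measure T \<Longrightarrow> sets T = sets borel \<Longrightarrow> absolutely_continuous T S2 \<Longrightarrow> \<exists>h. represents \<nu> T (\<lambda>x. x) h"
    using complex_borel_measure_density[OF assms(2)] by blast
  let ?T = "sum_measure S1 S2"
  have T: "finite_measure ?T" "sets ?T = sets borel" using S1 S2 by (auto intro!: finite_measure_sum_measure)
  have "absolutely_continuous ?T S1" "absolutely_continuous ?T S2"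
    using absolutely_continuous_sum_measure[of S2 S1 S1] absolutely_continuous_sum_measure[of S2 S1 S2]
    by (auto simp: S1(2) S2(2) absolutely_continuous_def)
  then show ?thesis using S1(3)[OF T] S2(3)[OF T] T that by blast
qed

subsection \<open>Convolution operators\<close>

text \<open>The squared L2 norm with values in \<open>ennreal\<close>: it is meaningful for any
  measurable function, so Tonelli and Cauchy-Schwarz apply before integrability is known.\<close>

definition sqnorm :: "'a measure \<Rightarrow> ('a \<Rightarrow> complex) \<Rightarrow> ennreal" where
  "sqnorm m \<xi> = (\<integral>\<^sup>+x. ennreal ((norm (\<xi> x))\<^sup>2) \<partial>m)"

lemma L2_iff_sqnorm: "\<xi> \<in> L2 m \<longleftrightarrow> \<xi> \<in> borel_measurable m \<and> sqnorm m \<xi> < \<infinity>"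
  by (auto simp: L2_def sqnorm_def integrable_iff_bounded)

lemma sqnorm_eq_L2_norm:
  assumes "\<xi> \<in> L2 m" shows "sqnorm m \<xi> = ennreal ((L2_norm m \<xi>)\<^sup>2)"
  using assms by (simp add: sqnorm_def L2_norm_def L2_def nn_integral_eq_integral)

lemma sqnorm_cong_AE:
  assumes "AE x in m. \<xi> x = \<eta> x" shows "sqnorm m \<xi> = sqnorm m \<eta>"
  unfolding sqnorm_def by (rule nn_integral_cong_AE) (use assms in auto)

lemma sqnorm_cmult:
  assumes [measurable]: "\<xi> \<in> borel_measurable m"
  shows "sqnorm m (\<lambda>x. c * \<xi> x) = ennreal ((norm c)\<^sup>2) * sqnorm m \<xi>"
  unfolding sqnorm_def by (simp add: norm_mult power_mult_distrib ennreal_mult nn_integral_cmult)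

text \<open>Pointwise, the square of a + b is at most twice the sum of the squares. The factor 2 is
  harmless for approximation and is compensated by the choice of epsilons later.\<close>

lemma sqnorm_add_le:
  assumes [measurable]: "\<xi> \<in> borel_measurable m" "\<eta> \<in> borel_measurable m"
  shows "sqnorm m (\<lambda>x. \<xi> x + \<eta> x) \<le> 2 * sqnorm m \<xi> + 2 * sqnorm m \<eta>"
proof -
  have "(norm (a + b))\<^sup>2 \<le> 2 * (norm a)\<^sup>2 + 2 * (norm b)\<^sup>2" for a b :: complex
  proof -
    have "(norm (a + b))\<^sup>2 \<le> (norm a + norm b)\<^sup>2" by (intro power_mono norm_triangle_ineq) auto
    also have "\<dots> \<le> 2 * (norm a)\<^sup>2 + 2 * (norm b)\<^sup>2"
      using zero_le_power2[of "norm a - norm b"] by (simp add: power2_eq_square algebra_simps)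
    finally show ?thesis .
  qed
  then have "sqnorm m (\<lambda>x. \<xi> x + \<eta> x) \<le> (\<integral>\<^sup>+x. ennreal (2 * (norm (\<xi> x))\<^sup>2 + 2 * (norm (\<eta> x))\<^sup>2) \<partial>m)"
    unfolding sqnorm_def by (intro nn_integral_mono ennreal_leI) auto
  also have "\<dots> = 2 * sqnorm m \<xi> + 2 * sqnorm m \<eta>"
    by (simp add: sqnorm_def ennreal_mult nn_integral_add nn_integral_cmult)
  finally show ?thesis .
qed

lemma L2_norm_nonneg: "0 \<le> L2_norm m \<xi>" by (simp add: L2_norm_def)

lemma L2_zero: "(\<lambda>x. 0) \<in> L2 m" by (simp add: L2_def)

lemma L2_cmult: "\<xi> \<in> L2 m \<Longrightarrow> (\<lambda>x. c * \<xi> x) \<in> L2 m"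
  by (auto simp: L2_iff_sqnorm sqnorm_cmult ennreal_mult_less_top)

lemma L2_add: "\<xi> \<in> L2 m \<Longrightarrow> \<eta> \<in> L2 m \<Longrightarrow> (\<lambda>x. \<xi> x + \<eta> x) \<in> L2 m"
  unfolding L2_iff_sqnorm
  using sqnorm_add_le[of \<xi> m \<eta>] by (auto simp: ennreal_mult_less_top intro: le_less_trans)

text \<open>The number e bounds the square of the operator norm, to match
  \<open>sqnorm\<close>.\<close>

definition op_bound :: "'a measure \<Rightarrow> 'a fun_op \<Rightarrow> real \<Rightarrow> bool" where
  "op_bound m D e \<longleftrightarrow> (\<forall>\<xi>\<in>L2 m. sqnorm m (D \<xi>) \<le> ennreal e * sqnorm m \<xi>)"

lemma op_boundD: "op_bound m D e \<Longrightarrow> \<xi> \<in> L2 m \<Longrightarrow> sqnorm m (D \<xi>) \<le> ennreal e * sqnorm m \<xi>"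
  by (simp add: op_bound_def)

lemma op_bound_mono: "op_bound m D e \<Longrightarrow> e \<le> e' \<Longrightarrow> op_bound m D e'"
  unfolding op_bound_def by (meson ennreal_leI mult_right_mono order_trans zero_le)

section \<open>Left invariant measures and convolution on L2\<close>

lemma borel_measurable_group_uminus [measurable (raw)]:
  fixes f :: "'w \<Rightarrow> 'a::{topological_group_add, second_countable_topology}"
  assumes "f \<in> borel_measurable M"
  shows "(\<lambda>w. - f w) \<in> borel_measurable M"
  by (rule borel_measurable_continuous_on[OF _ assms]) (intro continuous_intros)

lemma borel_measurable_group_diff [measurable (raw)]:
  fixes f g :: "'w \<Rightarrow> 'a::{topological_group_add, second_countable_topology}"
  assumes [measurable]: "f \<in> borel_measurable M" "g \<in> borel_measurable M"
  shows "(\<lambda>w. f w - g w) \<in> borel_measurable M"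
  unfolding diff_conv_add_uminus by measurable

text \<open>What the operator estimates use of a Haar measure. Both properties pass to product
  measures, so the product of two Haar measures falls under the locale without being compared to a
  given Haar measure of the product group.\<close>

locale left_invariant = sigma_finite_measure m
  for m :: "'a::{topological_group_add, second_countable_topology} measure" +
  assumes sets_eq_borel [simp, measurable_cong]: "sets m = sets borel"
    and distr_translate: "distr m borel (\<lambda>x. a + x) = m"
begin

lemma space_eq_UNIV [simp]: "space m = UNIV"
  using sets_eq_imp_space_eq[OF sets_eq_borel] by simp

lemma L2_borel: "\<xi> \<in> L2 m \<Longrightarrow> \<xi> \<in> borel_measurable borel"
  using measurable_cong_sets[OF sets_eq_borel refl] by (auto simp: L2_def)

lemma nn_integral_translate:
  assumes [measurable]: "f \<in> borel_measurable borel"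
  shows "(\<integral>\<^sup>+x. f (a + x) \<partial>m) = (\<integral>\<^sup>+x. f x \<partial>m)"
proof -
  have "(\<integral>\<^sup>+x. f x \<partial>m) = (\<integral>\<^sup>+x. f x \<partial>distr m borel (\<lambda>x. a + x))" by (simp only: distr_translate)
  also have "\<dots> = (\<integral>\<^sup>+x. f (a + x) \<partial>m)"
    by (intro nn_integral_distr) auto
  finally show ?thesis by simp
qed

text \<open>Young's inequality for a measure acting on L2. Write the modulus of h as a product of
  two square roots, attach one of them to \<open>\<xi>\<close> and apply Cauchy-Schwarz; Tonelli and
  left invariance do the rest. With the modulus inside the inner integral, it gives at once the
  existence of the convolution almost everywhere and its norm bound.\<close>

lemma nn_integral_convolution_square:
  assumes M: "sigma_finite_measure M" and [measurable]: "\<pi> \<in> borel_measurable M" "h \<in> borel_measurable M" "\<xi> \<in> borel_measurable borel"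
  shows "(\<integral>\<^sup>+x. (\<integral>\<^sup>+w. ennreal (norm (\<xi> (- \<pi> w + x) * h w)) \<partial>M)\<^sup>2 \<partial>m) \<le> (\<integral>\<^sup>+w. ennreal (norm (h w)) \<partial>M)\<^sup>2 * sqnorm m \<xi>"
proof -
  interpret M: sigma_finite_measure M by fact
  interpret pair_sigma_finite m M ..
  define H where "H = (\<integral>\<^sup>+w. ennreal (norm (h w)) \<partial>M)"
  have "(\<integral>\<^sup>+w. ennreal (norm (\<xi> (- \<pi> w + x) * h w)) \<partial>M)\<^sup>2
      \<le> H * (\<integral>\<^sup>+w. ennreal ((norm (\<xi> (- \<pi> w + x)))\<^sup>2) * ennreal (norm (h w)) \<partial>M)" for x
  proof -
    have "(\<integral>\<^sup>+w. ennreal (norm (\<xi> (- \<pi> w + x) * h w)) \<partial>M)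
        = (\<integral>\<^sup>+w. ennreal (sqrt (norm (h w))) * ennreal (norm (\<xi> (- \<pi> w + x)) * sqrt (norm (h w))) \<partial>M)"
      by (intro nn_integral_cong) (simp add: norm_mult ennreal_mult[symmetric] mult_ac)
    then have "(\<integral>\<^sup>+w. ennreal (norm (\<xi> (- \<pi> w + x) * h w)) \<partial>M)\<^sup>2
       \<le> (\<integral>\<^sup>+w. ennreal (sqrt (norm (h w))) ^ 2 \<partial>M) * (\<integral>\<^sup>+w. ennreal (norm (\<xi> (- \<pi> w + x)) * sqrt (norm (h w))) ^ 2 \<partial>M)"
      by (simp only:) (rule Cauchy_Schwarz_nn_integral; measurable)
    then show ?thesis
      by (simp add: H_def ennreal_power power_mult_distrib ennreal_mult)
  qed
  then have "(\<integral>\<^sup>+x. (\<integral>\<^sup>+w. ennreal (norm (\<xi> (- \<pi> w + x) * h w)) \<partial>M)\<^sup>2 \<partial>m)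
     \<le> (\<integral>\<^sup>+x. H * (\<integral>\<^sup>+w. ennreal ((norm (\<xi> (- \<pi> w + x)))\<^sup>2) * ennreal (norm (h w)) \<partial>M) \<partial>m)"
    by (intro nn_integral_mono)
  also have "\<dots> = H * (\<integral>\<^sup>+x. (\<integral>\<^sup>+w. ennreal ((norm (\<xi> (- \<pi> w + x)))\<^sup>2) * ennreal (norm (h w)) \<partial>M) \<partial>m)"
    by (rule nn_integral_cmult) measurable
  also have "(\<integral>\<^sup>+x. (\<integral>\<^sup>+w. ennreal ((norm (\<xi> (- \<pi> w + x)))\<^sup>2) * ennreal (norm (h w)) \<partial>M) \<partial>m)
      = (\<integral>\<^sup>+w. (\<integral>\<^sup>+x. ennreal ((norm (\<xi> (- \<pi> w + x)))\<^sup>2) * ennreal (norm (h w)) \<partial>m) \<partial>M)"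
    by (rule Fubini'[symmetric]) measurable
  also have "\<dots> = (\<integral>\<^sup>+w. sqnorm m \<xi> * ennreal (norm (h w)) \<partial>M)"
    using nn_integral_translate[of "\<lambda>x. ennreal ((norm (\<xi> x))\<^sup>2)"]
    by (intro nn_integral_cong) (simp add: nn_integral_multc sqnorm_def)
  also have "\<dots> = sqnorm m \<xi> * H"
    by (simp add: nn_integral_cmult H_def)
  finally show ?thesis by (simp add: H_def power2_eq_square mult_ac)
qed

text \<open>A function whose square has finite integral is finite almost everywhere, so by
  \<open>nn_integral_convolution_square\<close> the integrand is integrable for almost every x. The
  exceptional set depends on \<open>\<xi>\<close>, which is why all identities below are almost
  everywhere.\<close>

lemma conv_op_eq_integral:
  assumes r: "represents \<mu> M \<pi> h" and \<xi>: "\<xi> \<in> L2 m"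
  shows "AE x in m. integrable M (\<lambda>w. \<xi> (- \<pi> w + x) * h w) \<and> conv_op \<mu> \<xi> x = (\<integral>w. \<xi> (- \<pi> w + x) * h w \<partial>M)"
proof -
  note [measurable] = representsD(2,4)[OF r] L2_borel[OF \<xi>]
  interpret M: sigma_finite_measure M by (rule representsD(1)[OF r])
  have "(\<integral>\<^sup>+w. ennreal (norm (h w)) \<partial>M) < \<infinity>" using representsD(3)[OF r] by (simp add: integrable_iff_bounded)
  then have "(\<integral>\<^sup>+x. (\<integral>\<^sup>+w. ennreal (norm (\<xi> (- \<pi> w + x) * h w)) \<partial>M)\<^sup>2 \<partial>m) < \<infinity>"
    using nn_integral_convolution_square[OF representsD(1,2,4)[OF r] L2_borel[OF \<xi>]] \<xi>
    by (auto simp: L2_iff_sqnorm ennreal_mult_less_top power_less_top_ennreal intro: le_less_trans)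
  then have "AE x in m. (\<integral>\<^sup>+w. ennreal (norm (\<xi> (- \<pi> w + x) * h w)) \<partial>M)\<^sup>2 \<noteq> \<infinity>"
    by (intro nn_integral_PInf_AE) auto
  then show ?thesis
  proof eventually_elim
    case (elim x)
    then have "(\<integral>\<^sup>+w. ennreal (norm (\<xi> (- \<pi> w + x) * h w)) \<partial>M) < \<infinity>"
      by (auto simp: less_top[symmetric] power2_eq_square)
    then have int: "integrable M (\<lambda>w. \<xi> (- \<pi> w + x) * h w)"
      by (intro integrableI_bounded) auto
    have "(\<lambda>s. \<xi> (- s + x)) \<in> borel_measurable borel" by measurable
    from represents_integral[OF r this int] int show ?case by (simp add: conv_op_def)
  qed
qed

text \<open>Argued from the definition by Jordan parts, which is valid at every point. The integral
  formula for a representation holds only almost everywhere, and Borel measurability does not pass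
  through such an equality.\<close>

lemma conv_op_measurable:
  fixes \<mu> :: "'a set \<Rightarrow> complex"
  assumes \<mu>: "complex_borel_measure \<mu>" and [measurable]: "\<xi> \<in> borel_measurable borel"
  shows "conv_op \<mu> \<xi> \<in> borel_measurable borel"
proof -
  have part: "(\<lambda>x. \<integral>s. \<xi> (- s + x) \<partial>positive_variation \<nu>) \<in> borel_measurable borel" if "signed_borel_measure \<nu>" for \<nu>
  proof -
    interpret finite_measure "positive_variation \<nu>" by (rule finite_measure_positive_variation[OF that])
    show ?thesis by measurable
  qed
  note [measurable] = part[OF complex_borel_measure_Re[OF \<mu>]] part[OF complex_borel_measure_Im[OF \<mu>]]
    part[OF signed_borel_measure_uminus[OF complex_borel_measure_Re[OF \<mu>]]]
    part[OF signed_borel_measure_uminus[OF complex_borel_measure_Im[OF \<mu>]]]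
  show ?thesis unfolding conv_op_def[abs_def] complex_measure_integral_def signed_integral_def by measurable
qed

lemma sqnorm_conv_op_le:
  assumes r: "represents \<mu> M \<pi> h" and \<xi>: "\<xi> \<in> L2 m"
  shows "sqnorm m (conv_op \<mu> \<xi>) \<le> (\<integral>\<^sup>+w. ennreal (norm (h w)) \<partial>M)\<^sup>2 * sqnorm m \<xi>"
proof -
  have "sqnorm m (conv_op \<mu> \<xi>) \<le> (\<integral>\<^sup>+x. (\<integral>\<^sup>+w. ennreal (norm (\<xi> (- \<pi> w + x) * h w)) \<partial>M)\<^sup>2 \<partial>m)"
    unfolding sqnorm_def
  proof (rule nn_integral_mono_AE, use conv_op_eq_integral[OF r \<xi>] in eventually_elim)
    case (elim x)
    then have "ennreal (norm (conv_op \<mu> \<xi> x)) \<le> (\<integral>\<^sup>+w. ennreal (norm (\<xi> (- \<pi> w + x) * h w)) \<partial>M)"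
      using integral_norm_bound_ennreal by metis
    then show ?case by (simp add: power_mono flip: ennreal_power)
  qed
  also have "\<dots> \<le> (\<integral>\<^sup>+w. ennreal (norm (h w)) \<partial>M)\<^sup>2 * sqnorm m \<xi>"
    by (rule nn_integral_convolution_square[OF representsD(1,2,4)[OF r] L2_borel[OF \<xi>]])
  finally show ?thesis .
qed

lemma op_bound_conv_op:
  assumes "complex_borel_measure \<mu>"
  obtains C where "0 \<le> C" "op_bound m (conv_op \<mu>) C"
proof -
  obtain M h where "finite_measure M" "sets M = sets borel" and r: "represents \<mu> M (\<lambda>x. x) h"
    by (rule represents_common[OF assms assms])
  have H: "(\<integral>\<^sup>+w. ennreal (norm (h w)) \<partial>M) = ennreal (\<integral>w. norm (h w) \<partial>M)"
    using representsD(3)[OF r] by (simp add: nn_integral_eq_integral)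
  have "op_bound m (conv_op \<mu>) ((\<integral>w. norm (h w) \<partial>M)\<^sup>2)"
    unfolding op_bound_def using sqnorm_conv_op_le[OF r] by (simp add: H ennreal_power)
  then show ?thesis by (intro that) auto
qed

lemma conv_op_L2:
  assumes \<mu>: "complex_borel_measure \<mu>" and \<xi>: "\<xi> \<in> L2 m"
  shows "conv_op \<mu> \<xi> \<in> L2 m"
proof -
  obtain C where "op_bound m (conv_op \<mu>) C" using op_bound_conv_op[OF \<mu>] .
  then have "sqnorm m (conv_op \<mu> \<xi>) \<le> ennreal C * sqnorm m \<xi>" by (rule op_boundD[OF _ \<xi>])
  also have "\<dots> < \<infinity>" using \<xi> by (simp add: L2_iff_sqnorm ennreal_mult_less_top)
  finally show ?thesis
    using conv_op_measurable[OF \<mu> L2_borel[OF \<xi>]] measurable_cong_sets[OF sets_eq_borel refl]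
    by (auto simp: L2_iff_sqnorm)
qed

lemma conv_op_add:
  assumes \<mu>: "complex_borel_measure \<mu>" and \<xi>: "\<xi> \<in> L2 m" and \<eta>: "\<eta> \<in> L2 m"
  shows "AE x in m. conv_op \<mu> (\<lambda>y. \<xi> y + \<eta> y) x = conv_op \<mu> \<xi> x + conv_op \<mu> \<eta> x"
proof -
  obtain M h where "finite_measure M" "sets M = sets borel" and r: "represents \<mu> M (\<lambda>x. x) h"
    by (rule represents_common[OF \<mu> \<mu>])
  show ?thesis
    using conv_op_eq_integral[OF r \<xi>] conv_op_eq_integral[OF r \<eta>] conv_op_eq_integral[OF r L2_add[OF \<xi> \<eta>]]
    by eventually_elim (simp add: distrib_right)
qed

lemma conv_op_cmult:
  assumes \<mu>: "complex_borel_measure \<mu>" and \<xi>: "\<xi> \<in> L2 m"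
  shows "AE x in m. conv_op \<mu> (\<lambda>y. c * \<xi> y) x = c * conv_op \<mu> \<xi> x"
proof -
  obtain M h where "finite_measure M" "sets M = sets borel" and r: "represents \<mu> M (\<lambda>x. x) h"
    by (rule represents_common[OF \<mu> \<mu>])
  show ?thesis
    using conv_op_eq_integral[OF r \<xi>] conv_op_eq_integral[OF r L2_cmult[OF \<xi>]]
    by eventually_elim (simp add: mult.assoc)
qed

lemma conv_op_bounded:
  assumes \<mu>: "complex_borel_measure \<mu>"
  shows "conv_op \<mu> \<in> L2_bounded_ops m"
proof -
  obtain C where C: "0 \<le> C" "op_bound m (conv_op \<mu>) C" using op_bound_conv_op[OF \<mu>] .
  have "L2_norm m (conv_op \<mu> \<xi>) \<le> sqrt C * L2_norm m \<xi>" if \<xi>: "\<xi> \<in> L2 m" for \<xi>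
  proof -
    have "(L2_norm m (conv_op \<mu> \<xi>))\<^sup>2 \<le> C * (L2_norm m \<xi>)\<^sup>2"
      using op_boundD[OF C(2) \<xi>] C(1)
      by (simp add: sqnorm_eq_L2_norm \<xi> conv_op_L2[OF \<mu>] flip: ennreal_mult)
    also have "\<dots> = (sqrt C * L2_norm m \<xi>)\<^sup>2" using C by (simp add: power_mult_distrib)
    finally show ?thesis
      by (rule power2_le_imp_le) (use C L2_norm_nonneg[of m \<xi>] in simp)
  qed
  then show ?thesis
    unfolding L2_bounded_ops_def using conv_op_L2[OF \<mu>] conv_op_add[OF \<mu>] conv_op_cmult[OF \<mu>] by blast
qed

end

lemma complex_borel_measure_diff:
  "complex_borel_measure \<mu> \<Longrightarrow> complex_borel_measure \<nu> \<Longrightarrow> complex_borel_measure (\<lambda>A. \<mu> A - \<nu> A)"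
  unfolding complex_borel_measure_def by (auto intro!: sums_diff)

lemma represents_diff:
  assumes r: "represents \<mu> M \<pi> h" and s: "represents \<nu> M \<pi> k"
  shows "represents (\<lambda>A. \<mu> A - \<nu> A) M \<pi> (\<lambda>w. h w - k w)"
  unfolding represents_def
proof (intro conjI ballI)
  fix A :: "'a set" assume A [measurable]: "A \<in> sets borel"
  note [measurable] = representsD(2,4)[OF r] representsD(2,4)[OF s]
  have int: "integrable M (\<lambda>w. indicator A (\<pi> w) * u w)" if "integrable M u" for u :: "_ \<Rightarrow> complex"
    by (rule Bochner_Integration.integrable_bound[OF that]) (use that in \<open>auto simp: indicator_def\<close>)
  show "\<mu> A - \<nu> A = (\<integral>w. indicator A (\<pi> w) * (h w - k w) \<partial>M)"
    using int[OF representsD(3)[OF r]] int[OF representsD(3)[OF s]]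
    by (simp add: representsD(5)[OF r A] representsD(5)[OF s A] right_diff_distrib)
qed (use representsD[OF r] representsD[OF s] in auto)

lemma represents_cong:
  assumes "represents \<mu> M \<pi> h" "\<And>A. A \<in> sets borel \<Longrightarrow> \<nu> A = \<mu> A"
  shows "represents \<nu> M \<pi> h"
  using assms by (simp add: represents_def)

context left_invariant
begin

lemma represents_L1_measure:
  assumes f: "f \<in> L1 m" shows "represents (L1_measure m f) m (\<lambda>x. x) f"
  using f sigma_finite_measure_axioms
  by (auto simp: represents_def L1_measure_def L1_def set_lebesgue_integral_def measurable_ident_sets
      scaleR_conv_of_real indicator_def intro!: Bochner_Integration.integral_cong)

lemmas complex_borel_measure_L1_measure = represents_complex_borel_measure[OF represents_L1_measure]

lemma conv_op_diff:
  assumes \<mu>: "complex_borel_measure \<mu>" and \<nu>: "complex_borel_measure \<nu>" and \<xi>: "\<xi> \<in> L2 m"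
  shows "AE x in m. conv_op (\<lambda>A. \<mu> A - \<nu> A) \<xi> x = conv_op \<mu> \<xi> x - conv_op \<nu> \<xi> x"
proof -
  obtain M h k where "finite_measure M" "sets M = sets borel"
    and r: "represents \<mu> M (\<lambda>x. x) h" and s: "represents \<nu> M (\<lambda>x. x) k"
    by (rule represents_common[OF \<mu> \<nu>])
  show ?thesis
    using conv_op_eq_integral[OF r \<xi>] conv_op_eq_integral[OF s \<xi>] conv_op_eq_integral[OF represents_diff[OF r s] \<xi>]
    by eventually_elim (simp add: right_diff_distrib)
qed

text \<open>Set functions representing the same complex measure may differ off the Borel sets. This
  lemma allows exchanging them after an identity that is proved for Borel sets only.\<close>

lemma conv_op_cong:
  assumes \<mu>: "complex_borel_measure \<mu>" and eq: "\<And>A. A \<in> sets borel \<Longrightarrow> \<nu> A = \<mu> A" and \<xi>: "\<xi> \<in> L2 m"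
  shows "AE x in m. conv_op \<nu> \<xi> x = conv_op \<mu> \<xi> x"
proof -
  obtain M h where "finite_measure M" "sets M = sets borel" and r: "represents \<mu> M (\<lambda>x. x) h"
    by (rule represents_common[OF \<mu> \<mu>])
  have s: "represents \<nu> M (\<lambda>x. x) h" by (rule represents_cong[OF r eq])
  show ?thesis
    using conv_op_eq_integral[OF r \<xi>] conv_op_eq_integral[OF s \<xi>]
    by eventually_elim simp
qed

section \<open>The operator norm and the reduced C*-algebra in terms of squared bounds\<close>

lemma L2_opnorm_le:
  assumes "0 \<le> e" "\<And>\<xi>. \<xi> \<in> L2 m \<Longrightarrow> sqnorm m (D \<xi>) \<le> ennreal (e\<^sup>2) * sqnorm m \<xi>"
    "\<And>\<xi>. \<xi> \<in> L2 m \<Longrightarrow> D \<xi> \<in> L2 m"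
  shows "L2_opnorm m D \<le> e"
  unfolding L2_opnorm_def
proof (rule cSup_least)
  \<comment> \<open>The zero function makes the set nonempty, as \<open>cSup_least\<close>
    requires.\<close>
  have "L2_norm m (\<lambda>x. 0) \<le> 1" by (simp add: L2_norm_def)
  then show "{L2_norm m (D \<xi>) |\<xi>. \<xi> \<in> L2 m \<and> L2_norm m \<xi> \<le> 1} \<noteq> {}" using L2_zero[of m] by blast
  fix r assume "r \<in> {L2_norm m (D \<xi>) |\<xi>. \<xi> \<in> L2 m \<and> L2_norm m \<xi> \<le> 1}"
  then obtain \<xi> where \<xi>: "\<xi> \<in> L2 m" "L2_norm m \<xi> \<le> 1" and r: "r = L2_norm m (D \<xi>)" by auto
  have "(L2_norm m (D \<xi>))\<^sup>2 \<le> e\<^sup>2 * (L2_norm m \<xi>)\<^sup>2"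
    using assms(2)[OF \<xi>(1)] by (simp add: sqnorm_eq_L2_norm \<xi> assms(3) flip: ennreal_mult)
  also have "\<dots> \<le> e\<^sup>2 * 1\<^sup>2"
    using \<xi>(2) by (intro mult_left_mono power_mono) (auto simp: L2_norm_def)
  finally show "r \<le> e" unfolding r using assms(1) by (intro power2_le_imp_le[of "L2_norm m (D \<xi>)" e]) simp_all
qed

text \<open>In the application D is a pointwise difference of two convolution operators and
  \<open>\<mu>\<close> the difference of the measures. The two operators agree only almost
  everywhere, hence the comparison through norms.\<close>

lemma op_bound_L2_opnorm:
  assumes \<mu>: "complex_borel_measure \<mu>"
    and D: "\<And>\<xi>. \<xi> \<in> L2 m \<Longrightarrow> L2_norm m (D \<xi>) = L2_norm m (conv_op \<mu> \<xi>)"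
    and le: "L2_opnorm m D \<le> e"
  shows "op_bound m (conv_op \<mu>) (e\<^sup>2)"
  unfolding op_bound_def
proof
  fix \<xi> assume \<xi>: "\<xi> \<in> L2 m"
  obtain C where C: "\<And>\<xi>. \<xi> \<in> L2 m \<Longrightarrow> L2_norm m (conv_op \<mu> \<xi>) \<le> C * L2_norm m \<xi>"
    using conv_op_bounded[OF \<mu>] unfolding L2_bounded_ops_def by blast
  note nn = L2_norm_nonneg[of m]
  \<comment> \<open>A real \<open>Sup\<close> bounds the elements of its set only when the set is
    bounded above; the boundedness of convolution supplies this.\<close>
  have bdd: "bdd_above {L2_norm m (D \<xi>) |\<xi>. \<xi> \<in> L2 m \<and> L2_norm m \<xi> \<le> 1}"
  proof (rule bdd_aboveI, clarify)
    fix \<eta> assume \<eta>: "\<eta> \<in> L2 m" "L2_norm m \<eta> \<le> 1"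
    have "L2_norm m (D \<eta>) \<le> C * L2_norm m \<eta>" using C[OF \<eta>(1)] D[OF \<eta>(1)] by simp
    also have "\<dots> \<le> \<bar>C\<bar> * 1" using \<eta> nn[of \<eta>] by (intro mult_mono) auto
    finally show "L2_norm m (D \<eta>) \<le> \<bar>C\<bar>" by simp
  qed
  have "L2_norm m (conv_op \<mu> \<xi>) \<le> e * L2_norm m \<xi>"
  \<comment> \<open>A function of norm zero cannot be normalised; there the crude bound C already
    gives norm zero.\<close>
  proof (cases "L2_norm m \<xi> = 0")
    case True then show ?thesis using C[OF \<xi>] by simp
  next
    case False
    define n where "n = L2_norm m \<xi>"
    have n: "n > 0" using False nn[of \<xi>] by (simp add: n_def)
    let ?\<eta> = "\<lambda>x. complex_of_real (1 / n) * \<xi> x"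
    have sc: "L2_norm m (\<lambda>x. complex_of_real (1 / n) * \<zeta> x) = L2_norm m \<zeta> / n" for \<zeta>
      using n by (simp add: L2_norm_def norm_mult norm_divide power_divide real_sqrt_divide)
    have \<eta>: "?\<eta> \<in> L2 m" by (rule L2_cmult[OF \<xi>])
    have "L2_norm m (conv_op \<mu> ?\<eta>) = L2_norm m (\<lambda>x. complex_of_real (1 / n) * conv_op \<mu> \<xi> x)"
      using sqnorm_cong_AE[OF conv_op_cmult[OF \<mu> \<xi>, of "complex_of_real (1 / n)"]]
        sqnorm_eq_L2_norm[OF conv_op_L2[OF \<mu> \<eta>]] sqnorm_eq_L2_norm[OF L2_cmult[OF conv_op_L2[OF \<mu> \<xi>], of "complex_of_real (1 / n)"]]
      by (simp add: L2_norm_def)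
    also have "\<dots> = L2_norm m (conv_op \<mu> \<xi>) / n" by (rule sc)
    finally have eq: "L2_norm m (conv_op \<mu> \<xi>) / n = L2_norm m (D ?\<eta>)" by (simp only: D[OF \<eta>])
    also have "\<dots> \<le> L2_opnorm m D"
      unfolding L2_opnorm_def
    proof (rule cSup_upper[OF _ bdd])
      have "L2_norm m ?\<eta> \<le> 1" unfolding sc using n by (simp add: n_def)
      then show "L2_norm m (D ?\<eta>) \<in> {L2_norm m (D \<xi>) |\<xi>. \<xi> \<in> L2 m \<and> L2_norm m \<xi> \<le> 1}" using \<eta> by blast
    qed
    also have "\<dots> \<le> e" by (rule le)
    finally show ?thesis using n by (simp add: n_def field_simps)
  qed
  then have "(L2_norm m (conv_op \<mu> \<xi>))\<^sup>2 \<le> e\<^sup>2 * (L2_norm m \<xi>)\<^sup>2"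
    using nn by (metis power_mono power_mult_distrib)
  then show "sqnorm m (conv_op \<mu> \<xi>) \<le> ennreal (e\<^sup>2) * sqnorm m \<xi>"
    by (simp add: sqnorm_eq_L2_norm \<xi> conv_op_L2[OF \<mu>] flip: ennreal_mult)
qed

end

text \<open>Membership of lambda(mu) in the reduced C*-algebra with the difference taken between
  measures instead of operators, so that slicing and multiplying measures can be applied to it. As
  in \<open>op_bound\<close>, the epsilon bounds a squared norm.\<close>

definition approximable :: "'a::topological_group_add measure \<Rightarrow> ('a set \<Rightarrow> complex) \<Rightarrow> bool" where
  "approximable m \<mu> \<longleftrightarrow> (\<forall>\<epsilon>>0. \<exists>f\<in>L1 m. op_bound m (conv_op (\<lambda>A. \<mu> A - L1_measure m f A)) \<epsilon>)"

context left_invariant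
begin

lemma reduced_Cstar_iff_approximable:
  assumes \<mu>: "complex_borel_measure \<mu>"
  shows "conv_op \<mu> \<in> reduced_Cstar m \<longleftrightarrow> approximable m \<mu>"
proof
  have D: "(\<lambda>g. conv_op \<mu> \<xi> g - conv_op (L1_measure m f) \<xi> g) \<in> L2 m"
    "sqnorm m (\<lambda>g. conv_op \<mu> \<xi> g - conv_op (L1_measure m f) \<xi> g) = sqnorm m (conv_op (\<lambda>A. \<mu> A - L1_measure m f A) \<xi>)"
    if \<xi>: "\<xi> \<in> L2 m" and f: "f \<in> L1 m" for \<xi> f
  proof -
    note \<nu> = complex_borel_measure_L1_measure[OF f]
    show *: "sqnorm m (\<lambda>g. conv_op \<mu> \<xi> g - conv_op (L1_measure m f) \<xi> g) = sqnorm m (conv_op (\<lambda>A. \<mu> A - L1_measure m f A) \<xi>)"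
      using conv_op_diff[OF \<mu> \<nu> \<xi>] by (intro sqnorm_cong_AE) auto
    show "(\<lambda>g. conv_op \<mu> \<xi> g - conv_op (L1_measure m f) \<xi> g) \<in> L2 m"
      using L2_add[OF conv_op_L2[OF \<mu> \<xi>] L2_cmult[OF conv_op_L2[OF \<nu> \<xi>], of "-1"]] by simp
  qed
  have N: "L2_norm m (\<lambda>g. conv_op \<mu> \<xi> g - conv_op (L1_measure m f) \<xi> g) = L2_norm m (conv_op (\<lambda>A. \<mu> A - L1_measure m f A) \<xi>)"
    if \<xi>: "\<xi> \<in> L2 m" and f: "f \<in> L1 m" for \<xi> f
    using D[OF \<xi> f] conv_op_L2[OF complex_borel_measure_diff[OF \<mu> complex_borel_measure_L1_measure[OF f]] \<xi>]
    by (simp add: sqnorm_eq_L2_norm L2_norm_def)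
  show "approximable m \<mu>" if red: "conv_op \<mu> \<in> reduced_Cstar m"
    unfolding approximable_def
  proof (intro allI impI)
    fix \<epsilon> :: real assume "0 < \<epsilon>"
    \<comment> \<open>The square root accounts for \<open>op_bound\<close> being a bound on squared
      norms.\<close>
    then have "0 < sqrt \<epsilon>" by simp
    then obtain f where f: "f \<in> L1 m" "L2_opnorm m (\<lambda>\<xi> g. conv_op \<mu> \<xi> g - conv_op (L1_measure m f) \<xi> g) < sqrt \<epsilon>"
      using red unfolding reduced_Cstar_def by blast
    have "op_bound m (conv_op (\<lambda>A. \<mu> A - L1_measure m f A)) ((sqrt \<epsilon>)\<^sup>2)"
      by (rule op_bound_L2_opnorm[OF complex_borel_measure_diff[OF \<mu> complex_borel_measure_L1_measure[OF f(1)]] N[OF _ f(1)]])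
         (use f in auto)
    then show "\<exists>f\<in>L1 m. op_bound m (conv_op (\<lambda>A. \<mu> A - L1_measure m f A)) \<epsilon>"
      using f(1) \<open>0 < sqrt \<epsilon>\<close> by auto
  qed
  show "conv_op \<mu> \<in> reduced_Cstar m" if a: "approximable m \<mu>"
    unfolding reduced_Cstar_def
  proof (intro CollectI conjI conv_op_bounded[OF \<mu>] allI impI)
    fix \<epsilon> :: real assume e: "0 < \<epsilon>"
    \<comment> \<open>Half of \<open>\<epsilon>\<close>, because \<open>L2_opnorm_le\<close> yields
      a weak inequality and the closure asks for a strict one; squared to fit
      \<open>op_bound\<close>.\<close>
    then obtain f where f: "f \<in> L1 m" "op_bound m (conv_op (\<lambda>A. \<mu> A - L1_measure m f A)) ((\<epsilon> / 2)\<^sup>2)"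
      using a unfolding approximable_def by (meson half_gt_zero zero_less_power)
    have "L2_opnorm m (\<lambda>\<xi> g. conv_op \<mu> \<xi> g - conv_op (L1_measure m f) \<xi> g) \<le> \<epsilon> / 2"
      by (rule L2_opnorm_le) (use e f D op_boundD[OF f(2)] in auto)
    then show "\<exists>f\<in>L1 m. L2_opnorm m (\<lambda>\<xi> g. conv_op \<mu> \<xi> g - conv_op (L1_measure m f) \<xi> g) < \<epsilon>"
      using f(1) e by (intro bexI[of _ f]) auto
  qed
qed

lemma extended_uniqueness_iff:
  "extended_uniqueness m E \<longleftrightarrow> (\<forall>\<mu>\<in>measures_on E. approximable m \<mu> \<longrightarrow> conv_op \<mu> \<in> L2_zero_ops m)"
  unfolding extended_uniqueness_def using reduced_Cstar_iff_approximable by (auto simp: measures_on_def)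

end

subsection \<open>Uniqueness of Haar measure\<close>

lemma image_translate: "(\<lambda>x. a + x) ` U = (\<lambda>x. - a + x) -` U"
  for U :: "'a::group_add set"
proof (intro set_eqI iffI)
  fix x assume "x \<in> (\<lambda>x. - a + x) -` U"
  then show "x \<in> (\<lambda>x. a + x) ` U" by (intro image_eqI[of _ _ "- a + x"]) auto
qed auto

lemma image_translate_right: "(\<lambda>x. x + a) ` U = (\<lambda>x. x + - a) -` U"
  for U :: "'a::group_add set"
proof (intro set_eqI iffI)
  fix x assume "x \<in> (\<lambda>x. x + - a) -` U"
  then show "x \<in> (\<lambda>x. x + a) ` U" by (intro image_eqI[of _ _ "x + - a"]) (auto simp: add.assoc)
qed (auto simp: add.assoc)

lemma open_translate:
  fixes U :: "'a::topological_group_add set"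
  assumes "open U" shows "open ((\<lambda>x. a + x) ` U)"
  unfolding image_translate by (intro open_vimage assms continuous_intros)

lemma countable_translate_cover:
  fixes U :: "'a::{topological_group_add, second_countable_topology} set"
  assumes "open U" "U \<noteq> {}"
  obtains A where "countable A" "(\<Union>a\<in>A. (\<lambda>x. a + x) ` U) = UNIV"
proof -
  obtain u where u: "u \<in> U" using assms by blast
  have "\<And>S. S \<in> range (\<lambda>a. (\<lambda>x. a + x) ` U) \<Longrightarrow> open S" using open_translate[OF assms(1)] by blast
  then obtain F where F: "F \<subseteq> range (\<lambda>a. (\<lambda>x. a + x) ` U)" "countable F" "\<Union>F = \<Union>(range (\<lambda>a. (\<lambda>x. a + x) ` U))"
    by (rule Lindelof)
  have "\<Union>(range (\<lambda>a. (\<lambda>x. a + x) ` U)) = UNIV"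
  proof (intro set_eqI iffI UNIV_I)
    fix x :: 'a show "x \<in> \<Union>(range (\<lambda>a. (\<lambda>x. a + x) ` U))"
      using u by (intro UN_I[of "x - u"]) (auto intro!: image_eqI[of _ _ u])
  qed
  moreover obtain A where "countable A" "F = (\<lambda>a. (\<lambda>x. a + x) ` U) ` A"
    using F(1,2) by (metis countable_subset_image)
  ultimately show ?thesis using that F(3) by metis
qed

lemma left_haar_measureD:
  assumes "left_haar_measure m"
  shows "sets m = sets borel" "compact K \<Longrightarrow> emeasure m K < \<infinity>" "emeasure m UNIV \<noteq> 0"
    "A \<in> sets borel \<Longrightarrow> emeasure m ((\<lambda>x. a + x) ` A) = emeasure m A"
  using assms by (auto simp: left_haar_measure_def)

lemma compact_neighbourhood_0:
  assumes "locally_compact_space (euclidean :: 'a::{t2_space, zero} topology)"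
  obtains U K :: "'a::{t2_space, zero} set" where "open U" "compact K" "0 \<in> U" "U \<subseteq> K"
  using assms unfolding locally_compact_space_def
  by (metis UNIV_I compactin_euclidean_iff open_openin topspace_euclidean)

text \<open>Sigma-finiteness comes from local compactness and second countability: countably many
  translates of an open set inside a compact one cover the group, all of the same finite
  measure.\<close>

lemma left_haar_left_invariant:
  fixes m :: "'a::{topological_group_add, t2_space, second_countable_topology} measure"
  assumes lc: "locally_compact_space (euclidean :: 'a topology)" and m: "left_haar_measure m"
  shows "left_invariant m"
proof
  note mD = left_haar_measureD[OF m]
  have sp: "space m = UNIV" using sets_eq_imp_space_eq[OF mD(1)] by simp
  obtain U K :: "'a set" where UK: "open U" "compact K" "0 \<in> U" "U \<subseteq> K"
    using compact_neighbourhood_0[OF lc] .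
  obtain A where A: "countable A" "(\<Union>a\<in>A. (\<lambda>x. a + x) ` U) = UNIV"
    using countable_translate_cover[OF UK(1)] UK(3) by blast
  have "emeasure m ((\<lambda>x. a + x) ` U) \<noteq> \<infinity>" for a
  proof -
    have "emeasure m ((\<lambda>x. a + x) ` U) = emeasure m U" using UK(1) by (intro mD(4)) auto
    also have "\<dots> \<le> emeasure m K" using UK compact_imp_closed[OF UK(2)] by (intro emeasure_mono) (auto simp: mD(1))
    also have "\<dots> < \<infinity>" by (rule mD(2)[OF UK(2)])
    finally show ?thesis by simp
  qed
  then show "\<exists>B. countable B \<and> B \<subseteq> sets m \<and> \<Union>B = space m \<and> (\<forall>a\<in>B. emeasure m a \<noteq> \<infinity>)"
    using A open_translate[OF UK(1)] by (intro exI[of _ "(\<lambda>a. (\<lambda>x. a + x) ` U) ` A"]) (auto simp: mD(1) sp)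
  show "sets m = sets borel" by (rule mD)
  show "distr m borel (\<lambda>x. a + x) = m" for a
  proof (rule measure_eqI)
    fix X assume "X \<in> sets (distr m borel (\<lambda>x. a + x))"
    then have X [measurable]: "X \<in> sets borel" by simp
    have [measurable]: "(\<lambda>x. a + x) \<in> borel_measurable m"
      unfolding measurable_cong_sets[OF mD(1) refl] by simp
    have "emeasure (distr m borel (\<lambda>x. a + x)) X = emeasure m ((\<lambda>x. a + x) -` X)"
      by (simp add: emeasure_distr sp)
    also have "(\<lambda>x. a + x) -` X = (\<lambda>x. - a + x) ` X"
      using image_translate[of "- a" X] by simp
    also have "emeasure m \<dots> = emeasure m X" by (rule mD(4)[OF X])
    finally show "emeasure (distr m borel (\<lambda>x. a + x)) X = emeasure m X" .
  qed (simp add: mD(1))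
qed

text \<open>Countably many translates of U cover the group, so a null U would make the whole measure
  zero.\<close>

lemma left_haar_open_pos:
  fixes m :: "'a::{topological_group_add, t2_space, second_countable_topology} measure"
  assumes m: "left_haar_measure m" and U: "open U" "U \<noteq> {}"
  shows "emeasure m U \<noteq> 0"
proof
  note mD = left_haar_measureD[OF m]
  assume "emeasure m U = 0"
  obtain A where A: "countable A" "(\<Union>a\<in>A. (\<lambda>x. a + x) ` U) = UNIV"
    using countable_translate_cover[OF U] .
  have "(\<lambda>x. a + x) ` U \<in> null_sets m" for a
    using \<open>emeasure m U = 0\<close> mD(4)[of U a] open_translate[OF U(1)] U(1) by (auto simp: null_sets_def mD(1))
  then have "(\<Union>a\<in>A. (\<lambda>x. a + x) ` U) \<in> null_sets m" by (intro null_sets_UN' A)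
  then show False using A mD(3) by (simp add: null_sets_def)
qed

(* Substituting x by -y + x in the inner integral turns the right-hand side into a product. With f the
   indicator of a compact neighbourhood K and g chosen so that the right-hand side is the measure of A,
   it yields uniqueness of Haar measure. *)
lemma left_invariant_product_integral:
  fixes \<mu> \<nu> :: "'a::{topological_group_add, second_countable_topology} measure"
  assumes \<mu>: "left_invariant \<mu>" and \<nu>: "left_invariant \<nu>"
    and [measurable]: "f \<in> borel_measurable borel" "g \<in> borel_measurable borel"
  shows "(\<integral>\<^sup>+x. f x \<partial>\<mu>) * (\<integral>\<^sup>+y. g y \<partial>\<nu>) = (\<integral>\<^sup>+x. g (- x) * (\<integral>\<^sup>+y. f (y + x) \<partial>\<nu>) \<partial>\<mu>)"
proof -
  interpret m: left_invariant \<mu> by fact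
  interpret n: left_invariant \<nu> by fact
  interpret pair_sigma_finite \<mu> \<nu> ..
  have "(\<integral>\<^sup>+x. g (- x) * (\<integral>\<^sup>+y. f (y + x) \<partial>\<nu>) \<partial>\<mu>) = (\<integral>\<^sup>+x. (\<integral>\<^sup>+y. g (- x) * f (y + x) \<partial>\<nu>) \<partial>\<mu>)"
    by (simp add: nn_integral_cmult)
  also have "\<dots> = (\<integral>\<^sup>+y. (\<integral>\<^sup>+x. g (- x) * f (y + x) \<partial>\<mu>) \<partial>\<nu>)"
    by (rule Fubini'[symmetric]) measurable
  also have "\<dots> = (\<integral>\<^sup>+y. (\<integral>\<^sup>+x. g (- x + y) * f x \<partial>\<mu>) \<partial>\<nu>)"
  proof (rule nn_integral_cong)
    fix y
    have "(\<integral>\<^sup>+x. g (- x + y) * f x \<partial>\<mu>) = (\<integral>\<^sup>+x. g (- (y + x) + y) * f (y + x) \<partial>\<mu>)"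
      by (rule m.nn_integral_translate[symmetric]) measurable
    then show "(\<integral>\<^sup>+x. g (- x) * f (y + x) \<partial>\<mu>) = (\<integral>\<^sup>+x. g (- x + y) * f x \<partial>\<mu>)"
      by (simp add: minus_add add.assoc)
  qed
  also have "\<dots> = (\<integral>\<^sup>+x. (\<integral>\<^sup>+y. g (- x + y) * f x \<partial>\<nu>) \<partial>\<mu>)"
    by (rule Fubini') measurable
  also have "\<dots> = (\<integral>\<^sup>+x. (\<integral>\<^sup>+y. g y \<partial>\<nu>) * f x \<partial>\<mu>)"
    using n.nn_integral_translate[of g] by (intro nn_integral_cong) (simp add: nn_integral_multc)
  also have "\<dots> = (\<integral>\<^sup>+y. g y \<partial>\<nu>) * (\<integral>\<^sup>+x. f x \<partial>\<mu>)" by (simp add: nn_integral_cmult)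
  finally show ?thesis by (simp add: mult.commute)
qed

text \<open>The identity \<open>left_invariant_product_integral\<close> yields a set function C with
  \<open>emeasure \<rho> K * C A = emeasure \<rho> A\<close> for every left invariant
  \<open>\<rho>\<close>; comparing \<open>\<mu>\<close> and \<open>\<nu>\<close> gives the factor.
  It is only an \<open>ennreal\<close>, since K may have measure zero or infinity for
  \<open>\<mu>\<close>; these cases are excluded where the lemma is applied.\<close>

lemma left_invariant_unique:
  fixes \<mu> \<nu> :: "'a::{topological_group_add, t2_space, second_countable_topology} measure"
  assumes lc: "locally_compact_space (euclidean :: 'a topology)"
    and \<mu>: "left_invariant \<mu>" and \<nu>: "left_haar_measure \<nu>"
  obtains c where "\<mu> = scale_measure c \<nu>"
proof -
  interpret m: left_invariant \<mu> by fact
  have \<nu>i: "left_invariant \<nu>" by (rule left_haar_left_invariant[OF lc \<nu>])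
  interpret n: left_invariant \<nu> by fact
  note \<nu>D = left_haar_measureD[OF \<nu>]
  obtain U K :: "'a set" where UK: "open U" "compact K" "0 \<in> U" "U \<subseteq> K"
    using compact_neighbourhood_0[OF lc] .
  have Kb [measurable]: "K \<in> sets borel" using compact_imp_closed[OF UK(2)] by auto
  \<comment> \<open>F x is the \<open>\<nu>\<close>-measure of a right translate of K. It varies
    with x when the group is not unimodular, and the division by F in C corrects this.\<close>
  define F where "F x = (\<integral>\<^sup>+y. indicator K (y + x) \<partial>\<nu>)" for x
  have [measurable]: "F \<in> borel_measurable borel" unfolding F_def by measurable
  have F: "F x \<noteq> 0" "F x < \<infinity>" for x
  proof -
    have c: "continuous_on S (\<lambda>y. y + z)" for z :: 'a and S by (intro continuous_intros)
    have eq: "(\<lambda>y. y + x) -` K = (\<lambda>y. y + - x) ` K"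
      using image_translate_right[of "- x" K] by simp
    have Fx: "F x = emeasure \<nu> ((\<lambda>y. y + x) -` K)"
    proof -
      have "F x = (\<integral>\<^sup>+y. indicator ((\<lambda>y. y + x) -` K) y \<partial>\<nu>)" unfolding F_def by (simp add: indicator_vimage)
      moreover have "(\<lambda>y. y + x) -` K \<in> sets borel" unfolding eq
        by (rule borel_closed[OF compact_imp_closed[OF compact_continuous_image[OF c UK(2)]]])
      ultimately show ?thesis by simp
    qed
    have "compact ((\<lambda>y. y + - x) ` K)" by (rule compact_continuous_image[OF c UK(2)])
    then show "F x < \<infinity>" unfolding Fx eq by (rule \<nu>D(2))
    \<comment> \<open>Positivity of F x: the right translate of U lies in that of K and contains -
      x, so it is open and nonempty.\<close>
    have "open ((\<lambda>y. y + x) -` U)" by (rule open_vimage[OF UK(1) c])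
    moreover have "- x \<in> (\<lambda>y. y + x) -` U" using UK by simp
    ultimately have "emeasure \<nu> ((\<lambda>y. y + x) -` U) \<noteq> 0" by (intro left_haar_open_pos[OF \<nu>]) blast+
    moreover have "emeasure \<nu> ((\<lambda>y. y + x) -` U) \<le> emeasure \<nu> ((\<lambda>y. y + x) -` K)"
      using UK eq compact_imp_closed[OF \<open>compact ((\<lambda>y. y + - x) ` K)\<close>] by (intro emeasure_mono) auto
    ultimately show "F x \<noteq> 0" unfolding Fx by auto
  qed
  \<comment> \<open>The integrand is the function g for which \<open>g (- x) * F x\<close> is the
    indicator of A. The measure \<open>\<rho>\<close> of \<open>key\<close> does not occur in
    it.\<close>
  define C where "C A = (\<integral>\<^sup>+z. indicator A (- z) / F (- z) \<partial>\<nu>)" for A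
  have key: "emeasure \<rho> K * C A = emeasure \<rho> A"
    if \<rho>: "left_invariant \<rho>" and A [measurable]: "A \<in> sets borel" for \<rho> :: "'a measure" and A
  proof -
    interpret r: left_invariant \<rho> by fact
    have "(\<integral>\<^sup>+x. indicator K x \<partial>\<rho>) * C A = (\<integral>\<^sup>+x. (indicator A (- (- x)) / F (- (- x))) * F x \<partial>\<rho>)"
      unfolding C_def
      by (subst left_invariant_product_integral[OF \<rho> \<nu>i]) (simp_all add: F_def)
    also have "\<dots> = (\<integral>\<^sup>+x. indicator A x \<partial>\<rho>)"
      using F by (intro nn_integral_cong) (simp add: ennreal_divide_times less_top[symmetric])
    finally show ?thesis by simp
  qed
  have K0: "emeasure \<nu> K \<noteq> 0" "emeasure \<nu> K < \<infinity>"
    using F[of 0] by (simp_all add: F_def)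
  show ?thesis
  proof (rule that[of "emeasure \<mu> K / emeasure \<nu> K"], rule measure_eqI)
    fix A assume "A \<in> sets \<mu>"
    then have A: "A \<in> sets borel" by simp
    have "emeasure \<mu> A = emeasure \<mu> K / emeasure \<nu> K * (emeasure \<nu> K * C A)"
      using key[OF \<mu> A] K0 by (simp add: ennreal_divide_times mult.assoc[symmetric] less_top[symmetric])
    then show "emeasure \<mu> A = emeasure (scale_measure (emeasure \<mu> K / emeasure \<nu> K) \<nu>) A"
      by (simp add: key[OF \<nu>i A])
  qed simp
qed

section \<open>Product Haar measure and independence of the normalisation\<close>

lemma left_invariant_pair_measure:
  fixes m1 :: "'a::{topological_group_add, second_countable_topology} measure"
    and m2 :: "'b::{topological_group_add, second_countable_topology} measure"
  assumes "left_invariant m1" "left_invariant m2"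
  shows "left_invariant (m1 \<Otimes>\<^sub>M m2)"
proof -
  interpret m1: left_invariant m1 by fact
  interpret m2: left_invariant m2 by fact
  interpret P: pair_sigma_finite m1 m2 ..
  \<comment> \<open>By second countability the product of the Borel sigma-algebras is the Borel
    sigma-algebra of the product.\<close>
  have sets: "sets (m1 \<Otimes>\<^sub>M m2) = sets borel"
    by (simp add: borel_prod[symmetric] cong: sets_pair_measure_cong)
  show ?thesis
  proof
    show "sets (m1 \<Otimes>\<^sub>M m2) = sets borel" by (rule sets)
    show "distr (m1 \<Otimes>\<^sub>M m2) borel (\<lambda>x. a + x) = m1 \<Otimes>\<^sub>M m2" for a :: "'a \<times> 'b"
    proof -
      have "m1 \<Otimes>\<^sub>M m2 = distr m1 borel (\<lambda>x. fst a + x) \<Otimes>\<^sub>M distr m2 borel (\<lambda>x. snd a + x)"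
        by (simp only: m1.distr_translate m2.distr_translate)
      also have "\<dots> = distr (m1 \<Otimes>\<^sub>M m2) (borel \<Otimes>\<^sub>M borel) (\<lambda>(x, y). (fst a + x, snd a + y))"
        by (rule pair_measure_distr) (simp_all add: m2.distr_translate m2.sigma_finite_measure_axioms)
      also have "\<dots> = distr (m1 \<Otimes>\<^sub>M m2) borel (\<lambda>x. a + x)"
        by (intro distr_cong arg_cong[OF borel_prod]) (auto simp: plus_prod_def)
      finally show ?thesis by simp
    qed
  qed
qed

lemma scale_measure_eq_density: "scale_measure c M = density M (\<lambda>_. c)"
  by (rule measure_eqI) (simp_all add: emeasure_density_const)

text \<open>Squared norms on both sides of an operator bound scale by r, so the bounds are the same;
  the measure f d(r m) is (r f) dm, so the approximating L1 functions are only rescaled.\<close>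

lemma extended_uniqueness_scale_measure:
  assumes m: "left_invariant m" and n: "left_invariant (scale_measure (ennreal r) m)" and r: "0 < r"
  shows "extended_uniqueness (scale_measure (ennreal r) m) E \<longleftrightarrow> extended_uniqueness m E"
proof -
  interpret m: left_invariant m by fact
  interpret n: left_invariant "scale_measure (ennreal r) m" by fact
  let ?n = "scale_measure (ennreal r) m"
  have int: "integrable ?n f \<longleftrightarrow> integrable m f" for f :: "'a \<Rightarrow> 'c::{banach, second_countable_topology}"
  proof (cases "f \<in> borel_measurable m")
    case True then show ?thesis
      using r integrable_scaleR_right[of "1 / r" m "\<lambda>x. r *\<^sub>R f x"]
      by (auto simp: scale_measure_eq_density integrable_density)
  next
    case False then show ?thesis using measurable_cong_sets[OF sets_scale_measure refl] by (metis borel_measurable_integrable)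
  qed
  have L1: "L1 ?n = L1 m" by (simp add: L1_def int)
  have L2: "L2 ?n = L2 m" using measurable_cong_sets[OF sets_scale_measure refl] by (auto simp: L2_def int)
  have sq: "sqnorm ?n \<xi> = ennreal r * sqnorm m \<xi>" if "\<xi> \<in> borel_measurable borel" for \<xi>
    unfolding sqnorm_def using that by (subst nn_integral_scale_measure) auto
  have AE: "(AE x in ?n. P x) \<longleftrightarrow> (AE x in m. P x)" for P
    unfolding scale_measure_eq_density using r by (subst AE_density) auto
  have L1m: "L1_measure ?n f A = L1_measure m (\<lambda>x. complex_of_real r * f x) A" if "f \<in> L1 m" "A \<in> sets borel" for f A
    unfolding L1_measure_def set_lebesgue_integral_def scale_measure_eq_density using r that
    by (subst integral_density) (auto simp: L1_def scaleR_conv_of_real mult_ac intro!: Bochner_Integration.integral_cong)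
  have bound: "op_bound ?n (conv_op \<mu>) e \<longleftrightarrow> op_bound m (conv_op \<mu>) e" if \<mu>: "complex_borel_measure \<mu>" for \<mu> e
    unfolding op_bound_def L2
  proof (intro ball_cong refl)
    fix \<xi> assume \<xi>: "\<xi> \<in> L2 m"
    have "sqnorm ?n (conv_op \<mu> \<xi>) \<le> ennreal e * sqnorm ?n \<xi> \<longleftrightarrow>
        ennreal r * sqnorm m (conv_op \<mu> \<xi>) \<le> ennreal r * (ennreal e * sqnorm m \<xi>)"
      using m.L2_borel[OF \<xi>] by (simp add: sq m.conv_op_measurable[OF \<mu>] mult_ac)
    also have "\<dots> \<longleftrightarrow> sqnorm m (conv_op \<mu> \<xi>) \<le> ennreal e * sqnorm m \<xi>"
      using r by (subst ennreal_mult_le_mult_iff) auto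
    finally show "sqnorm ?n (conv_op \<mu> \<xi>) \<le> ennreal e * sqnorm ?n \<xi> \<longleftrightarrow> sqnorm m (conv_op \<mu> \<xi>) \<le> ennreal e * sqnorm m \<xi>" .
  qed
  have eqm: "op_bound ?n (conv_op (\<lambda>A. \<mu> A - L1_measure ?n f A)) e \<longleftrightarrow> op_bound m (conv_op (\<lambda>A. \<mu> A - L1_measure m (\<lambda>x. complex_of_real r * f x) A)) e"
    if \<mu>: "complex_borel_measure \<mu>" and f: "f \<in> L1 m" for \<mu> f e
  proof -
    have rf: "(\<lambda>x. complex_of_real r * f x) \<in> L1 m" using f by (auto simp: L1_def)
    have c1: "complex_borel_measure (\<lambda>A. \<mu> A - L1_measure ?n f A)"
      using f L1 by (intro complex_borel_measure_diff[OF \<mu>] n.complex_borel_measure_L1_measure) auto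
    have c2: "complex_borel_measure (\<lambda>A. \<mu> A - L1_measure m (\<lambda>x. complex_of_real r * f x) A)"
      by (intro complex_borel_measure_diff[OF \<mu>] m.complex_borel_measure_L1_measure rf)
    have "sqnorm m (conv_op (\<lambda>A. \<mu> A - L1_measure ?n f A) \<xi>) = sqnorm m (conv_op (\<lambda>A. \<mu> A - L1_measure m (\<lambda>x. complex_of_real r * f x) A) \<xi>)"
      if "\<xi> \<in> L2 m" for \<xi>
      by (intro sqnorm_cong_AE m.conv_op_cong[OF c2 _ that]) (simp add: L1m[OF f])
    then show ?thesis unfolding bound[OF c1] by (simp add: op_bound_def)
  qed
  have scale: "(\<lambda>x. complex_of_real s * f x) \<in> L1 m" if "f \<in> L1 m" for f s using that by (auto simp: L1_def)
  have "approximable ?n \<mu> \<longleftrightarrow> approximable m \<mu>" if \<mu>: "complex_borel_measure \<mu>" for \<mu>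
    unfolding approximable_def L1
  proof (intro all_cong1 imp_cong refl iffI; elim bexE)
    fix e f assume f: "f \<in> L1 m" "op_bound ?n (conv_op (\<lambda>A. \<mu> A - L1_measure ?n f A)) e"
    then show "\<exists>f\<in>L1 m. op_bound m (conv_op (\<lambda>A. \<mu> A - L1_measure m f A)) e"
      using eqm[OF \<mu> f(1)] scale[OF f(1)] by blast
  next
    fix e f assume f: "f \<in> L1 m" "op_bound m (conv_op (\<lambda>A. \<mu> A - L1_measure m f A)) e"
    have "(\<lambda>x. complex_of_real r * (complex_of_real (1 / r) * f x)) = f" using r by auto
    then show "\<exists>f\<in>L1 m. op_bound ?n (conv_op (\<lambda>A. \<mu> A - L1_measure ?n f A)) e"
      using eqm[OF \<mu> scale[OF f(1)], of "1 / r" e] scale[OF f(1), of "1 / r"] f(2) by auto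
  qed
  then show ?thesis
    unfolding m.extended_uniqueness_iff n.extended_uniqueness_iff L2_zero_ops_def L2 AE
    by (auto simp: measures_on_def)
qed

lemma extended_uniqueness_pair_measure:
  fixes m1 :: "'a::{topological_group_add, t2_space, second_countable_topology} measure"
    and m2 :: "'b::{topological_group_add, t2_space, second_countable_topology} measure"
  assumes lc1: "locally_compact_space (euclidean :: 'a topology)"
    and lc2: "locally_compact_space (euclidean :: 'b topology)"
    and m1: "left_haar_measure m1" and m2: "left_haar_measure m2" and m: "left_haar_measure m"
  shows "extended_uniqueness m E \<longleftrightarrow> extended_uniqueness (m1 \<Otimes>\<^sub>M m2) E"
proof -
  have lc: "locally_compact_space (euclidean :: ('a \<times> 'b) topology)"
    using lc1 lc2 by (simp add: locally_compact_space_prod_topology flip: prod_topology_euclidean)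
  have i1: "left_invariant m1" and i2: "left_invariant m2" and i: "left_invariant m"
    using left_haar_left_invariant lc1 lc2 lc m1 m2 m by blast+
  have P: "left_invariant (m1 \<Otimes>\<^sub>M m2)" by (rule left_invariant_pair_measure[OF i1 i2])
  interpret m1: left_invariant m1 by fact
  interpret m2: left_invariant m2 by fact
  interpret P: left_invariant "m1 \<Otimes>\<^sub>M m2" by fact
  interpret m: left_invariant m by fact
  obtain c where c: "m1 \<Otimes>\<^sub>M m2 = scale_measure c m" using left_invariant_unique[OF lc P m] .
  have "emeasure (m1 \<Otimes>\<^sub>M m2) (UNIV \<times> UNIV) \<noteq> 0"
    using left_haar_measureD(3)[OF m1] left_haar_measureD(3)[OF m2]
    by (subst m2.emeasure_pair_measure_Times) auto
  then have U: "emeasure (m1 \<Otimes>\<^sub>M m2) UNIV \<noteq> 0" by simp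
  then have "c \<noteq> 0" unfolding c by auto
  \<comment> \<open>With an infinite factor every set of finite product measure would be null, and
    sigma-finiteness would make the whole product measure zero.\<close>
  moreover have "c \<noteq> top"
  proof
    assume top: "c = top"
    obtain A where A: "countable A" "A \<subseteq> sets (m1 \<Otimes>\<^sub>M m2)" "\<Union>A = space (m1 \<Otimes>\<^sub>M m2)" "\<forall>a\<in>A. emeasure (m1 \<Otimes>\<^sub>M m2) a \<noteq> \<infinity>"
      using P.sigma_finite_countable by blast
    have "a \<in> null_sets (m1 \<Otimes>\<^sub>M m2)" if "a \<in> A" for a
      using A(2,4) that unfolding c top by (auto simp: null_sets_def ennreal_top_mult split: if_splits)
    then have "(\<Union>a\<in>A. a) \<in> null_sets (m1 \<Otimes>\<^sub>M m2)" by (intro null_sets_UN' A)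
    then show False using A(3) U by (simp add: null_sets_def)
  qed
  ultimately obtain r where r: "c = ennreal r" "0 < r" by (cases c) (auto simp: ennreal_eq_0_iff)
  show ?thesis
    using extended_uniqueness_scale_measure[OF i _ r(2), of E] P unfolding c r(1) by simp
qed

subsection \<open>Slices of measures on a product\<close>

lemma ennreal_le_sqrt:
  fixes X :: ennreal
  assumes "X\<^sup>2 \<le> ennreal q" "0 \<le> q"
  shows "X \<le> ennreal (sqrt q)"
proof (cases X)
  case (real r)
  then have "r\<^sup>2 \<le> q" using assms by (simp add: ennreal_power)
  then show ?thesis using real by (auto intro!: ennreal_leI real_le_rsqrt)
next
  case top then show ?thesis using assms by (simp add: top_unique power2_eq_square)
qed

lemma nn_integral_norm_mult_square_le:
  assumes [measurable]: "f \<in> borel_measurable M" "g \<in> borel_measurable M"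
  shows "(\<integral>\<^sup>+x. ennreal (norm (f x * g x :: complex)) \<partial>M)\<^sup>2 \<le> sqnorm M f * sqnorm M g"
  using Cauchy_Schwarz_nn_integral[of "\<lambda>x. ennreal (norm (f x))" M "\<lambda>x. ennreal (norm (g x))"]
  by (simp add: sqnorm_def norm_mult ennreal_mult ennreal_power)

definition tensor :: "('a \<Rightarrow> complex) \<Rightarrow> ('b \<Rightarrow> complex) \<Rightarrow> 'a \<times> 'b \<Rightarrow> complex" where
  "tensor \<xi> \<eta> z = \<xi> (fst z) * \<eta> (snd z)"

text \<open>The matrix coefficient of the left regular representation, without conjugation of
  \<open>\<eta>\<close>; it is thus bilinear, and the inner product is recovered by conjugating
  \<open>\<eta>\<close>.\<close>

definition coefficient :: "'b::group_add measure \<Rightarrow> ('b \<Rightarrow> complex) \<Rightarrow> ('b \<Rightarrow> complex) \<Rightarrow> 'b \<Rightarrow> complex" where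
  "coefficient m \<xi> \<eta> t = (\<integral>y. \<xi> (- t + y) * \<eta> y \<partial>m)"

text \<open>The image under the first projection of the measure u(t) d kappa(s,t); for constant u =
  1 it is the first marginal.\<close>

definition slice ::
    "('b::topological_space \<Rightarrow> complex) \<Rightarrow> (('a::topological_space \<times> 'b) set \<Rightarrow> complex) \<Rightarrow> 'a set \<Rightarrow> complex" where
  "slice u \<kappa> A = complex_measure_integral \<kappa> (\<lambda>z. indicator A (fst z) * u (snd z))"

lemma borel_measurable_fst [measurable]: "fst \<in> borel_measurable (borel :: ('a::topological_space \<times> 'b::topological_space) measure)"
  and borel_measurable_snd [measurable]: "snd \<in> borel_measurable (borel :: ('a \<times> 'b) measure)"
  by (intro borel_measurable_continuous_onI continuous_intros)+

lemma represents_slice: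
  fixes \<kappa> :: "('a::{second_countable_topology} \<times> 'b::{second_countable_topology}) set \<Rightarrow> complex"
  assumes r: "represents \<kappa> M \<pi> h" and u [measurable]: "u \<in> borel_measurable borel" and B: "\<And>t. norm (u t) \<le> B"
  shows "represents (slice u \<kappa>) M (\<lambda>w. fst (\<pi> w)) (\<lambda>w. u (snd (\<pi> w)) * h w)"
proof -
  note [measurable] = representsD(2,4)[OF r]
  have int: "integrable M (\<lambda>w. u (snd (\<pi> w)) * h w)"
  proof (rule Bochner_Integration.integrable_bound)
    show "integrable M (\<lambda>w. B * norm (h w))" using representsD(3)[OF r] by simp
    show "AE w in M. norm (u (snd (\<pi> w)) * h w) \<le> norm (B * norm (h w))"
      using B by (auto simp: norm_mult abs_mult intro!: mult_right_mono order_trans[OF B abs_ge_self])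
  qed measurable
  have "slice u \<kappa> A = (\<integral>w. indicator A (fst (\<pi> w)) * (u (snd (\<pi> w)) * h w) \<partial>M)" if [measurable]: "A \<in> sets borel" for A
  proof -
    have "integrable M (\<lambda>w. indicator A (fst (\<pi> w)) * (u (snd (\<pi> w)) * h w))"
      by (rule Bochner_Integration.integrable_bound[OF int]) (auto simp: indicator_def)
    then show ?thesis
      unfolding slice_def by (subst represents_integral[OF r]) (simp_all add: mult.assoc)
  qed
  then show ?thesis using int representsD(1)[OF r] by (simp add: represents_def)
qed

lemma slice_diff:
  fixes \<mu> :: "('a::{second_countable_topology} \<times> 'b::{second_countable_topology}) set \<Rightarrow> complex"
  assumes \<mu>: "complex_borel_measure \<mu>" and \<nu>: "complex_borel_measure \<nu>"
    and u: "u \<in> borel_measurable borel" "\<And>t. norm (u t) \<le> B" and A: "A \<in> sets borel"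
  shows "slice u (\<lambda>A. \<mu> A - \<nu> A) A = slice u \<mu> A - slice u \<nu> A"
proof -
  obtain M h k where "finite_measure M" "sets M = sets borel" and r: "represents \<mu> M (\<lambda>x. x) h" and s: "represents \<nu> M (\<lambda>x. x) k"
    by (rule represents_common[OF \<mu> \<nu>])
  note D = represents_diff[OF represents_slice[OF r u] represents_slice[OF s u]]
  show ?thesis
    using representsD(5)[OF represents_slice[OF represents_diff[OF r s] u] A] representsD(5)[OF D A]
    by (simp add: right_diff_distrib)
qed

lemma measures_onI:
  assumes "complex_borel_measure \<mu>" "closed E" "\<And>A. A \<in> sets borel \<Longrightarrow> A \<subseteq> - E \<Longrightarrow> \<mu> A = 0"
  shows "\<mu> \<in> measures_on E"
proof -
  have "\<exists>A\<in>sets borel. A \<subseteq> - E \<and> \<mu> A \<noteq> 0" if "x \<in> measure_support \<mu>" "x \<notin> E" for x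
    using that assms(2) unfolding measure_support_def closed_def by blast
  then have "measure_support \<mu> \<subseteq> E" using assms(3) by blast
  then show ?thesis using assms(1) by (simp add: measures_on_def)
qed

text \<open>The complement of the support is a union of open sets on which all Borel subsets have
  measure zero. By Lindelof countably many of them suffice, and on each the density vanishes almost
  everywhere.\<close>

lemma represents_AE_zero:
  fixes \<mu> :: "'a::second_countable_topology set \<Rightarrow> complex"
  assumes \<mu>: "\<mu> \<in> measures_on E" and r: "represents \<mu> M (\<lambda>x. x) h" and M: "sets M = sets borel"
  shows "AE w in M. w \<notin> E \<longrightarrow> h w = 0"
proof -
  interpret sigma_finite_measure M by (rule representsD(1)[OF r])
  note [measurable] = representsD(4)[OF r]
  have sp: "space M = UNIV" using sets_eq_imp_space_eq[OF M] by simp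
  let ?F = "{U. open U \<and> (\<forall>A\<in>sets borel. A \<subseteq> U \<longrightarrow> \<mu> A = 0)}"
  obtain F where F: "F \<subseteq> ?F" "countable F" "\<Union>F = \<Union>?F"
    using Lindelof[of ?F] by blast
  have "AE w in M. w \<in> U \<longrightarrow> h w = 0" if "U \<in> F" for U
  proof -
    have U: "U \<in> sets borel" "\<And>A. A \<in> sets borel \<Longrightarrow> A \<subseteq> U \<Longrightarrow> \<mu> A = 0" using that F(1) by auto
    then have [measurable]: "U \<in> sets M" by (simp add: M)
    have "AE w in M. indicator U w * h w = 0"
    proof (rule density_zero)
      show "integrable M (\<lambda>w. indicator U w * h w)"
        by (rule Bochner_Integration.integrable_bound[OF representsD(3)[OF r]]) (auto simp: indicator_def)
      fix A assume "A \<in> sets M"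
      then have A: "A \<inter> U \<in> sets borel" using U by (simp add: M)
      have "(\<integral>w\<in>A. indicator U w * h w \<partial>M) = (\<integral>w. indicator (A \<inter> U) w * h w \<partial>M)"
        unfolding set_lebesgue_integral_def
        by (intro Bochner_Integration.integral_cong) (auto simp: indicator_def)
      also have "\<dots> = \<mu> (A \<inter> U)" by (rule representsD(5)[OF r A, symmetric])
      finally show "(\<integral>w\<in>A. indicator U w * h w \<partial>M) = 0" using U(2)[OF A] by simp
    qed
    then show ?thesis by eventually_elim (auto simp: indicator_def)
  qed
  then have "AE w in M. \<forall>U\<in>F. w \<in> U \<longrightarrow> h w = 0" by (subst AE_ball_countable[OF F(2)]) blast
  then show ?thesis
  proof eventually_elim
    case (elim w)
    show ?case
    proof
      assume "w \<notin> E"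
      then have "w \<notin> measure_support \<mu>" using \<mu> by (auto simp: measures_on_def)
      then obtain U where "open U" "w \<in> U" "\<And>A. A \<in> sets borel \<Longrightarrow> A \<subseteq> U \<Longrightarrow> \<mu> A = 0"
        unfolding measure_support_def by auto
      then have "w \<in> \<Union>F" unfolding F(3) by (intro UnionI[of U]) simp_all
      then show "h w = 0" using elim by auto
    qed
  qed
qed

lemma slice_measures_on:
  fixes \<mu> :: "('a::{second_countable_topology} \<times> 'b::{second_countable_topology}) set \<Rightarrow> complex"
  assumes \<mu>: "\<mu> \<in> measures_on (E1 \<times> E2)" and E1: "closed E1"
    and u: "u \<in> borel_measurable borel" "\<And>t. norm (u t) \<le> B"
  shows "slice u \<mu> \<in> measures_on E1"
proof -
  have c: "complex_borel_measure \<mu>" using \<mu> by (simp add: measures_on_def)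
  obtain M h where M: "finite_measure M" "sets M = sets borel" and r: "represents \<mu> M (\<lambda>x. x) h"
    by (rule represents_common[OF c c])
  note s = represents_slice[OF r u]
  have "slice u \<mu> A = 0" if A: "A \<in> sets borel" "A \<subseteq> - E1" for A
    unfolding representsD(5)[OF s A(1)]
  proof (rule integral_eq_zero_AE)
    show "AE w in M. indicator A (fst w) * (u (snd w) * h w) = 0"
      using represents_AE_zero[OF \<mu> r M(2)] by eventually_elim (use A(2) in \<open>auto simp: indicator_def\<close>)
  qed
  with represents_complex_borel_measure[OF s] E1 show ?thesis by (intro measures_onI)
qed

section \<open>Convolution operators of slices\<close>

locale left_invariant_pair = G1: left_invariant m1 + G2: left_invariant m2
  for m1 :: "'a::{topological_group_add, second_countable_topology} measure"
    and m2 :: "'b::{topological_group_add, second_countable_topology} measure"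
begin

sublocale pair_sigma_finite m1 m2 ..

sublocale P: left_invariant "m1 \<Otimes>\<^sub>M m2"
  by (rule left_invariant_pair_measure) unfold_locales

lemma sqnorm_tensor:
  assumes [measurable]: "\<xi> \<in> borel_measurable borel" "\<eta> \<in> borel_measurable borel"
  shows "sqnorm (m1 \<Otimes>\<^sub>M m2) (tensor \<xi> \<eta>) = sqnorm m1 \<xi> * sqnorm m2 \<eta>"
proof -
  have "sqnorm (m1 \<Otimes>\<^sub>M m2) (tensor \<xi> \<eta>) = (\<integral>\<^sup>+x. (\<integral>\<^sup>+y. ennreal ((norm (\<xi> x))\<^sup>2) * ennreal ((norm (\<eta> y))\<^sup>2) \<partial>m2) \<partial>m1)"
    unfolding sqnorm_def tensor_def
    by (subst G2.nn_integral_fst[symmetric]) (auto simp: norm_mult power_mult_distrib ennreal_mult)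
  also have "\<dots> = sqnorm m1 \<xi> * sqnorm m2 \<eta>"
    by (simp add: nn_integral_cmult nn_integral_multc sqnorm_def)
  finally show ?thesis .
qed

lemma tensor_L2: "\<xi> \<in> L2 m1 \<Longrightarrow> \<eta> \<in> L2 m2 \<Longrightarrow> tensor \<xi> \<eta> \<in> L2 (m1 \<Otimes>\<^sub>M m2)"
proof -
  assume a: "\<xi> \<in> L2 m1" "\<eta> \<in> L2 m2"
  note [measurable] = G1.L2_borel[OF a(1)] G2.L2_borel[OF a(2)]
  have "tensor \<xi> \<eta> \<in> borel_measurable (m1 \<Otimes>\<^sub>M m2)" unfolding tensor_def[abs_def] by measurable
  then show ?thesis using a by (simp add: L2_iff_sqnorm sqnorm_tensor ennreal_mult_less_top)
qed

text \<open>Cauchy-Schwarz and left invariance, uniformly in t. The version with the modulus under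
  the integral is what Tonelli needs in \<open>conv_op_slice\<close>.\<close>

lemma coefficient_bound:
  assumes \<xi>: "\<xi> \<in> L2 m2" and \<eta>: "\<eta> \<in> L2 m2"
  shows "(\<integral>\<^sup>+y. ennreal (norm (\<xi> (- t + y) * \<eta> y)) \<partial>m2) \<le> ennreal (L2_norm m2 \<xi> * L2_norm m2 \<eta>)"
    and "norm (coefficient m2 \<xi> \<eta> t) \<le> L2_norm m2 \<xi> * L2_norm m2 \<eta>"
    and "coefficient m2 \<xi> \<eta> \<in> borel_measurable borel"
proof -
  note [measurable] = G2.L2_borel[OF \<xi>] G2.L2_borel[OF \<eta>]
  have "(\<integral>\<^sup>+y. ennreal (norm (\<xi> (- t + y) * \<eta> y)) \<partial>m2)\<^sup>2 \<le> sqnorm m2 (\<lambda>y. \<xi> (- t + y)) * sqnorm m2 \<eta>"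
    by (rule nn_integral_norm_mult_square_le) measurable
  also have "sqnorm m2 (\<lambda>y. \<xi> (- t + y)) = sqnorm m2 \<xi>"
    unfolding sqnorm_def by (rule G2.nn_integral_translate) measurable
  also have "sqnorm m2 \<xi> * sqnorm m2 \<eta> = ennreal ((L2_norm m2 \<xi> * L2_norm m2 \<eta>)\<^sup>2)"
    by (simp add: sqnorm_eq_L2_norm \<xi> \<eta> ennreal_mult power_mult_distrib)
  finally show *: "(\<integral>\<^sup>+y. ennreal (norm (\<xi> (- t + y) * \<eta> y)) \<partial>m2) \<le> ennreal (L2_norm m2 \<xi> * L2_norm m2 \<eta>)"
    using ennreal_le_sqrt by (fastforce simp: L2_norm_nonneg real_sqrt_abs abs_mult)
  show "norm (coefficient m2 \<xi> \<eta> t) \<le> L2_norm m2 \<xi> * L2_norm m2 \<eta>"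
  proof (cases "integrable m2 (\<lambda>y. \<xi> (- t + y) * \<eta> y)")
    case True
    then show ?thesis
      using order_trans[OF integral_norm_bound_ennreal[OF True] *]
      by (simp add: coefficient_def L2_norm_nonneg)
  next
    \<comment> \<open>An integral that does not exist has the value 0, so the bound
      persists.\<close>
    case False
    then show ?thesis by (simp add: coefficient_def not_integrable_integral_eq L2_norm_nonneg)
  qed
  show "coefficient m2 \<xi> \<eta> \<in> borel_measurable borel"
    unfolding coefficient_def[abs_def] by measurable
qed

text \<open>The slice map on operators: pair lambda(kappa)(xi1 x xi2) with \<open>\<eta>\<close> in
  the second variable. By Fubini the integration over y can be done first, and it replaces the
  translate of \<open>\<xi>2\<close> by the coefficient at t.\<close>

lemma conv_op_slice:
  fixes \<kappa> :: "('a \<times> 'b) set \<Rightarrow> complex"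
  assumes \<kappa>: "complex_borel_measure \<kappa>" and \<xi>1: "\<xi>1 \<in> L2 m1" and \<xi>2: "\<xi>2 \<in> L2 m2" and \<eta>: "\<eta> \<in> L2 m2"
  shows "AE x in m1. conv_op (slice (coefficient m2 \<xi>2 \<eta>) \<kappa>) \<xi>1 x = (\<integral>y. conv_op \<kappa> (tensor \<xi>1 \<xi>2) (x, y) * \<eta> y \<partial>m2)"
proof -
  obtain M h where M: "finite_measure M" "sets M = sets borel" and r: "represents \<kappa> M (\<lambda>x. x) h"
    by (rule represents_common[OF \<kappa> \<kappa>])
  interpret M: finite_measure M by fact
  interpret Q: pair_sigma_finite M m2 ..
  note [measurable] = G1.L2_borel[OF \<xi>1] G2.L2_borel[OF \<xi>2] G2.L2_borel[OF \<eta>] representsD(4)[OF r]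
  note [measurable_cong] = M(2)
  let ?u = "coefficient m2 \<xi>2 \<eta>"
  note s = represents_slice[OF r coefficient_bound(3)[OF \<xi>2 \<eta>] coefficient_bound(2)[OF \<xi>2 \<eta>]]
  \<comment> \<open>The marginal of \<open>\<kappa>\<close> enters only through its convolution with
    \<open>\<xi>1\<close>: its existence at almost every x is the integrability in the first
    variable on which Fubini rests, the second variable being bounded uniformly by
    \<open>coefficient_bound\<close>.\<close>
  have one: "represents (slice (\<lambda>_. 1) \<kappa>) M fst (\<lambda>w. 1 * h w)"
    by (rule represents_slice[OF r, where B = 1]) auto
  show ?thesis
    using G1.conv_op_eq_integral[OF s \<xi>1] G1.conv_op_eq_integral[OF one \<xi>1]
      AE_pair[OF P.conv_op_eq_integral[OF r tensor_L2[OF \<xi>1 \<xi>2]]]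
  proof eventually_elim
    case (elim x)
    let ?f = "\<lambda>w y. \<xi>1 (- fst w + x) * \<xi>2 (- snd w + y) * h w * \<eta> y"
    have int: "integrable (M \<Otimes>\<^sub>M m2) (case_prod ?f)"
    proof (rule integrableI_bounded)
      have "(\<integral>\<^sup>+z. norm (case_prod ?f z) \<partial>(M \<Otimes>\<^sub>M m2)) = (\<integral>\<^sup>+w. (\<integral>\<^sup>+y. ennreal (norm (?f w y)) \<partial>m2) \<partial>M)"
        by (subst G2.nn_integral_fst[symmetric]) auto
      also have "\<dots> = (\<integral>\<^sup>+w. ennreal (norm (\<xi>1 (- fst w + x) * (1 * h w))) * (\<integral>\<^sup>+y. ennreal (norm (\<xi>2 (- snd w + y) * \<eta> y)) \<partial>m2) \<partial>M)"
        by (subst nn_integral_cmult[symmetric]) (auto simp: norm_mult ennreal_mult mult_ac)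
      also have "\<dots> \<le> (\<integral>\<^sup>+w. ennreal (norm (\<xi>1 (- fst w + x) * (1 * h w))) * ennreal (L2_norm m2 \<xi>2 * L2_norm m2 \<eta>) \<partial>M)"
        by (intro nn_integral_mono mult_left_mono coefficient_bound \<xi>2 \<eta>) auto
      also have "\<dots> = (\<integral>\<^sup>+w. ennreal (norm (\<xi>1 (- fst w + x) * (1 * h w))) \<partial>M) * ennreal (L2_norm m2 \<xi>2 * L2_norm m2 \<eta>)"
        by (rule nn_integral_multc) measurable
      also have "\<dots> < \<infinity>"
        using elim by (auto simp: ennreal_mult_less_top integrable_iff_bounded)
      finally show "(\<integral>\<^sup>+z. norm (case_prod ?f z) \<partial>(M \<Otimes>\<^sub>M m2)) < \<infinity>" .
    qed measurable
    have "(\<integral>y. conv_op \<kappa> (tensor \<xi>1 \<xi>2) (x, y) * \<eta> y \<partial>m2) = (\<integral>y. (\<integral>w. ?f w y \<partial>M) \<partial>m2)"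
    proof (rule integral_cong_AE)
      have [measurable]: "conv_op \<kappa> (tensor \<xi>1 \<xi>2) \<in> borel_measurable borel"
        by (rule P.conv_op_measurable[OF \<kappa> P.L2_borel[OF tensor_L2[OF \<xi>1 \<xi>2]]])
      show "(\<lambda>y. conv_op \<kappa> (tensor \<xi>1 \<xi>2) (x, y) * \<eta> y) \<in> borel_measurable m2" by measurable
      show "(\<lambda>y. \<integral>w. ?f w y \<partial>M) \<in> borel_measurable m2" by measurable
      have "AE y in m2. conv_op \<kappa> (tensor \<xi>1 \<xi>2) (x, y) = (\<integral>w. tensor \<xi>1 \<xi>2 (- w + (x, y)) * h w \<partial>M)"
        using elim by auto
      then show "AE y in m2. conv_op \<kappa> (tensor \<xi>1 \<xi>2) (x, y) * \<eta> y = (\<integral>w. ?f w y \<partial>M)"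
        by eventually_elim (simp add: tensor_def flip: integral_mult_left_zero)
    qed
    also have "\<dots> = (\<integral>w. (\<integral>y. ?f w y \<partial>m2) \<partial>M)" by (rule Q.Fubini_integral[OF int])
    also have "\<dots> = (\<integral>w. \<xi>1 (- fst w + x) * (?u (snd w) * h w) \<partial>M)"
    proof (rule Bochner_Integration.integral_cong[OF refl])
      fix w
      have eq: "?f w y = (\<xi>1 (- fst w + x) * h w) * (\<xi>2 (- snd w + y) * \<eta> y)" for y by (simp add: mult_ac)
      have "(\<integral>y. ?f w y \<partial>m2) = (\<xi>1 (- fst w + x) * h w) * ?u (snd w)"
        unfolding eq coefficient_def by (rule integral_mult_right_zero)
      then show "(\<integral>y. ?f w y \<partial>m2) = \<xi>1 (- fst w + x) * (?u (snd w) * h w)" by (simp add: mult_ac)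
    qed
    finally show ?case using elim by simp
  qed
qed

text \<open>Cauchy-Schwarz in y, for each x, then the bound for \<open>\<kappa>\<close> applied to a
  tensor, whose squared norm factors.\<close>

lemma op_bound_slice:
  fixes \<kappa> :: "('a \<times> 'b) set \<Rightarrow> complex"
  assumes \<kappa>: "complex_borel_measure \<kappa>" and \<xi>2: "\<xi>2 \<in> L2 m2" and \<eta>: "\<eta> \<in> L2 m2"
    and e: "op_bound (m1 \<Otimes>\<^sub>M m2) (conv_op \<kappa>) e" "0 \<le> e"
  shows "op_bound m1 (conv_op (slice (coefficient m2 \<xi>2 \<eta>) \<kappa>)) (e * ((L2_norm m2 \<xi>2)\<^sup>2 * (L2_norm m2 \<eta>)\<^sup>2))"
  unfolding op_bound_def
proof
  fix \<xi>1 assume \<xi>1: "\<xi>1 \<in> L2 m1"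
  let ?F = "conv_op \<kappa> (tensor \<xi>1 \<xi>2)"
  note [measurable] = G1.L2_borel[OF \<xi>1] G2.L2_borel[OF \<xi>2] G2.L2_borel[OF \<eta>]
    P.conv_op_measurable[OF \<kappa> P.L2_borel[OF tensor_L2[OF \<xi>1 \<xi>2]]]
  have "sqnorm m1 (conv_op (slice (coefficient m2 \<xi>2 \<eta>) \<kappa>) \<xi>1) = sqnorm m1 (\<lambda>x. \<integral>y. ?F (x, y) * \<eta> y \<partial>m2)"
    by (rule sqnorm_cong_AE[OF conv_op_slice[OF \<kappa> \<xi>1 \<xi>2 \<eta>]])
  also have "\<dots> \<le> (\<integral>\<^sup>+x. sqnorm m2 (\<lambda>y. ?F (x, y)) * sqnorm m2 \<eta> \<partial>m1)"
    unfolding sqnorm_def[of m1]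
  proof (rule nn_integral_mono)
    fix x
    have "ennreal (norm (\<integral>y. ?F (x, y) * \<eta> y \<partial>m2)) \<le> (\<integral>\<^sup>+y. ennreal (norm (?F (x, y) * \<eta> y)) \<partial>m2)"
      by (cases "integrable m2 (\<lambda>y. ?F (x, y) * \<eta> y)")
         (auto simp: not_integrable_integral_eq intro: integral_norm_bound_ennreal)
    then have "ennreal ((norm (\<integral>y. ?F (x, y) * \<eta> y \<partial>m2))\<^sup>2) \<le> (\<integral>\<^sup>+y. ennreal (norm (?F (x, y) * \<eta> y)) \<partial>m2)\<^sup>2"
      by (simp add: power_mono flip: ennreal_power)
    also have "\<dots> \<le> sqnorm m2 (\<lambda>y. ?F (x, y)) * sqnorm m2 \<eta>"
      by (rule nn_integral_norm_mult_square_le) measurable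
    finally show "ennreal ((norm (\<integral>y. ?F (x, y) * \<eta> y \<partial>m2))\<^sup>2) \<le> sqnorm m2 (\<lambda>y. ?F (x, y)) * sqnorm m2 \<eta>" .
  qed
  also have "\<dots> = (\<integral>\<^sup>+x. sqnorm m2 (\<lambda>y. ?F (x, y)) \<partial>m1) * sqnorm m2 \<eta>"
    unfolding sqnorm_def by (rule nn_integral_multc) measurable
  also have "(\<integral>\<^sup>+x. sqnorm m2 (\<lambda>y. ?F (x, y)) \<partial>m1) = sqnorm (m1 \<Otimes>\<^sub>M m2) ?F"
    unfolding sqnorm_def by (subst G2.nn_integral_fst[symmetric]) auto
  also have "sqnorm (m1 \<Otimes>\<^sub>M m2) ?F * sqnorm m2 \<eta> \<le> ennreal e * sqnorm (m1 \<Otimes>\<^sub>M m2) (tensor \<xi>1 \<xi>2) * sqnorm m2 \<eta>"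
    by (intro mult_right_mono op_boundD[OF e(1)] tensor_L2 \<xi>1 \<xi>2) auto
  also have "\<dots> = ennreal (e * ((L2_norm m2 \<xi>2)\<^sup>2 * (L2_norm m2 \<eta>)\<^sup>2)) * sqnorm m1 \<xi>1"
    using e(2) by (simp add: sqnorm_tensor sqnorm_eq_L2_norm[OF \<xi>2] sqnorm_eq_L2_norm[OF \<eta>] ennreal_mult mult_ac)
  finally show "sqnorm m1 (conv_op (slice (coefficient m2 \<xi>2 \<eta>) \<kappa>) \<xi>1)
      \<le> ennreal (e * ((L2_norm m2 \<xi>2)\<^sup>2 * (L2_norm m2 \<eta>)\<^sup>2)) * sqnorm m1 \<xi>1" .
qed

lemma slice_L1_measure:
  assumes f: "f \<in> L1 (m1 \<Otimes>\<^sub>M m2)" and u [measurable]: "u \<in> borel_measurable borel" and B: "\<And>t. norm (u t) \<le> B"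
  shows "(\<lambda>x. \<integral>y. u y * f (x, y) \<partial>m2) \<in> L1 m1"
    and "A \<in> sets borel \<Longrightarrow> slice u (L1_measure (m1 \<Otimes>\<^sub>M m2) f) A = L1_measure m1 (\<lambda>x. \<integral>y. u y * f (x, y) \<partial>m2) A"
proof -
  note r = represents_slice[OF P.represents_L1_measure[OF f] u B]
  have int: "integrable (m1 \<Otimes>\<^sub>M m2) (\<lambda>w. u (snd w) * f w)" by (rule representsD(3)[OF r])
  show "(\<lambda>x. \<integral>y. u y * f (x, y) \<partial>m2) \<in> L1 m1"
    unfolding L1_def using integrable_fst'[OF int] by simp
  assume A [measurable]: "A \<in> sets borel"
  have intA: "integrable (m1 \<Otimes>\<^sub>M m2) (\<lambda>w. indicator A (fst w) * (u (snd w) * f w))"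
    by (rule Bochner_Integration.integrable_bound[OF int])
       (use representsD(4)[OF r] in \<open>auto simp: indicator_def\<close>)
  have "slice u (L1_measure (m1 \<Otimes>\<^sub>M m2) f) A = (\<integral>x. (\<integral>y. indicator A x * (u y * f (x, y)) \<partial>m2) \<partial>m1)"
    unfolding representsD(5)[OF r A] using integral_fst'[OF intA] by simp
  also have "\<dots> = L1_measure m1 (\<lambda>x. \<integral>y. u y * f (x, y) \<partial>m2) A"
    unfolding L1_measure_def set_lebesgue_integral_def
    by (intro Bochner_Integration.integral_cong) (auto simp: indicator_def)
  finally show "slice u (L1_measure (m1 \<Otimes>\<^sub>M m2) f) A = L1_measure m1 (\<lambda>x. \<integral>y. u y * f (x, y) \<partial>m2) A" .
qed

lemma approximable_slice:
  assumes \<mu>: "complex_borel_measure \<mu>" and a: "approximable (m1 \<Otimes>\<^sub>M m2) \<mu>" and \<xi>2: "\<xi>2 \<in> L2 m2" and \<eta>: "\<eta> \<in> L2 m2"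
  shows "approximable m1 (slice (coefficient m2 \<xi>2 \<eta>) \<mu>)"
  unfolding approximable_def
proof (intro allI impI)
  fix \<epsilon> :: real assume \<epsilon>: "0 < \<epsilon>"
  let ?u = "coefficient m2 \<xi>2 \<eta>" and ?P = "m1 \<Otimes>\<^sub>M m2"
  note u = coefficient_bound(3)[OF \<xi>2 \<eta>] coefficient_bound(2)[OF \<xi>2 \<eta>]
  \<comment> \<open>q is the factor lost in \<open>op_bound_slice\<close>. It may be 0, so the
    approximation is made within \<open>\<epsilon> / (q + 1)\<close>.\<close>
  define q where "q = (L2_norm m2 \<xi>2)\<^sup>2 * (L2_norm m2 \<eta>)\<^sup>2"
  have q: "0 \<le> q" by (simp add: q_def)
  obtain f where f: "f \<in> L1 ?P" "op_bound ?P (conv_op (\<lambda>A. \<mu> A - L1_measure ?P f A)) (\<epsilon> / (q + 1))"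
    using a q \<epsilon> unfolding approximable_def by (meson add_nonneg_pos divide_pos_pos zero_less_one)
  let ?f = "\<lambda>x. \<integral>y. ?u y * f (x, y) \<partial>m2"
  note L = slice_L1_measure[OF f(1) u]
  note \<nu> = P.complex_borel_measure_L1_measure[OF f(1)]
  note \<kappa> = complex_borel_measure_diff[OF \<mu> \<nu>]
  have "op_bound m1 (conv_op (slice ?u (\<lambda>A. \<mu> A - L1_measure ?P f A))) (\<epsilon> / (q + 1) * q)"
    using op_bound_slice[OF \<kappa> \<xi>2 \<eta> f(2)] \<epsilon> q by (simp add: q_def)
  then have b: "op_bound m1 (conv_op (slice ?u (\<lambda>A. \<mu> A - L1_measure ?P f A))) \<epsilon>"
    by (rule op_bound_mono) (use \<epsilon> q in \<open>simp add: field_simps\<close>)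
  have c: "complex_borel_measure (slice ?u (\<lambda>A. \<mu> A - L1_measure ?P f A))"
  proof -
    obtain M h where "finite_measure M" "sets M = sets borel" and r: "represents (\<lambda>A. \<mu> A - L1_measure ?P f A) M (\<lambda>x. x) h"
      by (rule represents_common[OF \<kappa> \<kappa>])
    show ?thesis by (rule represents_complex_borel_measure[OF represents_slice[OF r u]])
  qed
  have "sqnorm m1 (conv_op (\<lambda>A. slice ?u \<mu> A - L1_measure m1 ?f A) \<xi>) = sqnorm m1 (conv_op (slice ?u (\<lambda>A. \<mu> A - L1_measure ?P f A)) \<xi>)"
    if "\<xi> \<in> L2 m1" for \<xi>
    by (intro sqnorm_cong_AE G1.conv_op_cong[OF c _ that]) (simp add: slice_diff[OF \<mu> \<nu> u] L(2))
  then have "op_bound m1 (conv_op (\<lambda>A. slice ?u \<mu> A - L1_measure m1 ?f A)) \<epsilon>"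
    using b by (simp add: op_bound_def)
  then show "\<exists>f\<in>L1 m1. op_bound m1 (conv_op (\<lambda>A. slice ?u \<mu> A - L1_measure m1 f A)) \<epsilon>"
    using L(1) by blast
qed

end

section \<open>Vanishing of a convolution operator detected on rectangles\<close>

lemma complex_borel_measure_Diff:
  assumes \<mu>: "complex_borel_measure \<mu>" and "A \<in> sets borel" "B \<in> sets borel" "B \<subseteq> A"
  shows "\<mu> (A - B) = \<mu> A - \<mu> B"
  using signed_borel_measure_Diff[OF complex_borel_measure_Re[OF \<mu>] assms(2-4)]
    signed_borel_measure_Diff[OF complex_borel_measure_Im[OF \<mu>] assms(2-4)]
  by (simp add: complex_eq_iff)

lemma (in left_invariant) indicator_L2:
  assumes "A \<in> sets borel" "emeasure m A \<noteq> \<infinity>"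
  shows "indicator A \<in> L2 m"
proof -
  have "(norm (indicator A x :: complex))\<^sup>2 = indicator A x" for x by (simp add: indicator_def)
  then show ?thesis using assms by (simp add: L2_def less_top[symmetric])
qed

context left_invariant_pair
begin

text \<open>Dynkin's argument for a family of complex measures indexed by z. The null set of indices
  depends on the Borel set C, which is compatible with the induction because complements and
  disjoint unions involve only countably many sets at a time.\<close>

lemma AE_zero_of_rectangles:
  fixes \<kappa> :: "'z \<Rightarrow> ('a \<times> 'b) set \<Rightarrow> complex"
  assumes \<kappa>: "\<And>z. complex_borel_measure (\<kappa> z)" and C: "C \<in> sets borel"
    and rectangle: "\<And>A B. A \<in> sets borel \<Longrightarrow> B \<in> sets borel \<Longrightarrow> emeasure m1 A \<noteq> \<infinity> \<Longrightarrow> emeasure m2 B \<noteq> \<infinity> \<Longrightarrow>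
      AE z in N. \<kappa> z (A \<times> B) = 0"
  shows "AE z in N. \<kappa> z C = 0"
proof -
  let ?G = "{A \<times> B |A B. A \<in> sets m1 \<and> B \<in> sets m2}"
  have sets: "sigma_sets (space m1 \<times> space m2) ?G = sets borel"
    using P.sets_eq_borel by (simp only: sets_pair_measure)
  have union: "AE z in N. \<kappa> z (\<Union>n. A n) = 0"
    if A: "range A \<subseteq> sets borel" "disjoint_family A" and zero: "\<And>n. AE z in N. \<kappa> z (A n) = 0" for A :: "nat \<Rightarrow> _"
  proof -
    have "AE z in N. \<forall>n. \<kappa> z (A n) = 0" using zero by (simp add: AE_all_countable)
    then show ?thesis
    proof eventually_elim
      case (elim z)
      have "(\<lambda>n. \<kappa> z (A n)) sums \<kappa> z (\<Union>n. A n)" using \<kappa>[of z] A by (simp add: complex_borel_measure_def)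
      then show ?case using elim by (simp add: sums_iff)
    qed
  qed
  have basic: "AE z in N. \<kappa> z (A \<times> B) = 0" if A: "A \<in> sets borel" and B: "B \<in> sets borel" for A B
  proof -
    obtain A0 :: "nat \<Rightarrow> 'a set" where A0: "range A0 \<subseteq> sets m1" "(\<Union>i. A0 i) = space m1" "\<And>i. emeasure m1 (A0 i) \<noteq> \<infinity>" "disjoint_family A0"
      using G1.sigma_finite_disjoint by blast
    obtain B0 :: "nat \<Rightarrow> 'b set" where B0: "range B0 \<subseteq> sets m2" "(\<Union>i. B0 i) = space m2" "\<And>i. emeasure m2 (B0 i) \<noteq> \<infinity>" "disjoint_family B0"
      using G2.sigma_finite_disjoint by blast
    \<comment> \<open>Sigma-finiteness cuts the rectangle into countably many disjoint rectangles of
      finite sides, enumerated by a pairing function.\<close>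
    define R where "R n = (A \<inter> A0 (fst (prod_decode n))) \<times> (B \<inter> B0 (snd (prod_decode n)))" for n
    have Ab: "A \<inter> A0 i \<in> sets borel" and Bb: "B \<inter> B0 i \<in> sets borel" for i using A B A0(1) B0(1) by auto
    have fin: "emeasure m1 (A \<inter> A0 i) \<noteq> \<infinity>" "emeasure m2 (B \<inter> B0 i) \<noteq> \<infinity>" for i
    proof -
      have "emeasure m1 (A \<inter> A0 i) \<le> emeasure m1 (A0 i)" "emeasure m2 (B \<inter> B0 i) \<le> emeasure m2 (B0 i)"
        using A0(1) B0(1) by (auto intro!: emeasure_mono)
      then show "emeasure m1 (A \<inter> A0 i) \<noteq> \<infinity>" "emeasure m2 (B \<inter> B0 i) \<noteq> \<infinity>"
        using A0(3)[of i] B0(3)[of i] by (auto simp: top_unique)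
    qed
    have "AE z in N. \<kappa> z (\<Union>n. R n) = 0"
    proof (rule union)
      show "range R \<subseteq> sets borel"
        using Ab Bb unfolding R_def by (auto simp: borel_prod[symmetric] intro!: pair_measureI)
      show "disjoint_family R"
        unfolding disjoint_family_on_def
      proof safe
        fix i j x y assume "i \<noteq> j" and *: "(x, y) \<in> R i" "(x, y) \<in> R j"
        then have "fst (prod_decode i) \<noteq> fst (prod_decode j) \<or> snd (prod_decode i) \<noteq> snd (prod_decode j)"
          by (metis prod_decode_inverse prod_eqI)
        then show "(x, y) \<in> {}"
          using * disjoint_family_onD[OF A0(4)] disjoint_family_onD[OF B0(4)] unfolding R_def by fastforce
      qed
      show "AE z in N. \<kappa> z (R n) = 0" for n unfolding R_def by (intro rectangle Ab Bb fin)
    qed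
    also have "(\<Union>n. R n) = A \<times> B"
    proof (intro set_eqI iffI)
      fix z assume z: "z \<in> A \<times> B"
      obtain i where "fst z \<in> A0 i" using A0(2) by auto
      moreover obtain j where "snd z \<in> B0 j" using B0(2) by auto
      ultimately show "z \<in> (\<Union>n. R n)" using z by (intro UN_I[of "prod_encode (i, j)"]) (auto simp: R_def)
    qed (auto simp: R_def)
    finally show ?thesis .
  qed
  have "C \<in> sigma_sets (space m1 \<times> space m2) ?G" using C by (simp only: sets)
  with Int_stable_pair_measure_generator pair_measure_closed show ?thesis
  proof (induction rule: sigma_sets_induct_disjoint)
    case (basic A) then show ?case using \<open>\<And>B A. A \<in> sets borel \<Longrightarrow> B \<in> sets borel \<Longrightarrow> AE z in N. \<kappa> z (A \<times> B) = 0\<close> by auto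
  next
    case empty then show ?case using basic[of "{}" "{}"] by simp
  next
    \<comment> \<open>The whole space is a rectangle, possibly of infinite measure, so the value on
      the complement reduces to that on A.\<close>
    case (compl A)
    then have "A \<in> sets borel" by (simp only: sets)
    then have "\<kappa> z (UNIV - A) = \<kappa> z UNIV - \<kappa> z A" for z using complex_borel_measure_Diff[OF \<kappa>, of UNIV A] by simp
    moreover have "AE z in N. \<kappa> z (UNIV \<times> UNIV) = 0" using basic[of UNIV UNIV] by simp
    ultimately show ?case using compl(2) by (auto simp: UNIV_Times_UNIV)
  next
    case (union A) then show ?case using \<open>\<And>A. range A \<subseteq> sets borel \<Longrightarrow> disjoint_family A \<Longrightarrow> (\<And>n. AE z in N. \<kappa> z (A n) = 0) \<Longrightarrow> AE z in N. \<kappa> z (\<Union>n. A n) = 0\<close> by (simp only: sets)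
  qed
qed

text \<open>A function in L2 need not be integrable, so it is first restricted to a box of finite
  measure, where it is the density of a complex measure vanishing on rectangles. The integrability
  premise in \<open>zero\<close> is there for the caller, who evaluates the integral by
  Fubini.\<close>

lemma AE_zero_of_rectangle_integrals:
  assumes F: "F \<in> L2 (m1 \<Otimes>\<^sub>M m2)"
    and zero: "\<And>A B. A \<in> sets borel \<Longrightarrow> B \<in> sets borel \<Longrightarrow> emeasure m1 A \<noteq> \<infinity> \<Longrightarrow> emeasure m2 B \<noteq> \<infinity> \<Longrightarrow>
      integrable (m1 \<Otimes>\<^sub>M m2) (\<lambda>z. indicator (A \<times> B) z * F z) \<Longrightarrow> (\<integral>z. indicator (A \<times> B) z * F z \<partial>(m1 \<Otimes>\<^sub>M m2)) = 0"
  shows "AE z in m1 \<Otimes>\<^sub>M m2. F z = 0"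
proof -
  let ?P = "m1 \<Otimes>\<^sub>M m2"
  note [measurable] = P.L2_borel[OF F]
  have Times [measurable]: "A \<times> B \<in> sets borel" if "A \<in> sets borel" "B \<in> sets borel" for A :: "'a set" and B :: "'b set"
    using that by (auto simp: borel_prod[symmetric] intro!: pair_measureI)
  have box: "AE z in ?P. z \<in> K \<times> L \<longrightarrow> F z = 0"
    if KL [measurable]: "K \<in> sets borel" "L \<in> sets borel" and fin: "emeasure m1 K \<noteq> \<infinity>" "emeasure m2 L \<noteq> \<infinity>" for K L
  proof -
    have int: "integrable ?P (\<lambda>z. indicator (K \<times> L) z * F z)"
    proof (rule Bochner_Integration.integrable_bound)
      have "emeasure ?P (K \<times> L) < \<infinity>"
        using fin KL by (subst G2.emeasure_pair_measure_Times) (auto simp: ennreal_mult_eq_top_iff less_top[symmetric])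
      then show "integrable ?P (\<lambda>z. indicator (K \<times> L) z + (norm (F z))\<^sup>2 :: real)"
        using F by (auto simp: L2_def)
      \<comment> \<open>On a set of finite measure square integrability gives integrability.\<close>
      have "r \<le> 1 + r\<^sup>2" for r :: real
        using zero_le_power2[of "r - 1 / 2"] by (simp add: power2_eq_square algebra_simps)
      then show "AE z in ?P. norm (indicator (K \<times> L) z * F z) \<le> norm (indicator (K \<times> L) z + (norm (F z))\<^sup>2 :: real)"
        by (auto simp: indicator_def)
    qed measurable
    let ?k = "\<lambda>C. \<integral>z. indicator C z * (indicator (K \<times> L) z * F z) \<partial>?P"
    have rep: "represents ?k ?P (\<lambda>z. z) (\<lambda>z. indicator (K \<times> L) z * F z)"
      using int P.sigma_finite_measure_axioms by (simp add: represents_def measurable_ident_sets)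
    have k0: "?k C = 0" if "C \<in> sets borel" for C
    proof -
      \<comment> \<open>A single measure is treated as a family over a one-point space, where almost
        everywhere means at that point.\<close>
      have "AE u in count_space (UNIV :: unit set). ?k C = 0"
      proof (rule AE_zero_of_rectangles[OF represents_complex_borel_measure[OF rep] that])
        fix A :: "'a set" and B :: "'b set" assume AB [measurable]: "A \<in> sets borel" "B \<in> sets borel"
        have eq: "indicator (A \<times> B) z * (indicator (K \<times> L) z * F z) = indicator ((A \<inter> K) \<times> (B \<inter> L)) z * F z" for z
          by (auto simp: indicator_def)
        have "emeasure m1 (A \<inter> K) \<noteq> \<infinity>" "emeasure m2 (B \<inter> L) \<noteq> \<infinity>"
          using emeasure_mono[of "A \<inter> K" K m1] emeasure_mono[of "B \<inter> L" L m2] fin by (auto simp: top_unique)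
        moreover have "integrable ?P (\<lambda>z. indicator ((A \<inter> K) \<times> (B \<inter> L)) z * F z)"
          unfolding eq[symmetric] by (rule Bochner_Integration.integrable_bound[OF int]) (auto simp: indicator_def)
        ultimately have "?k (A \<times> B) = 0" unfolding eq by (intro zero) auto
        then show "AE u in count_space (UNIV :: unit set). ?k (A \<times> B) = 0" by simp
      qed
      then show ?thesis by (simp add: AE_count_space)
    qed
    have "AE z in ?P. indicator (K \<times> L) z * F z = 0"
    proof (rule P.density_zero[OF int])
      fix A assume "A \<in> sets ?P"
      then have "A \<in> sets borel" by (rule equalityD1[OF P.sets_eq_borel, THEN subsetD])
      from k0[OF this] show "(\<integral>z\<in>A. indicator (K \<times> L) z * F z \<partial>?P) = 0"
        by (simp add: set_lebesgue_integral_def indicator_def scaleR_conv_of_real of_bool_def if_distrib[of complex_of_real] cong: if_cong)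
    qed
    then show ?thesis by eventually_elim (auto simp: indicator_def)
  qed
  obtain A0 :: "nat \<Rightarrow> 'a set" where A0: "range A0 \<subseteq> sets m1" "(\<Union>i. A0 i) = space m1" "\<And>i. emeasure m1 (A0 i) \<noteq> \<infinity>"
    using G1.sigma_finite by blast
  obtain B0 :: "nat \<Rightarrow> 'b set" where B0: "range B0 \<subseteq> sets m2" "(\<Union>i. B0 i) = space m2" "\<And>i. emeasure m2 (B0 i) \<noteq> \<infinity>"
    using G2.sigma_finite by blast
  have "AE z in ?P. z \<in> A0 i \<times> B0 j \<longrightarrow> F z = 0" for i j
    by (rule box) (use A0(1,3) B0(1,3) in auto)
  then have "AE z in ?P. \<forall>i j. z \<in> A0 i \<times> B0 j \<longrightarrow> F z = 0"
    unfolding AE_all_countable by blast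
  then show ?thesis
  proof eventually_elim
    case (elim z)
    obtain i where "fst z \<in> A0 i" using A0(2) by auto
    moreover obtain j where "snd z \<in> B0 j" using B0(2) by auto
    ultimately show ?case using elim by (metis mem_Times_iff)
  qed
qed

text \<open>For fixed z, the value at z of the convolution of \<open>\<mu>\<close> with the
  indicator of C is a complex measure in C, the image of h dM under w to -w + z. So vanishing for
  almost every z passes from rectangles to each Borel set, then to simple functions and, by
  dominated convergence, to L2.\<close>

lemma conv_op_zero_of_rectangles:
  fixes \<mu> :: "('a \<times> 'b) set \<Rightarrow> complex"
  assumes \<mu>: "complex_borel_measure \<mu>"
    and zero: "\<And>A B. A \<in> sets borel \<Longrightarrow> B \<in> sets borel \<Longrightarrow> emeasure m1 A \<noteq> \<infinity> \<Longrightarrow> emeasure m2 B \<noteq> \<infinity> \<Longrightarrow>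
      AE z in m1 \<Otimes>\<^sub>M m2. conv_op \<mu> (indicator (A \<times> B)) z = 0"
  shows "conv_op \<mu> \<in> L2_zero_ops (m1 \<Otimes>\<^sub>M m2)"
  unfolding L2_zero_ops_def
proof (intro CollectI ballI)
  let ?P = "m1 \<Otimes>\<^sub>M m2"
  fix \<xi> assume \<xi>: "\<xi> \<in> L2 ?P"
  obtain M h where M: "finite_measure M" "sets M = sets borel" and r: "represents \<mu> M (\<lambda>x. x) h"
    by (rule represents_common[OF \<mu> \<mu>])
  interpret M: finite_measure M by fact
  note [measurable] = P.L2_borel[OF \<xi>] representsD(4)[OF r]
  note [measurable_cong] = M(2)
  have Times [measurable]: "A \<times> B \<in> sets borel" if "A \<in> sets borel" "B \<in> sets borel" for A :: "'a set" and B :: "'b set"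
    using that by (auto simp: borel_prod[symmetric] intro!: pair_measureI)
  define \<kappa> where "\<kappa> z C = (\<integral>w. indicator C (- w + z) * h w \<partial>M)" for z :: "'a \<times> 'b" and C
  have rep: "represents (\<kappa> z) M (\<lambda>w. - w + z) h" for z
    using representsD(1,3)[OF r] unfolding represents_def \<kappa>_def by auto
  have int: "integrable M (\<lambda>w. indicator C (- w + z) * h w)" if [measurable]: "C \<in> sets borel" for C z
    by (rule Bochner_Integration.integrable_bound[OF representsD(3)[OF r]]) (auto simp: indicator_def)
  have conv: "conv_op \<mu> (indicator C) z = \<kappa> z C" if [measurable]: "C \<in> sets borel" for C z
    unfolding conv_op_def \<kappa>_def by (rule represents_integral[OF r _ int[OF that]]) measurable
  have \<kappa>0: "AE z in ?P. \<kappa> z C = 0" if "C \<in> sets borel" for C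
    by (rule AE_zero_of_rectangles[OF represents_complex_borel_measure[OF rep] that])
       (use zero in \<open>simp add: conv Times\<close>)
  \<comment> \<open>The pointwise bound by twice the modulus of \<open>\<xi>\<close> provides the
    dominating function, integrable for almost every z. Using one sequence for all z keeps the
    exceptional sets countable in number.\<close>
  obtain s where s: "\<And>i. simple_function borel (s i)" "\<And>z. (\<lambda>i. s i z) \<longlonglongrightarrow> \<xi> z" "\<And>i z. dist (s i z) 0 \<le> 2 * dist (\<xi> z) 0"
    using borel_measurable_implies_sequence_metric[of \<xi> borel 0] by auto
  have sm [measurable]: "s i \<in> borel_measurable borel" for i by (rule borel_measurable_simple_function[OF s(1)])
  have "AE z in ?P. \<forall>i. (\<integral>w. s i (- w + z) * h w \<partial>M) = 0"
    unfolding AE_all_countable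
  proof
    fix i
    have fin: "finite (range (s i))" using s(1)[of i] by (simp add: simple_function_def)
    have C: "s i -` {c} \<in> sets borel" for c using measurable_sets[OF sm[of i], of "{c}"] by simp
    have "AE z in ?P. \<forall>c\<in>range (s i). \<kappa> z (s i -` {c}) = 0"
      by (rule AE_finite_allI[OF fin \<kappa>0[OF C]])
    then show "AE z in ?P. (\<integral>w. s i (- w + z) * h w \<partial>M) = 0"
    proof eventually_elim
      case (elim z)
      have "s i (- w + z) * h w = (\<Sum>c\<in>range (s i). c * (indicator (s i -` {c}) (- w + z) * h w))" for w
      proof -
        have "(\<Sum>c\<in>range (s i). c * (indicator (s i -` {c}) (- w + z) * h w)) = (\<Sum>c\<in>range (s i). if c = s i (- w + z) then c * h w else 0)"
          by (intro sum.cong) (auto simp: indicator_def)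
        then show ?thesis using fin by (simp add: sum.delta')
      qed
      then have "(\<integral>w. s i (- w + z) * h w \<partial>M) = (\<integral>w. (\<Sum>c\<in>range (s i). c * (indicator (s i -` {c}) (- w + z) * h w)) \<partial>M)"
        by presburger
      also have "\<dots> = (\<Sum>c\<in>range (s i). \<integral>w. c * (indicator (s i -` {c}) (- w + z) * h w) \<partial>M)"
        by (intro Bochner_Integration.integral_sum integrable_mult_right int C)
      also have "\<dots> = (\<Sum>c\<in>range (s i). c * \<kappa> z (s i -` {c}))"
        unfolding \<kappa>_def by (simp only: integral_mult_right_zero)
      finally show ?case using elim by simp
    qed
  qed
  then show "AE z in ?P. conv_op \<mu> \<xi> z = 0"
    using P.conv_op_eq_integral[OF r \<xi>]
  proof eventually_elim
    case (elim z)
    have "(\<lambda>i. \<integral>w. s i (- w + z) * h w \<partial>M) \<longlonglongrightarrow> (\<integral>w. \<xi> (- w + z) * h w \<partial>M)"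
    proof (rule integral_dominated_convergence[where w = "\<lambda>w. 2 * norm (\<xi> (- w + z) * h w)"])
      show "integrable M (\<lambda>w. 2 * norm (\<xi> (- w + z) * h w))" using elim(2) by auto
      show "AE w in M. (\<lambda>i. s i (- w + z) * h w) \<longlonglongrightarrow> \<xi> (- w + z) * h w"
        by (intro AE_I2 tendsto_mult s(2) tendsto_const)
      show "AE w in M. norm (s i (- w + z) * h w) \<le> 2 * norm (\<xi> (- w + z) * h w)" for i
      proof (rule AE_I2)
        fix w show "norm (s i (- w + z) * h w) \<le> 2 * norm (\<xi> (- w + z) * h w)"
          using mult_right_mono[OF s(3)[of i "- w + z"], of "norm (h w)"] by (simp add: norm_mult mult.assoc)
      qed
    qed measurable
    then have "(\<integral>w. \<xi> (- w + z) * h w \<partial>M) = 0" using elim(1) by (simp add: LIMSEQ_const_iff)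
    then show ?case using elim(2) by simp
  qed
qed

text \<open>For \<open>\<xi>\<close> and \<open>\<eta>\<close> the indicators of B1 and B, the slice
  hypothesis says that the image of the indicator of A1 x B1 has, for almost every x, integral zero
  over B in the second variable. Integrating over x in A gives zero integrals over all finite
  rectangles.\<close>

lemma conv_op_zero_of_slices:
  fixes \<mu> :: "('a \<times> 'b) set \<Rightarrow> complex"
  assumes \<mu>: "complex_borel_measure \<mu>"
    and zero: "\<And>\<xi> \<eta>. \<xi> \<in> L2 m2 \<Longrightarrow> \<eta> \<in> L2 m2 \<Longrightarrow> conv_op (slice (coefficient m2 \<xi> \<eta>) \<mu>) \<in> L2_zero_ops m1"
  shows "conv_op \<mu> \<in> L2_zero_ops (m1 \<Otimes>\<^sub>M m2)"
proof (rule conv_op_zero_of_rectangles[OF \<mu>])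
  fix A1 B1 assume A1: "A1 \<in> sets borel" "emeasure m1 A1 \<noteq> \<infinity>" and B1: "B1 \<in> sets borel" "emeasure m2 B1 \<noteq> \<infinity>"
  have L1: "indicator A1 \<in> L2 m1" by (rule G1.indicator_L2[OF A1])
  have L2: "indicator B1 \<in> L2 m2" by (rule G2.indicator_L2[OF B1])
  have t: "tensor (indicator A1) (indicator B1) = indicator (A1 \<times> B1)"
    by (auto simp: tensor_def indicator_def)
  let ?F = "conv_op \<mu> (tensor (indicator A1) (indicator B1))"
  have F: "?F \<in> L2 (m1 \<Otimes>\<^sub>M m2)" by (rule P.conv_op_L2[OF \<mu> tensor_L2[OF L1 L2]])
  have "AE z in m1 \<Otimes>\<^sub>M m2. ?F z = 0"
  proof (rule AE_zero_of_rectangle_integrals[OF F])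
    fix A B assume A [measurable]: "A \<in> sets borel" "emeasure m1 A \<noteq> \<infinity>" and B [measurable]: "B \<in> sets borel" "emeasure m2 B \<noteq> \<infinity>"
      and int: "integrable (m1 \<Otimes>\<^sub>M m2) (\<lambda>z. indicator (A \<times> B) z * ?F z)"
    have "AE x in m1. conv_op (slice (coefficient m2 (indicator B1) (indicator B)) \<mu>) (indicator A1) x = 0"
      using zero[OF L2 G2.indicator_L2[OF B]] L1 by (simp add: L2_zero_ops_def)
    then have "AE x in m1. (\<integral>y. indicator (A \<times> B) (x, y) * ?F (x, y) \<partial>m2) = 0"
      using conv_op_slice[OF \<mu> L1 L2 G2.indicator_L2[OF B]]
    proof eventually_elim
      case (elim x)
      have eq: "indicator (A \<times> B) (x, y) * ?F (x, y) = indicator A x * (?F (x, y) * indicator B y)" for y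
        by (auto simp: indicator_def)
      show ?case unfolding eq integral_mult_right_zero using elim by simp
    qed
    then show "(\<integral>z. indicator (A \<times> B) z * ?F z \<partial>(m1 \<Otimes>\<^sub>M m2)) = 0"
      unfolding integral_fst'[OF int, symmetric] by (rule integral_eq_zero_AE)
  qed
  then show "AE z in m1 \<Otimes>\<^sub>M m2. conv_op \<mu> (indicator (A1 \<times> B1)) z = 0" by (simp only: t)
qed

theorem extended_uniqueness_Times:
  assumes "closed E1" and E1: "extended_uniqueness m1 E1"
  shows "extended_uniqueness (m1 \<Otimes>\<^sub>M m2) (E1 \<times> E2)"
  unfolding P.extended_uniqueness_iff
proof (intro ballI impI)
  fix \<mu> :: "('a \<times> 'b) set \<Rightarrow> complex"
  assume \<mu>: "\<mu> \<in> measures_on (E1 \<times> E2)" and a: "approximable (m1 \<Otimes>\<^sub>M m2) \<mu>"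
  then have c: "complex_borel_measure \<mu>" by (simp add: measures_on_def)
  show "conv_op \<mu> \<in> L2_zero_ops (m1 \<Otimes>\<^sub>M m2)"
  proof (rule conv_op_zero_of_slices[OF c])
    fix \<xi> \<eta> assume *: "\<xi> \<in> L2 m2" "\<eta> \<in> L2 m2"
    show "conv_op (slice (coefficient m2 \<xi> \<eta>) \<mu>) \<in> L2_zero_ops m1"
      by (rule E1[unfolded G1.extended_uniqueness_iff, rule_format, OF
            slice_measures_on[OF \<mu> assms(1) coefficient_bound(3)[OF *] coefficient_bound(2)[OF *]] approximable_slice[OF c a *]])
  qed
qed

end

subsection \<open>Products of measures\<close>

text \<open>The product of complex measures through the measures of vertical sections, which makes
  sense for complex values.\<close>

definition tensor_measure ::
    "('a::topological_space set \<Rightarrow> complex) \<Rightarrow> ('b::topological_space set \<Rightarrow> complex) \<Rightarrow> ('a \<times> 'b) set \<Rightarrow> complex" where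
  "tensor_measure \<mu> \<nu> A = complex_measure_integral \<mu> (\<lambda>s. \<nu> (Pair s -` A))"

lemma integrable_tensor:
  assumes M: "sigma_finite_measure M" and N: "sigma_finite_measure N" and h: "integrable M h" and k: "integrable N k"
  shows "integrable (M \<Otimes>\<^sub>M N) (\<lambda>w. h (fst w) * k (snd w) :: complex)"
    and "(\<integral>w. h (fst w) * k (snd w) \<partial>(M \<Otimes>\<^sub>M N)) = (\<integral>w. h w \<partial>M) * (\<integral>w. k w \<partial>N)"
proof -
  interpret M: sigma_finite_measure M by fact
  interpret N: sigma_finite_measure N by fact
  interpret pair_sigma_finite M N ..
  note [measurable] = borel_measurable_integrable[OF h] borel_measurable_integrable[OF k]
  show int: "integrable (M \<Otimes>\<^sub>M N) (\<lambda>w. h (fst w) * k (snd w))"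
  proof (rule integrableI_bounded)
    have "(\<integral>\<^sup>+w. norm (h (fst w) * k (snd w)) \<partial>(M \<Otimes>\<^sub>M N)) = (\<integral>\<^sup>+x. (\<integral>\<^sup>+y. ennreal (norm (h x)) * ennreal (norm (k y)) \<partial>N) \<partial>M)"
      by (subst N.nn_integral_fst[symmetric]) (auto simp: norm_mult ennreal_mult)
    also have "\<dots> = (\<integral>\<^sup>+x. ennreal (norm (h x)) \<partial>M) * (\<integral>\<^sup>+y. ennreal (norm (k y)) \<partial>N)"
      by (simp add: nn_integral_cmult nn_integral_multc)
    also have "\<dots> < \<infinity>" using h k by (simp add: integrable_iff_bounded ennreal_mult_less_top)
    finally show "(\<integral>\<^sup>+w. norm (h (fst w) * k (snd w)) \<partial>(M \<Otimes>\<^sub>M N)) < \<infinity>" .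
  qed measurable
  show "(\<integral>w. h (fst w) * k (snd w) \<partial>(M \<Otimes>\<^sub>M N)) = (\<integral>w. h w \<partial>M) * (\<integral>w. k w \<partial>N)"
    using integral_fst'[OF int] by simp
qed

text \<open>The product of the densities is a density of the product: the sections are integrals
  over N, so Fubini turns the iterated integral into one over the product space, for every Borel set
  directly.\<close>

lemma represents_tensor_measure:
  fixes \<mu> :: "'a::second_countable_topology set \<Rightarrow> complex" and \<nu> :: "'b::second_countable_topology set \<Rightarrow> complex"
  assumes r: "represents \<mu> M \<pi> h" and s: "represents \<nu> N \<rho> k"
  shows "represents (tensor_measure \<mu> \<nu>) (M \<Otimes>\<^sub>M N) (\<lambda>w. (\<pi> (fst w), \<rho> (snd w))) (\<lambda>w. h (fst w) * k (snd w))"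
  unfolding represents_def
proof (intro conjI ballI)
  note [measurable] = representsD(2,4)[OF r] representsD(2,4)[OF s]
  interpret M: sigma_finite_measure M by (rule representsD(1)[OF r])
  interpret N: sigma_finite_measure N by (rule representsD(1)[OF s])
  interpret pair_sigma_finite M N ..
  show "sigma_finite_measure (M \<Otimes>\<^sub>M N)" by (rule sigma_finite_measure_axioms)
  show "(\<lambda>w. (\<pi> (fst w), \<rho> (snd w))) \<in> borel_measurable (M \<Otimes>\<^sub>M N)" by measurable
  show int: "integrable (M \<Otimes>\<^sub>M N) (\<lambda>w. h (fst w) * k (snd w))"
    by (rule integrable_tensor representsD(1,3)[OF r] representsD(1,3)[OF s])+
  fix A :: "('a \<times> 'b) set" assume A [measurable]: "A \<in> sets borel"
  have sec: "Pair x -` A \<in> sets borel" for x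
  proof -
    have "(\<lambda>y :: 'b. (x, y)) \<in> borel_measurable borel" by measurable
    from measurable_sets[OF this A] show ?thesis by simp
  qed
  have eq: "\<nu> (Pair x -` A) = (\<integral>w. indicator A (x, \<rho> w) * k w \<partial>N)" for x
    using representsD(5)[OF s sec] by (simp add: indicator_vimage[symmetric] indicator_def)
  have meas [measurable]: "(\<lambda>x. \<nu> (Pair x -` A)) \<in> borel_measurable borel"
    unfolding eq by measurable
  have intA: "integrable (M \<Otimes>\<^sub>M N) (\<lambda>w. indicator A (\<pi> (fst w), \<rho> (snd w)) * (h (fst w) * k (snd w)))"
    by (rule Bochner_Integration.integrable_bound[OF int]) (auto simp: indicator_def)
  have inner: "(\<integral>y. indicator A (\<pi> x, \<rho> y) * (h x * k y) \<partial>N) = \<nu> (Pair (\<pi> x) -` A) * h x" for x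
  proof -
    have e: "indicator A (\<pi> x, \<rho> y) * (h x * k y) = h x * (indicator A (\<pi> x, \<rho> y) * k y)" for y by (simp add: mult_ac)
    show ?thesis unfolding e eq integral_mult_right_zero by (simp add: mult.commute)
  qed
  have "integrable M (\<lambda>x. \<nu> (Pair (\<pi> x) -` A) * h x)"
    using integrable_fst'[OF intA] by (simp add: inner)
  then have "tensor_measure \<mu> \<nu> A = (\<integral>x. \<nu> (Pair (\<pi> x) -` A) * h x \<partial>M)"
    unfolding tensor_measure_def by (rule represents_integral[OF r meas])
  also have "\<dots> = (\<integral>w. indicator A (\<pi> (fst w), \<rho> (snd w)) * (h (fst w) * k (snd w)) \<partial>(M \<Otimes>\<^sub>M N))"
    using integral_fst'[OF intA] by (simp add: inner)
  finally show "tensor_measure \<mu> \<nu> A = (\<integral>w. indicator A (\<pi> (fst w), \<rho> (snd w)) * (h (fst w) * k (snd w)) \<partial>(M \<Otimes>\<^sub>M N))" .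
qed

lemma complex_borel_measure_tensor_measure:
  fixes \<mu> :: "'a::second_countable_topology set \<Rightarrow> complex" and \<nu> :: "'b::second_countable_topology set \<Rightarrow> complex"
  assumes "complex_borel_measure \<mu>" "complex_borel_measure \<nu>"
  shows "complex_borel_measure (tensor_measure \<mu> \<nu>)"
proof -
  obtain M h where "finite_measure M" "sets M = sets borel" and r: "represents \<mu> M (\<lambda>x. x) h"
    by (rule represents_common[OF assms(1) assms(1)])
  obtain N k where "finite_measure N" "sets N = sets borel" and s: "represents \<nu> N (\<lambda>x. x) k"
    by (rule represents_common[OF assms(2) assms(2)])
  show ?thesis by (rule represents_complex_borel_measure[OF represents_tensor_measure[OF r s]])
qed

lemma tensor_measure_measures_on:
  fixes \<mu> :: "'a::second_countable_topology set \<Rightarrow> complex" and \<nu> :: "'b::second_countable_topology set \<Rightarrow> complex"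
  assumes \<mu>: "\<mu> \<in> measures_on E" and \<nu>: "\<nu> \<in> measures_on F" and cl: "closed E" "closed F"
  shows "tensor_measure \<mu> \<nu> \<in> measures_on (E \<times> F)"
proof (rule measures_onI)
  have c: "complex_borel_measure \<mu>" "complex_borel_measure \<nu>" using \<mu> \<nu> by (auto simp: measures_on_def)
  then show "complex_borel_measure (tensor_measure \<mu> \<nu>)" by (rule complex_borel_measure_tensor_measure)
  show "closed (E \<times> F)" using cl by (rule closed_Times)
  obtain M h where M: "finite_measure M" "sets M = sets borel" and r: "represents \<mu> M (\<lambda>x. x) h"
    by (rule represents_common[OF c(1) c(1)])
  obtain N k where N: "finite_measure N" "sets N = sets borel" and s: "represents \<nu> N (\<lambda>x. x) k"
    by (rule represents_common[OF c(2) c(2)])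
  interpret M: finite_measure M by fact
  interpret N: finite_measure N by fact
  interpret pair_sigma_finite M N ..
  note [measurable] = representsD(4)[OF r] representsD(4)[OF s] borel_closed[OF cl(1)] borel_closed[OF cl(2)]
  note [measurable_cong] = M(2) N(2)
  have ae: "AE w in M \<Otimes>\<^sub>M N. (fst w \<notin> E \<longrightarrow> h (fst w) = 0) \<and> (snd w \<notin> F \<longrightarrow> k (snd w) = 0)"
  proof (rule AE_pair_measure)
    show "{w \<in> space (M \<Otimes>\<^sub>M N). (fst w \<notin> E \<longrightarrow> h (fst w) = 0) \<and> (snd w \<notin> F \<longrightarrow> k (snd w) = 0)} \<in> sets (M \<Otimes>\<^sub>M N)"
      by measurable
    show "AE x in M. AE y in N. (fst (x, y) \<notin> E \<longrightarrow> h (fst (x, y)) = 0) \<and> (snd (x, y) \<notin> F \<longrightarrow> k (snd (x, y)) = 0)"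
      using represents_AE_zero[OF \<mu> r M(2)]
    proof eventually_elim
      case (elim x)
      then show ?case using represents_AE_zero[OF \<nu> s N(2)] by auto
    qed
  qed
  fix A :: "('a \<times> 'b) set" assume A: "A \<in> sets borel" "A \<subseteq> - (E \<times> F)"
  show "tensor_measure \<mu> \<nu> A = 0"
    unfolding representsD(5)[OF represents_tensor_measure[OF r s] A(1)]
    by (rule integral_eq_zero_AE, use ae in eventually_elim) (use A(2) in \<open>auto simp: indicator_def\<close>)
qed

section \<open>Convolution operators of product measures\<close>

context left_invariant_pair
begin

text \<open>Convolving with the product means convolving with \<open>\<kappa>\<close> in the first
  variable and with \<open>\<nu>\<close> in the second. The first costs the operator bound e on
  almost every section of \<open>\<xi>\<close>, the second only the total mass of the density k, by
  Young's inequality. Keeping the operator bound for \<open>\<kappa>\<close> is essential, because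
  the error of an approximation is small only in that norm.\<close>

lemma op_bound_tensor_measure_left:
  assumes \<kappa>: "complex_borel_measure \<kappa>" and s: "represents \<nu> N \<rho> k" and e: "op_bound m1 (conv_op \<kappa>) e" "0 \<le> e"
  shows "op_bound (m1 \<Otimes>\<^sub>M m2) (conv_op (tensor_measure \<kappa> \<nu>)) ((\<integral>w. norm (k w) \<partial>N)\<^sup>2 * e)"
  unfolding op_bound_def
proof
  let ?P = "m1 \<Otimes>\<^sub>M m2"
  fix \<xi> assume \<xi>: "\<xi> \<in> L2 ?P"
  obtain M h where M: "finite_measure M" "sets M = sets borel" and r: "represents \<kappa> M (\<lambda>x. x) h"
    by (rule represents_common[OF \<kappa> \<kappa>])
  interpret M: finite_measure M by fact
  interpret N: sigma_finite_measure N by (rule representsD(1)[OF s])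
  interpret Q: pair_sigma_finite M N ..
  note [measurable] = P.L2_borel[OF \<xi>] representsD(4)[OF r] representsD(2,4)[OF s]
  note [measurable_cong] = M(2)
  define C where "C = (\<integral>w. norm (k w) \<partial>N)"
  have C: "0 \<le> C" "(\<integral>\<^sup>+w. ennreal (norm (k w)) \<partial>N) = ennreal C"
    using representsD(3)[OF s] by (simp_all add: C_def nn_integral_eq_integral)
  \<comment> \<open>The partial convolution in the first variable. It is written as an integral over
    M, and not as \<open>conv_op\<close> of a section, to be jointly measurable in x and t.\<close>
  define G where "G x t = (\<integral>w. \<xi> (- w + x, t) * h w \<partial>M)" for x t
  have [measurable (raw)]: "(\<lambda>z. G (f z) (g z)) \<in> borel_measurable Z"
    if [measurable]: "f \<in> borel_measurable Z" "g \<in> borel_measurable Z" for f g and Z :: "'z measure"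
    unfolding G_def by measurable
  have G: "AE t in m2. (\<integral>\<^sup>+x. ennreal ((norm (G x t))\<^sup>2) \<partial>m1) \<le> ennreal e * (\<integral>\<^sup>+x. ennreal ((norm (\<xi> (x, t)))\<^sup>2) \<partial>m1)"
  proof -
    have "(\<integral>\<^sup>+t. (\<integral>\<^sup>+x. ennreal ((norm (\<xi> (x, t)))\<^sup>2) \<partial>m1) \<partial>m2) = sqnorm ?P \<xi>"
      unfolding sqnorm_def by (rule nn_integral_snd) measurable
    then have "(\<integral>\<^sup>+t. (\<integral>\<^sup>+x. ennreal ((norm (\<xi> (x, t)))\<^sup>2) \<partial>m1) \<partial>m2) \<noteq> \<infinity>" using \<xi> by (auto simp: L2_iff_sqnorm)
    then have "AE t in m2. (\<integral>\<^sup>+x. ennreal ((norm (\<xi> (x, t)))\<^sup>2) \<partial>m1) \<noteq> \<infinity>"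
      by (intro nn_integral_PInf_AE) auto
    then show ?thesis
    proof eventually_elim
      case (elim t)
      have L: "(\<lambda>x. \<xi> (x, t)) \<in> L2 m1"
      proof -
        have "(\<lambda>x. \<xi> (x, t)) \<in> borel_measurable m1" by measurable
        then show ?thesis using elim by (simp add: L2_iff_sqnorm sqnorm_def less_top[symmetric])
      qed
      have "AE x in m1. G x t = conv_op \<kappa> (\<lambda>x. \<xi> (x, t)) x"
        using G1.conv_op_eq_integral[OF r L] by eventually_elim (simp add: G_def)
      then have "sqnorm m1 (\<lambda>x. G x t) = sqnorm m1 (conv_op \<kappa> (\<lambda>x. \<xi> (x, t)))" by (rule sqnorm_cong_AE)
      also have "\<dots> \<le> ennreal e * sqnorm m1 (\<lambda>x. \<xi> (x, t))" by (rule op_boundD[OF e(1) L])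
      finally show ?case by (simp add: sqnorm_def)
    qed
  qed
  have "sqnorm ?P (conv_op (tensor_measure \<kappa> \<nu>) \<xi>)
      \<le> (\<integral>\<^sup>+z. (\<integral>\<^sup>+w. ennreal (norm (G (fst z) (- \<rho> w + snd z) * k w)) \<partial>N)\<^sup>2 \<partial>?P)"
    unfolding sqnorm_def
  proof (rule nn_integral_mono_AE, use P.conv_op_eq_integral[OF represents_tensor_measure[OF r s] \<xi>] in eventually_elim)
    case (elim z)
    obtain x y where z: "z = (x, y)" by (cases z)
    have int: "integrable (M \<Otimes>\<^sub>M N) (case_prod (\<lambda>v w. \<xi> (- v + x, - \<rho> w + y) * (h v * k w)))"
      using elim by (simp add: z case_prod_unfold)
    \<comment> \<open>The inner integration is over the variable of \<open>\<kappa>\<close>, so that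
      G appears and the remaining integral is a convolution in the second variable alone.\<close>
    have "conv_op (tensor_measure \<kappa> \<nu>) \<xi> z = (\<integral>w. (\<integral>v. \<xi> (- v + x, - \<rho> w + y) * (h v * k w) \<partial>M) \<partial>N)"
      unfolding Q.integral_snd[OF int] using elim by (simp add: z case_prod_unfold)
    also have "\<dots> = (\<integral>w. G x (- \<rho> w + y) * k w \<partial>N)"
      unfolding G_def by (simp flip: integral_mult_left_zero add: mult.assoc)
    finally have "ennreal (norm (conv_op (tensor_measure \<kappa> \<nu>) \<xi> z)) \<le> (\<integral>\<^sup>+w. ennreal (norm (G x (- \<rho> w + y) * k w)) \<partial>N)"
      by (cases "integrable N (\<lambda>w. G x (- \<rho> w + y) * k w)")
         (auto simp: not_integrable_integral_eq intro: integral_norm_bound_ennreal)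
    then show ?case by (simp add: z power_mono flip: ennreal_power)
  qed
  also have "\<dots> = (\<integral>\<^sup>+x. (\<integral>\<^sup>+y. (\<integral>\<^sup>+w. ennreal (norm (G x (- \<rho> w + y) * k w)) \<partial>N)\<^sup>2 \<partial>m2) \<partial>m1)"
    by (subst G2.nn_integral_fst[symmetric]) auto
  also have "\<dots> \<le> (\<integral>\<^sup>+x. ennreal (C\<^sup>2) * (\<integral>\<^sup>+t. ennreal ((norm (G x t))\<^sup>2) \<partial>m2) \<partial>m1)"
  proof (rule nn_integral_mono)
    fix x
    show "(\<integral>\<^sup>+y. (\<integral>\<^sup>+w. ennreal (norm (G x (- \<rho> w + y) * k w)) \<partial>N)\<^sup>2 \<partial>m2) \<le> ennreal (C\<^sup>2) * (\<integral>\<^sup>+t. ennreal ((norm (G x t))\<^sup>2) \<partial>m2)"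
      using G2.nn_integral_convolution_square[OF representsD(1,2,4)[OF s], of "G x"] C
      by (simp add: sqnorm_def ennreal_power)
  qed
  also have "\<dots> = ennreal (C\<^sup>2) * (\<integral>\<^sup>+x. (\<integral>\<^sup>+t. ennreal ((norm (G x t))\<^sup>2) \<partial>m2) \<partial>m1)"
    by (rule nn_integral_cmult) measurable
  also have "(\<integral>\<^sup>+x. (\<integral>\<^sup>+t. ennreal ((norm (G x t))\<^sup>2) \<partial>m2) \<partial>m1) = (\<integral>\<^sup>+t. (\<integral>\<^sup>+x. ennreal ((norm (G x t))\<^sup>2) \<partial>m1) \<partial>m2)"
    by (rule Fubini'[symmetric]) measurable
  also have "ennreal (C\<^sup>2) * \<dots> \<le> ennreal (C\<^sup>2) * (\<integral>\<^sup>+t. ennreal e * (\<integral>\<^sup>+x. ennreal ((norm (\<xi> (x, t)))\<^sup>2) \<partial>m1) \<partial>m2)"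
    by (intro mult_left_mono nn_integral_mono_AE G) auto
  also have "(\<integral>\<^sup>+t. ennreal e * (\<integral>\<^sup>+x. ennreal ((norm (\<xi> (x, t)))\<^sup>2) \<partial>m1) \<partial>m2) = ennreal e * (\<integral>\<^sup>+t. (\<integral>\<^sup>+x. ennreal ((norm (\<xi> (x, t)))\<^sup>2) \<partial>m1) \<partial>m2)"
    by (rule nn_integral_cmult) measurable
  also have "(\<integral>\<^sup>+t. (\<integral>\<^sup>+x. ennreal ((norm (\<xi> (x, t)))\<^sup>2) \<partial>m1) \<partial>m2) = sqnorm ?P \<xi>"
    unfolding sqnorm_def by (rule nn_integral_snd) measurable
  also have "ennreal (C\<^sup>2) * (ennreal e * sqnorm ?P \<xi>) = ennreal (C\<^sup>2 * e) * sqnorm ?P \<xi>"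
    using e(2) by (simp add: ennreal_mult mult.assoc)
  finally show "sqnorm ?P (conv_op (tensor_measure \<kappa> \<nu>) \<xi>) \<le> ennreal ((\<integral>w. norm (k w) \<partial>N)\<^sup>2 * e) * sqnorm ?P \<xi>"
    by (simp add: C_def)
qed

lemma left_invariant_pair_swap: "left_invariant_pair m2 m1" ..

text \<open>Exchange of coordinates maps one L2 space isometrically onto the other and carries
  convolution with the product of \<open>\<mu>\<close> and \<open>\<kappa>\<close> to convolution
  with the product in the opposite order, where \<open>op_bound_tensor_measure_left\<close>
  applies.\<close>

lemma op_bound_tensor_measure_right:
  assumes \<kappa>: "complex_borel_measure \<kappa>" and r: "represents \<mu> M \<pi> h" and e: "op_bound m2 (conv_op \<kappa>) e" "0 \<le> e"
  shows "op_bound (m1 \<Otimes>\<^sub>M m2) (conv_op (tensor_measure \<mu> \<kappa>)) ((\<integral>w. norm (h w) \<partial>M)\<^sup>2 * e)"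
  unfolding op_bound_def
proof
  let ?P = "m1 \<Otimes>\<^sub>M m2" and ?Q = "m2 \<Otimes>\<^sub>M m1"
  interpret S: left_invariant_pair m2 m1 by (rule left_invariant_pair_swap)
  fix \<xi> assume \<xi>: "\<xi> \<in> L2 ?P"
  obtain N k where N: "finite_measure N" "sets N = sets borel" and s: "represents \<kappa> N (\<lambda>x. x) k"
    by (rule represents_common[OF \<kappa> \<kappa>])
  interpret M: sigma_finite_measure M by (rule representsD(1)[OF r])
  interpret N: finite_measure N by fact
  interpret Q: pair_sigma_finite N M ..
  note [measurable] = P.L2_borel[OF \<xi>] representsD(2,4)[OF r] representsD(4)[OF s]
  note [measurable_cong] = N(2)
  note c = complex_borel_measure_tensor_measure[OF \<kappa> represents_complex_borel_measure[OF r]]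
    complex_borel_measure_tensor_measure[OF represents_complex_borel_measure[OF r] \<kappa>]
  let ?s = "\<lambda>z. \<xi> (snd z, fst z)"
  have sq: "sqnorm ?Q (\<lambda>z. F (snd z, fst z)) = sqnorm ?P F" if [measurable]: "F \<in> borel_measurable borel" for F
  proof -
    have "sqnorm ?Q (\<lambda>z. F (snd z, fst z)) = (\<integral>\<^sup>+y. (\<integral>\<^sup>+x. ennreal ((norm (F (x, y)))\<^sup>2) \<partial>m1) \<partial>m2)"
      unfolding sqnorm_def by (subst G1.nn_integral_fst[symmetric]) auto
    also have "\<dots> = sqnorm ?P F" unfolding sqnorm_def by (rule nn_integral_snd) measurable
    finally show ?thesis .
  qed
  have s_L2: "?s \<in> L2 ?Q" using \<xi> sq[of \<xi>] by (simp add: L2_iff_sqnorm)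
  have "AE z in ?P. conv_op (tensor_measure \<mu> \<kappa>) \<xi> z = conv_op (tensor_measure \<kappa> \<mu>) ?s (snd z, fst z)"
  proof -
    have "AE z in ?Q. conv_op (tensor_measure \<kappa> \<mu>) ?s z = (\<integral>w. ?s (- (fst w, \<pi> (snd w)) + z) * (k (fst w) * h (snd w)) \<partial>(N \<Otimes>\<^sub>M M))"
      using S.P.conv_op_eq_integral[OF represents_tensor_measure[OF s r] s_L2] by eventually_elim simp
    \<comment> \<open>The null set lives on the product in the opposite order; writing that measure
      as an image under the swap transports it back.\<close>
    then have "AE z in distr ?P ?Q (\<lambda>(x, y). (y, x)). conv_op (tensor_measure \<kappa> \<mu>) ?s z = (\<integral>w. ?s (- (fst w, \<pi> (snd w)) + z) * (k (fst w) * h (snd w)) \<partial>(N \<Otimes>\<^sub>M M))"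
      unfolding S.distr_pair_swap[symmetric] .
    then have "AE z in ?P. conv_op (tensor_measure \<kappa> \<mu>) ?s (snd z, fst z) =
        (\<integral>w. ?s (- (fst w, \<pi> (snd w)) + (snd z, fst z)) * (k (fst w) * h (snd w)) \<partial>(N \<Otimes>\<^sub>M M))"
      by (drule_tac AE_distrD[rotated]) (auto simp: case_prod_beta)
    then show ?thesis
      using P.conv_op_eq_integral[OF represents_tensor_measure[OF r s] \<xi>]
    proof eventually_elim
      case (elim z)
      have "(\<integral>w. ?s (- (fst w, \<pi> (snd w)) + (snd z, fst z)) * (k (fst w) * h (snd w)) \<partial>(N \<Otimes>\<^sub>M M))
          = (\<integral>(x, y). (\<lambda>w. ?s (- (fst w, \<pi> (snd w)) + (snd z, fst z)) * (k (fst w) * h (snd w))) (y, x) \<partial>(M \<Otimes>\<^sub>M N))"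
        by (rule Q.integral_product_swap[symmetric]) measurable
      also have "\<dots> = (\<integral>w. \<xi> (- (\<pi> (fst w), snd w) + z) * (h (fst w) * k (snd w)) \<partial>(M \<Otimes>\<^sub>M N))"
        by (intro Bochner_Integration.integral_cong) (auto simp: mult_ac plus_prod_def)
      finally show ?case using elim by simp
    qed
  qed
  then have "sqnorm ?P (conv_op (tensor_measure \<mu> \<kappa>) \<xi>) = sqnorm ?P (\<lambda>z. conv_op (tensor_measure \<kappa> \<mu>) ?s (snd z, fst z))"
    by (rule sqnorm_cong_AE)
  also have "\<dots> = sqnorm ?Q (conv_op (tensor_measure \<kappa> \<mu>) ?s)"
  proof -
    have [measurable]: "conv_op (tensor_measure \<kappa> \<mu>) ?s \<in> borel_measurable borel"
      by (rule S.P.conv_op_measurable[OF c(1)]) measurable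
    show ?thesis by (subst sq[symmetric]) simp_all
  qed
  also have "\<dots> \<le> ennreal ((\<integral>w. norm (h w) \<partial>M)\<^sup>2 * e) * sqnorm ?Q ?s"
    by (rule op_boundD[OF S.op_bound_tensor_measure_left[OF \<kappa> r e] s_L2])
  also have "sqnorm ?Q ?s = sqnorm ?P \<xi>" by (rule sq) measurable
  finally show "sqnorm ?P (conv_op (tensor_measure \<mu> \<kappa>) \<xi>) \<le> ennreal ((\<integral>w. norm (h w) \<partial>M)\<^sup>2 * e) * sqnorm ?P \<xi>" .
qed

lemma conv_op_tensor_measure_diff:
  assumes c: "complex_borel_measure \<mu>1" "complex_borel_measure \<nu>1" "complex_borel_measure \<mu>2" "complex_borel_measure \<nu>2"
    and \<xi>: "\<xi> \<in> L2 (m1 \<Otimes>\<^sub>M m2)"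
  shows "AE z in m1 \<Otimes>\<^sub>M m2. conv_op (\<lambda>A. tensor_measure \<mu>1 \<mu>2 A - tensor_measure \<nu>1 \<nu>2 A) \<xi> z =
    conv_op (tensor_measure (\<lambda>A. \<mu>1 A - \<nu>1 A) \<mu>2) \<xi> z + conv_op (tensor_measure \<nu>1 (\<lambda>A. \<mu>2 A - \<nu>2 A)) \<xi> z"
proof -
  obtain M h1 k1 where "finite_measure M" "sets M = sets borel"
    and r: "represents \<mu>1 M (\<lambda>x. x) h1" "represents \<nu>1 M (\<lambda>x. x) k1" by (rule represents_common[OF c(1,2)])
  obtain N h2 k2 where "finite_measure N" "sets N = sets borel"
    and s: "represents \<mu>2 N (\<lambda>x. x) h2" "represents \<nu>2 N (\<lambda>x. x) k2" by (rule represents_common[OF c(3,4)])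
  show ?thesis
    using P.conv_op_eq_integral[OF represents_diff[OF represents_tensor_measure[OF r(1) s(1)] represents_tensor_measure[OF r(2) s(2)]] \<xi>]
      P.conv_op_eq_integral[OF represents_tensor_measure[OF represents_diff[OF r] s(1)] \<xi>]
      P.conv_op_eq_integral[OF represents_tensor_measure[OF r(2) represents_diff[OF s]] \<xi>]
  proof eventually_elim
    case (elim z)
    then show ?case
      by (simp flip: Bochner_Integration.integral_add) (simp add: algebra_simps)
  qed
qed

lemma tensor_measure_L1_measure:
  assumes f: "f \<in> L1 m1" and g: "g \<in> L1 m2"
  shows "tensor f g \<in> L1 (m1 \<Otimes>\<^sub>M m2)"
    and "A \<in> sets borel \<Longrightarrow> tensor_measure (L1_measure m1 f) (L1_measure m2 g) A = L1_measure (m1 \<Otimes>\<^sub>M m2) (tensor f g) A"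
proof -
  show t: "tensor f g \<in> L1 (m1 \<Otimes>\<^sub>M m2)"
    using f g integrable_tensor(1)[of m1 m2 f g] G1.sigma_finite_measure_axioms G2.sigma_finite_measure_axioms
    by (simp add: L1_def tensor_def[abs_def])
  assume A: "A \<in> sets borel"
  show "tensor_measure (L1_measure m1 f) (L1_measure m2 g) A = L1_measure (m1 \<Otimes>\<^sub>M m2) (tensor f g) A"
    using representsD(5)[OF represents_tensor_measure[OF G1.represents_L1_measure[OF f] G2.represents_L1_measure[OF g]] A]
      representsD(5)[OF P.represents_L1_measure[OF t] A]
    by (simp add: tensor_def)
qed

lemma approximable_tensor_measure:
  assumes \<mu>: "complex_borel_measure \<mu>" "approximable m1 \<mu>" and \<nu>: "complex_borel_measure \<nu>" "approximable m2 \<nu>"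
  shows "approximable (m1 \<Otimes>\<^sub>M m2) (tensor_measure \<mu> \<nu>)"
  unfolding approximable_def
proof (intro allI impI)
  let ?P = "m1 \<Otimes>\<^sub>M m2"
  fix \<epsilon> :: real assume \<epsilon>: "0 < \<epsilon>"
  obtain N k where "finite_measure N" "sets N = sets borel" and s: "represents \<nu> N (\<lambda>x. x) k"
    by (rule represents_common[OF \<nu>(1) \<nu>(1)])
  \<comment> \<open>The total mass q of the other factor enters squared and may be 0, whence the 1
    in the denominator. Each of the two errors is kept below \<open>\<epsilon> / 4\<close> because
    \<open>sqnorm_add_le\<close> doubles both.\<close>
  have frac: "0 < \<epsilon> / (4 * (q\<^sup>2 + 1))" "q\<^sup>2 * (\<epsilon> / (4 * (q\<^sup>2 + 1))) \<le> \<epsilon> / 4" for q :: real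
    using \<epsilon> by (auto simp: field_simps add_pos_nonneg intro!: divide_pos_pos)
  obtain f where f: "f \<in> L1 m1"
    "op_bound m1 (conv_op (\<lambda>A. \<mu> A - L1_measure m1 f A)) (\<epsilon> / (4 * ((\<integral>w. norm (k w) \<partial>N)\<^sup>2 + 1)))"
    using \<mu>(2) frac(1) unfolding approximable_def by blast
  obtain g where g: "g \<in> L1 m2"
    "op_bound m2 (conv_op (\<lambda>A. \<nu> A - L1_measure m2 g A)) (\<epsilon> / (4 * ((\<integral>x. norm (f x) \<partial>m1)\<^sup>2 + 1)))"
    using \<nu>(2) frac(1) unfolding approximable_def by blast
  note cf = G1.complex_borel_measure_L1_measure[OF f(1)] and cg = G2.complex_borel_measure_L1_measure[OF g(1)]
  note c1 = complex_borel_measure_diff[OF \<mu>(1) cf] and c2 = complex_borel_measure_diff[OF \<nu>(1) cg]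
  let ?D1 = "tensor_measure (\<lambda>A. \<mu> A - L1_measure m1 f A) \<nu>"
  let ?D2 = "tensor_measure (L1_measure m1 f) (\<lambda>A. \<nu> A - L1_measure m2 g A)"
  let ?D = "\<lambda>A. tensor_measure \<mu> \<nu> A - L1_measure ?P (tensor f g) A"
  have b1: "op_bound ?P (conv_op ?D1) (\<epsilon> / 4)"
    by (rule op_bound_mono[OF op_bound_tensor_measure_left[OF c1 s f(2) less_imp_le[OF frac(1)]] frac(2)])
  have b2: "op_bound ?P (conv_op ?D2) (\<epsilon> / 4)"
    by (rule op_bound_mono[OF op_bound_tensor_measure_right[OF c2 G1.represents_L1_measure[OF f(1)] g(2) less_imp_le[OF frac(1)]] frac(2)])
  have "op_bound ?P (conv_op ?D) \<epsilon>"
    unfolding op_bound_def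
  proof
    fix \<xi> assume \<xi>: "\<xi> \<in> L2 ?P"
    note cD = complex_borel_measure_diff[OF complex_borel_measure_tensor_measure[OF \<mu>(1) \<nu>(1)] complex_borel_measure_tensor_measure[OF cf cg]]
    have "AE z in ?P. conv_op ?D \<xi> z = conv_op (\<lambda>A. tensor_measure \<mu> \<nu> A - tensor_measure (L1_measure m1 f) (L1_measure m2 g) A) \<xi> z"
      by (rule P.conv_op_cong[OF cD _ \<xi>]) (simp add: tensor_measure_L1_measure(2)[OF f(1) g(1)])
    then have "AE z in ?P. conv_op ?D \<xi> z = conv_op ?D1 \<xi> z + conv_op ?D2 \<xi> z"
      using conv_op_tensor_measure_diff[OF \<mu>(1) cf \<nu>(1) cg \<xi>] by eventually_elim simp
    then have "sqnorm ?P (conv_op ?D \<xi>) = sqnorm ?P (\<lambda>z. conv_op ?D1 \<xi> z + conv_op ?D2 \<xi> z)" by (rule sqnorm_cong_AE)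
    also have "\<dots> \<le> 2 * sqnorm ?P (conv_op ?D1 \<xi>) + 2 * sqnorm ?P (conv_op ?D2 \<xi>)"
      using P.conv_op_L2[OF complex_borel_measure_tensor_measure[OF c1 \<nu>(1)] \<xi>]
        P.conv_op_L2[OF complex_borel_measure_tensor_measure[OF cf c2] \<xi>]
      by (intro sqnorm_add_le) (auto simp: L2_def)
    also have "\<dots> \<le> 2 * (ennreal (\<epsilon> / 4) * sqnorm ?P \<xi>) + 2 * (ennreal (\<epsilon> / 4) * sqnorm ?P \<xi>)"
      by (intro add_mono mult_left_mono op_boundD[OF b1 \<xi>] op_boundD[OF b2 \<xi>]) auto
    also have "\<dots> = (ennreal 2 * ennreal (\<epsilon> / 4) + ennreal 2 * ennreal (\<epsilon> / 4)) * sqnorm ?P \<xi>"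
      by (simp add: distrib_right mult.assoc)
    also have "ennreal 2 * ennreal (\<epsilon> / 4) + ennreal 2 * ennreal (\<epsilon> / 4) = ennreal \<epsilon>"
      using \<epsilon> by (simp flip: ennreal_mult ennreal_plus del: ennreal_numeral)
    finally show "sqnorm ?P (conv_op ?D \<xi>) \<le> ennreal \<epsilon> * sqnorm ?P \<xi>" .
  qed
  then show "\<exists>f\<in>L1 ?P. op_bound ?P (conv_op (\<lambda>A. tensor_measure \<mu> \<nu> A - L1_measure ?P f A)) \<epsilon>"
    using tensor_measure_L1_measure(1)[OF f(1) g(1)] by blast
qed

text \<open>The identity lambda(mu x nu) = lambda(mu) x lambda(nu) on elementary tensors. The nested
  form allows fixing x and arguing about y alone, as the proof of nonvanishing does.\<close>

lemma conv_op_tensor_measure_tensor: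
  assumes c: "complex_borel_measure \<mu>" "complex_borel_measure \<nu>" and \<xi>: "\<xi> \<in> L2 m1" and \<eta>: "\<eta> \<in> L2 m2"
  shows "AE x in m1. AE y in m2. conv_op (tensor_measure \<mu> \<nu>) (tensor \<xi> \<eta>) (x, y) = conv_op \<mu> \<xi> x * conv_op \<nu> \<eta> y"
proof -
  obtain M h where "finite_measure M" "sets M = sets borel" and r: "represents \<mu> M (\<lambda>x. x) h"
    by (rule represents_common[OF c(1) c(1)])
  obtain N k where "finite_measure N" "sets N = sets borel" and s: "represents \<nu> N (\<lambda>x. x) k"
    by (rule represents_common[OF c(2) c(2)])
  show ?thesis
    using AE_pair[OF P.conv_op_eq_integral[OF represents_tensor_measure[OF r s] tensor_L2[OF \<xi> \<eta>]]]
      G1.conv_op_eq_integral[OF r \<xi>]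
  proof eventually_elim
    case (elim x)
    note x = elim(2)
    show ?case
      using elim(1) G2.conv_op_eq_integral[OF s \<eta>]
    proof eventually_elim
      case (elim y)
      have "(\<integral>w. tensor \<xi> \<eta> (- (fst w, snd w) + (x, y)) * (h (fst w) * k (snd w)) \<partial>(M \<Otimes>\<^sub>M N))
          = (\<integral>w. (\<xi> (- fst w + x) * h (fst w)) * (\<eta> (- snd w + y) * k (snd w)) \<partial>(M \<Otimes>\<^sub>M N))"
        by (simp add: tensor_def mult_ac)
      also have "\<dots> = (\<integral>w. \<xi> (- w + x) * h w \<partial>M) * (\<integral>w. \<eta> (- w + y) * k w \<partial>N)"
        using x elim(2) by (intro integrable_tensor(2) representsD(1)[OF r] representsD(1)[OF s]) auto
      finally show ?case using x elim by simp
    qed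
  qed
qed

theorem restricted_multiplicity_Times:
  assumes cl: "closed E1" "closed E2" and E1: "restricted_multiplicity m1 E1" and E2: "restricted_multiplicity m2 E2"
  shows "restricted_multiplicity (m1 \<Otimes>\<^sub>M m2) (E1 \<times> E2)"
proof -
  obtain \<mu> where \<mu>: "\<mu> \<in> measures_on E1" "approximable m1 \<mu>" "conv_op \<mu> \<notin> L2_zero_ops m1"
    using E1 unfolding restricted_multiplicity_def G1.extended_uniqueness_iff by blast
  obtain \<nu> where \<nu>: "\<nu> \<in> measures_on E2" "approximable m2 \<nu>" "conv_op \<nu> \<notin> L2_zero_ops m2"
    using E2 unfolding restricted_multiplicity_def G2.extended_uniqueness_iff by blast
  have c: "complex_borel_measure \<mu>" "complex_borel_measure \<nu>" using \<mu>(1) \<nu>(1) by (auto simp: measures_on_def)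
  obtain \<xi> where \<xi>: "\<xi> \<in> L2 m1" "\<not> (AE x in m1. conv_op \<mu> \<xi> x = 0)" using \<mu>(3) by (auto simp: L2_zero_ops_def)
  obtain \<eta> where \<eta>: "\<eta> \<in> L2 m2" "\<not> (AE y in m2. conv_op \<nu> \<eta> y = 0)" using \<nu>(3) by (auto simp: L2_zero_ops_def)
  have "\<not> (AE z in m1 \<Otimes>\<^sub>M m2. conv_op (tensor_measure \<mu> \<nu>) (tensor \<xi> \<eta>) z = 0)"
  proof
    assume "AE z in m1 \<Otimes>\<^sub>M m2. conv_op (tensor_measure \<mu> \<nu>) (tensor \<xi> \<eta>) z = 0"
    then have "AE x in m1. AE y in m2. conv_op (tensor_measure \<mu> \<nu>) (tensor \<xi> \<eta>) (x, y) = 0" by (rule AE_pair)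
    then have "AE x in m1. conv_op \<mu> \<xi> x = 0"
      using conv_op_tensor_measure_tensor[OF c \<xi>(1) \<eta>(1)]
    proof eventually_elim
      case (elim x)
      then have "AE y in m2. conv_op \<mu> \<xi> x * conv_op \<nu> \<eta> y = 0" by eventually_elim simp
      \<comment> \<open>If the first factor were nonzero at x, the second would vanish for almost
        every y, contrary to the choice of \<open>\<eta>\<close>.\<close>
      then show ?case using \<eta>(2) by (cases "conv_op \<mu> \<xi> x = 0") auto
    qed
    then show False using \<xi>(2) by simp
  qed
  then have "conv_op (tensor_measure \<mu> \<nu>) \<notin> L2_zero_ops (m1 \<Otimes>\<^sub>M m2)"
    using tensor_L2[OF \<xi>(1) \<eta>(1)] by (auto simp: L2_zero_ops_def)
  then show ?thesis
    unfolding restricted_multiplicity_def P.extended_uniqueness_iff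
    using approximable_tensor_measure[OF c(1) \<mu>(2) c(2) \<nu>(2)] tensor_measure_measures_on[OF \<mu>(1) \<nu>(1) cl] by blast
qed

end

theorem corollary3p17:
  fixes m1 :: "'a::{topological_group_add, t2_space, second_countable_topology} measure"
    and m2 :: "'b::{topological_group_add, t2_space, second_countable_topology} measure"
    and m :: "('a \<times> 'b) measure"
    and E1 :: "'a set" and E2 :: "'b set"
  assumes "locally_compact_space (euclidean :: 'a topology)"
    and "locally_compact_space (euclidean :: 'b topology)"
    and "left_haar_measure m1" and "left_haar_measure m2" and "left_haar_measure m"
    and "closed E1" and "closed E2"
  shows "(restricted_multiplicity m1 E1 \<and> restricted_multiplicity m2 E2
            \<longrightarrow> restricted_multiplicity m (E1 \<times> E2)) \<and>
         (extended_uniqueness m1 E1 \<and> extended_uniqueness m2 E2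
            \<longrightarrow> extended_uniqueness m (E1 \<times> E2))"
proof -
  interpret left_invariant_pair m1 m2
    using assms by (intro left_invariant_pair.intro left_haar_left_invariant)
  show ?thesis
    using restricted_multiplicity_Times[OF assms(6,7)] extended_uniqueness_Times[OF assms(6), of E2]
    unfolding restricted_multiplicity_def extended_uniqueness_pair_measure[OF assms(1-5)] by blast
qed

end
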